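(* Let $S$ be a compact space, $\mu$ a positive Radon measure on $S$, $(h_\iota)_{\iota\in I}$ an orthonormal basis of $L^2(\mu)$, $H$ the C*-direct sum of copies of $E$ indexed by $I$, and $w\in\mathcal{C}(S\times S,E)$. Let $\tilde w:H\to H$ be the integral operator with kernel $w$ (defined in the context). Then $\tilde w\in\mathcal{L}^2_E(H)$ (i.e. $\tilde w$ is a Hilbert–Schmidt operator on $H$) and $\tilde w^*=\widetilde{w'}$, where $$w':S\times S\to E,\qquad (r,s)\mapsto w(s,r)^*$$ and $\widetilde{w'}$ is defined from $w'$ in the same way as $\tilde w$ from $w$.
   Context: $\mathbb{K}$ is $\mathbb{R}$ or $\mathbb{C}$; $\mathbb{N}=\{1,2,\dots\}$. $T$ is a compact hyperstonian space and $E:=\mathcal{C}(T)$ is the commutative C*-algebra of continuous $\mathbb{K}$-valued functions on $T$. $H$ is the Hilbert right $E$-module of families $\xi=(\xi_\iota)_{\iota\in I}$ in $E$ with $\sum_\iota\xi_\iota^*\xi_\iota$ norm-summable in $E$, with $\langle\xi|\eta\rangle=\sum_\iota\eta_\iota^*\xi_\iota$. $\mathcal{C}(S,E)$, $\mathcal{C}(S\times S,E)$ are the Banach spaces of continuous $E$-valued maps. Integrals of $E$-valued maps: for $g:S\to E$, $\int g\,d\mu$ denotes the function $t\mapsto\int g(s)(t)\,d\mu(s)$ on $T$, when each $s\mapsto g(s)(t)$ is $\mu$-integrable and the resulting function is in $E$. The operator $\tilde w$: the Hilbert right $E$-module (exterior) tensor product $L^2(\mu)\otimes E$ is identified with $H$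 through the isomorphism extending $f\otimes x\mapsto(\langle f|h_\iota\rangle x)_{\iota\in I}$. For $f\in L^2(\mu)$ the map $\tilde f:S\to E$, $r\mapsto\int w(r,s)f(s)\,d\mu(s)$ is continuous. $\mathcal{C}(S,E)\approx\mathcal{C}(S)\otimes E$ maps continuously into $L^2(\mu)\otimes E\approx H$ (a map $g\in\mathcal{C}(S,E)$ corresponds to $(\int g\,\overline{h_\iota}\,d\mu)_{\iota\in I}\in H$). The linear map defined on the algebraic tensor product $L^2(\mu)\odot E$ by $f\otimes x\mapsto\tilde f x\in \mathcal{C}(S,E)\to H$ is continuous, and $\tilde w:H\to H$ is its extension by continuity. $\mathcal{L}_E(H)$ is the C*-algebra of adjointable operators on $H$, $\mathcal{K}_E(H)$ the closed linear span in it of the operators $\xi\langle\cdot|\eta\rangle:\zeta\mapsto\xi\langle\zeta|\eta\rangle$. For $t\in T$ and $u\in\mathcal{L}_E(H)$, $\varphi_tu:=\psi_t\circ u\circ\psi\in\mathcal{L}(l^2(I))$, where $\psi:l^2(I)\to H$, $\zeta\mapsto(\zeta_\iota1_E)_\iota$, and $\psi_t:H\to l^2(I)$, $\xi\mapsto(\xi_\iota(t))_\iota$. For $u\in\mathcal{K}_E(H)$ each $\varphi_tu$ is compact and $\theta_n(u)\in E$ is the continuous function $t\mapsto\theta_n(\varphi_tu)$, where $\theta_n(x)$ denotes the $n$-th singular value of a compact operator $x$ (decreasing order, with multiplicity, completed by $0$). $\mathcal{L}^2_E(H)$ is the set of $u\in\mathcal{K}_E(H)$ such that $(\theta_n(u)^2)_{n\in\mathbb{N}}$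 is (norm-)summable in $E$; its elements are called Hilbert–Schmidt operators on $H$. *)

theory Defs
  imports "HOL-Analysis.Analysis" "HOL-Library.Function_Algebras"
begin

section \<open>The scalar field\<close>

text \<open>
  The instances \<^typ>\<open>real\<close> and \<^typ>\<open>complex\<close> below are, up to isomorphism, the only ones: a complete
  real normed field is \<open>\<real>\<close> or \<open>\<complex>\<close>, and \<open>mult_kcnj\<close> then determines the conjugation.
\<close>

class real_or_complex = real_normed_field + euclidean_space +
  fixes kcnj :: "'a \<Rightarrow> 'a"
  assumes kcnj_add: "kcnj (x + y) = kcnj x + kcnj y"
    and kcnj_mult: "kcnj (x * y) = kcnj x * kcnj y"
    and kcnj_kcnj: "kcnj (kcnj x) = x"
    and mult_kcnj: "x * kcnj x = scaleR ((norm x)\<^sup>2) 1"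

instantiation real :: real_or_complex
begin
definition kcnj_real :: "real \<Rightarrow> real" where "kcnj_real x = x"
instance by standard (auto simp: kcnj_real_def power2_eq_square)
end

instantiation complex :: real_or_complex
begin
definition kcnj_complex :: "complex \<Rightarrow> complex" where "kcnj_complex = cnj"
instance
proof
  fix x y :: complex
  show "kcnj (x + y) = kcnj x + kcnj y" by (simp add: kcnj_complex_def)
  show "kcnj (x * y) = kcnj x * kcnj y" by (simp add: kcnj_complex_def)
  show "kcnj (kcnj x) = x" by (simp add: kcnj_complex_def)
  show "x * kcnj x = scaleR ((norm x)\<^sup>2) 1"
    unfolding kcnj_complex_def scaleR_conv_of_real by (metis complex_norm_square mult.right_neutral)
qed
end

lemma kcnj_zero [simp]: "kcnj (0::'k::real_or_complex) = 0"
  using kcnj_add [of 0 "0::'k"] by simp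

lemma norm_kcnj [simp]: "norm (kcnj (x::'k::real_or_complex)) = norm x"
proof (cases "x = 0")
  case False
  have "norm x * norm (kcnj x) = norm x * norm x"
    using arg_cong [OF mult_kcnj [of x], of norm] by (simp add: norm_mult power2_eq_square)
  then show ?thesis using False by simp
qed simp

lemma kcnj_diff: "kcnj (x - y) = kcnj x - kcnj (y::'k::real_or_complex)"
  using kcnj_add [of "x - y" y] by simp

lemma continuous_on_kcnj:
  "continuous_on A f \<Longrightarrow> continuous_on A (\<lambda>x. kcnj (f x :: 'k::real_or_complex))"
proof (rule continuous_on_compose2 [of UNIV kcnj])
  show "continuous_on UNIV (kcnj :: 'k \<Rightarrow> 'k)"
    unfolding continuous_on_iff dist_norm kcnj_diff [symmetric] norm_kcnj by auto
qed auto

section \<open>The algebra of continuous functions\<close>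

unbundle bcontfun.lifting

instantiation bcontfun :: (topological_space, real_normed_field) real_normed_algebra_1
begin

lift_definition one_bcontfun :: "'a \<Rightarrow>\<^sub>C 'b" is "\<lambda>_. 1"
  by (rule const_bcontfun)

lift_definition times_bcontfun :: "('a \<Rightarrow>\<^sub>C 'b) \<Rightarrow> ('a \<Rightarrow>\<^sub>C 'b) \<Rightarrow> 'a \<Rightarrow>\<^sub>C 'b"
  is "\<lambda>f g x. f x * g x"
proof -
  fix f g :: "'a \<Rightarrow> 'b"
  assume fg: "f \<in> bcontfun" "g \<in> bcontfun"
  then obtain a b where ab: "\<And>x. norm (f x) \<le> a" "\<And>x. norm (g x) \<le> b"
    by (auto simp: bcontfun_def bounded_iff)
  show "(\<lambda>x. f x * g x) \<in> bcontfun"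
  proof (rule bcontfun_normI)
    show "continuous_on UNIV (\<lambda>x. f x * g x)"
      using fg by (auto simp: bcontfun_def intro!: continuous_intros)
    show "norm (f x * g x) \<le> a * b" for x
      unfolding norm_mult by (rule mult_mono [OF ab order_trans [OF norm_ge_zero ab(1)] norm_ge_zero])
  qed
qed

instance
proof
  fix f g k :: "'a \<Rightarrow>\<^sub>C 'b" and r :: real
  note rep = times_bcontfun.rep_eq one_bcontfun.rep_eq plus_bcontfun.rep_eq scaleR_bcontfun.rep_eq
  show "f * g * k = f * (g * k)" by (rule bcontfun_eqI) (simp add: rep mult.assoc)
  show "(f + g) * k = f * k + g * k" by (rule bcontfun_eqI) (simp add: rep distrib_right)
  show "f * (g + k) = f * g + f * k" by (rule bcontfun_eqI) (simp add: rep distrib_left)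
  show "r *\<^sub>R f * g = r *\<^sub>R (f * g)" by (rule bcontfun_eqI) (simp add: rep)
  show "f * r *\<^sub>R g = r *\<^sub>R (f * g)" by (rule bcontfun_eqI) (simp add: rep)
  show "1 * f = f" by (rule bcontfun_eqI) (simp add: rep)
  show "f * 1 = f" by (rule bcontfun_eqI) (simp add: rep)
  have "apply_bcontfun (0::'a \<Rightarrow>\<^sub>C 'b) undefined \<noteq> apply_bcontfun 1 undefined"
    by (simp add: rep zero_bcontfun.rep_eq)
  then show "(0::'a \<Rightarrow>\<^sub>C 'b) \<noteq> 1" by metis
  show "norm (f * g) \<le> norm f * norm g"
  proof (rule norm_bound)
    fix x
    have "norm (f x) * norm (g x) \<le> norm f * norm g"
      by (intro mult_mono norm_bounded norm_ge_zero)
    then show "norm ((f * g) x) \<le> norm f * norm g"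
      unfolding times_bcontfun.rep_eq norm_mult .
  qed
  show "norm (1::'a \<Rightarrow>\<^sub>C 'b) = 1"
  proof (rule antisym)
    show "norm (1::'a \<Rightarrow>\<^sub>C 'b) \<le> 1" by (rule norm_bound) (simp add: rep)
    show "1 \<le> norm (1::'a \<Rightarrow>\<^sub>C 'b)"
      using norm_bounded [of "1::'a \<Rightarrow>\<^sub>C 'b" undefined] by (simp add: rep)
  qed
qed

end

instance bcontfun :: (topological_space, real_normed_field) comm_ring_1
proof
  fix f g k :: "'a \<Rightarrow>\<^sub>C 'b"
  show "f * g = g * f"
    by (rule bcontfun_eqI) (simp add: times_bcontfun.rep_eq mult.commute)
  show "(f + g) * k = f * k + g * k" by (rule distrib_right)
  show "1 * f = f" by (rule mult_1_left)
qed

lift_definition star :: "('t::topological_space \<Rightarrow>\<^sub>C 'k::real_or_complex) \<Rightarrow> 't \<Rightarrow>\<^sub>C 'k"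
  is "\<lambda>f t. kcnj (f t)"
  by (auto simp: bcontfun_def bounded_iff intro: continuous_on_kcnj)

text \<open>
  The right-hand side is in \<open>\<C>(T)\<close> only if \<open>t \<mapsto> \<integral>g(s)(t) d\<mu>(s)\<close> is continuous (and bounded);
  otherwise the value is unspecified. Non-integrable integrands contribute the value \<open>0\<close>.
\<close>

definition Eintegral :: "'s measure \<Rightarrow> ('s \<Rightarrow> ('t::topological_space \<Rightarrow>\<^sub>C 'k::real_or_complex)) \<Rightarrow> 't \<Rightarrow>\<^sub>C 'k"
  where "Eintegral \<mu> g = Bcontfun (\<lambda>t. \<integral>s. apply_bcontfun (g s) t \<partial>\<mu>)"

section \<open>Radon measures and hyperstonian spaces\<close>

definition radon_measure :: "'s::t2_space measure \<Rightarrow> bool"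
  where "radon_measure \<mu> \<longleftrightarrow> sets \<mu> = sets borel \<and> finite_measure \<mu> \<and>
    (\<forall>A\<in>sets borel. emeasure \<mu> A = (SUP K\<in>{K. compact K \<and> K \<subseteq> A}. emeasure \<mu> K))"

definition measure_support :: "'s::topological_space measure \<Rightarrow> 's set"
  where "measure_support \<mu> = {x. \<forall>U. open U \<and> x \<in> U \<longrightarrow> emeasure \<mu> U > 0}"

definition bcontfun_le :: "('t::topological_space \<Rightarrow>\<^sub>C real) \<Rightarrow> ('t \<Rightarrow>\<^sub>C real) \<Rightarrow> bool"
  where "bcontfun_le f g \<longleftrightarrow> (\<forall>t. apply_bcontfun f t \<le> apply_bcontfun g t)"

text \<open>
  Normality in the sense of Dixmier: the integral preserves the suprema, formed in the lattice
  \<open>\<C>(T, \<real>)\<close> (not pointwise), of upward directed families.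
\<close>

definition normal_measure :: "'t::t2_space measure \<Rightarrow> bool"
  where "normal_measure \<nu> \<longleftrightarrow> radon_measure \<nu> \<and>
    (\<forall>(F :: ('t \<Rightarrow>\<^sub>C real) set) f.
       F \<noteq> {} \<and> (\<forall>g\<in>F. \<forall>g'\<in>F. \<exists>k\<in>F. bcontfun_le g k \<and> bcontfun_le g' k) \<and>
       (\<forall>g\<in>F. bcontfun_le g f) \<and> (\<forall>k. (\<forall>g\<in>F. bcontfun_le g k) \<longrightarrow> bcontfun_le f k)
       \<longrightarrow> (\<integral>t. apply_bcontfun f t \<partial>\<nu>) = (SUP g\<in>F. \<integral>t. apply_bcontfun g t \<partial>\<nu>))"

definition hyperstonian :: "'t::t2_space itself \<Rightarrow> bool"
  where "hyperstonian _ \<longleftrightarrow> compact (UNIV :: 't set) \<and>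
    (\<forall>U :: 't set. open U \<longrightarrow> open (closure U)) \<and>
    closure (\<Union>\<nu>\<in>{\<nu> :: 't measure. normal_measure \<nu>}. measure_support \<nu>) = UNIV"

section \<open>The space \<open>L\<^sup>2(\<mu>)\<close>\<close>

text \<open>Elements of \<open>L\<^sup>2(\<mu>)\<close> are handled through their Borel representatives.\<close>

definition Lsq :: "'s measure \<Rightarrow> ('s \<Rightarrow> 'k::real_or_complex) set"
  where "Lsq \<mu> = {f. f \<in> borel_measurable \<mu> \<and> integrable \<mu> (\<lambda>s. (norm (f s))\<^sup>2)}"

definition Lsq_inner :: "'s measure \<Rightarrow> ('s \<Rightarrow> 'k::real_or_complex) \<Rightarrow> ('s \<Rightarrow> 'k) \<Rightarrow> 'k"
  where "Lsq_inner \<mu> f g = (\<integral>s. f s * kcnj (g s) \<partial>\<mu>)"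

definition Lsq_norm :: "'s measure \<Rightarrow> ('s \<Rightarrow> 'k::real_or_complex) \<Rightarrow> real"
  where "Lsq_norm \<mu> f = sqrt (\<integral>s. (norm (f s))\<^sup>2 \<partial>\<mu>)"

definition orthonormal_basis :: "'s measure \<Rightarrow> 'i set \<Rightarrow> ('i \<Rightarrow> 's \<Rightarrow> 'k::real_or_complex) \<Rightarrow> bool"
  where "orthonormal_basis \<mu> I h \<longleftrightarrow>
    (\<forall>i\<in>I. h i \<in> Lsq \<mu>) \<and>
    (\<forall>i\<in>I. \<forall>j\<in>I. Lsq_inner \<mu> (h i) (h j) = (if i = j then 1 else 0)) \<and>
    (\<forall>f\<in>Lsq \<mu>. \<forall>\<epsilon>>0. \<exists>J c. finite J \<and> J \<subseteq> I \<and> Lsq_norm \<mu> (\<lambda>s. f s - (\<Sum>i\<in>J. c i * h i s)) < \<epsilon>)"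

section \<open>The Hilbert module \<open>H\<close>\<close>

text \<open>
  Families indexed by \<open>I\<close> are functions on the whole index type vanishing off \<open>I\<close>; operators on \<open>H\<close>
  are elements of \<open>H \<rightarrow>\<^sub>E H\<close> (undefined off \<open>H\<close>), so that their equality is equality on \<open>H\<close>.
\<close>

definition Hmod :: "'i set \<Rightarrow> ('i \<Rightarrow> ('t::topological_space \<Rightarrow>\<^sub>C 'k::real_or_complex)) set"
  where "Hmod I = {\<xi>. (\<forall>i. i \<notin> I \<longrightarrow> \<xi> i = 0) \<and> (\<lambda>i. star (\<xi> i) * \<xi> i) summable_on I}"

definition Hinner :: "'i set \<Rightarrow> ('i \<Rightarrow> ('t::topological_space \<Rightarrow>\<^sub>C 'k::real_or_complex))
    \<Rightarrow> ('i \<Rightarrow> ('t \<Rightarrow>\<^sub>C 'k)) \<Rightarrow> 't \<Rightarrow>\<^sub>C 'k"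
  where "Hinner I \<xi> \<eta> = (\<Sum>\<^sub>\<infinity>i\<in>I. star (\<eta> i) * \<xi> i)"

definition Hnorm :: "'i set \<Rightarrow> ('i \<Rightarrow> ('t::topological_space \<Rightarrow>\<^sub>C 'k::real_or_complex)) \<Rightarrow> real"
  where "Hnorm I \<xi> = sqrt (norm (Hinner I \<xi> \<xi>))"

definition Hscale :: "'k \<Rightarrow> ('i \<Rightarrow> ('t::topological_space \<Rightarrow>\<^sub>C 'k::real_or_complex)) \<Rightarrow> 'i \<Rightarrow> ('t \<Rightarrow>\<^sub>C 'k)"
  where "Hscale c \<xi> = (\<lambda>i. const_bcontfun c * \<xi> i)"

definition Hopnorm :: "'i set \<Rightarrow> (('i \<Rightarrow> ('t::topological_space \<Rightarrow>\<^sub>C 'k::real_or_complex))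
    \<Rightarrow> ('i \<Rightarrow> ('t \<Rightarrow>\<^sub>C 'k))) \<Rightarrow> real"
  where "Hopnorm I u = (SUP \<zeta>\<in>{\<zeta>\<in>Hmod I. Hnorm I \<zeta> \<le> 1}. Hnorm I (u \<zeta>))"

definition is_adjoint_on :: "'a set \<Rightarrow> ('a \<Rightarrow> 'a \<Rightarrow> 'b) \<Rightarrow> ('a \<Rightarrow> 'a) \<Rightarrow> ('a \<Rightarrow> 'a) \<Rightarrow> bool"
  where "is_adjoint_on X ip u v \<longleftrightarrow>
    u \<in> X \<rightarrow>\<^sub>E X \<and> v \<in> X \<rightarrow>\<^sub>E X \<and> (\<forall>\<xi>\<in>X. \<forall>\<eta>\<in>X. ip (u \<xi>) \<eta> = ip \<xi> (v \<eta>))"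

definition adjoint_on :: "'a set \<Rightarrow> ('a \<Rightarrow> 'a \<Rightarrow> 'b) \<Rightarrow> ('a \<Rightarrow> 'a) \<Rightarrow> ('a \<Rightarrow> 'a)"
  where "adjoint_on X ip u = (THE v. is_adjoint_on X ip u v)"

definition adjointable_ops :: "'i set \<Rightarrow> (('i \<Rightarrow> ('t::topological_space \<Rightarrow>\<^sub>C 'k::real_or_complex))
    \<Rightarrow> ('i \<Rightarrow> ('t \<Rightarrow>\<^sub>C 'k))) set"
  where "adjointable_ops I = {u. \<exists>v. is_adjoint_on (Hmod I) (Hinner I) u v}"

definition rank_one :: "'i set \<Rightarrow> ('i \<Rightarrow> ('t::topological_space \<Rightarrow>\<^sub>C 'k::real_or_complex))
    \<Rightarrow> ('i \<Rightarrow> ('t \<Rightarrow>\<^sub>C 'k)) \<Rightarrow> ('i \<Rightarrow> ('t \<Rightarrow>\<^sub>C 'k)) \<Rightarrow> ('i \<Rightarrow> ('t \<Rightarrow>\<^sub>C 'k))"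
  where "rank_one I \<xi> \<eta> = (\<lambda>\<zeta>\<in>Hmod I. \<lambda>i. \<xi> i * Hinner I \<zeta> \<eta>)"

definition compact_ops :: "'i set \<Rightarrow> (('i \<Rightarrow> ('t::topological_space \<Rightarrow>\<^sub>C 'k::real_or_complex))
    \<Rightarrow> ('i \<Rightarrow> ('t \<Rightarrow>\<^sub>C 'k))) set"
  where "compact_ops I = {u \<in> adjointable_ops I. \<forall>\<epsilon>>0. \<exists>(n::nat) c \<xi> \<eta>.
    (\<forall>k<n. \<xi> k \<in> Hmod I \<and> \<eta> k \<in> Hmod I) \<and>
    Hopnorm I (\<lambda>\<zeta>. u \<zeta> - (\<Sum>k<n. Hscale (c k) (rank_one I (\<xi> k) (\<eta> k) \<zeta>))) < \<epsilon>}"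

section \<open>Singular values and Hilbert-Schmidt operators\<close>

definition l2 :: "'i set \<Rightarrow> ('i \<Rightarrow> 'k::real_or_complex) set"
  where "l2 I = {\<zeta>. (\<forall>i. i \<notin> I \<longrightarrow> \<zeta> i = 0) \<and> (\<lambda>i. (norm (\<zeta> i))\<^sup>2) summable_on I}"

definition l2_inner :: "'i set \<Rightarrow> ('i \<Rightarrow> 'k::real_or_complex) \<Rightarrow> ('i \<Rightarrow> 'k) \<Rightarrow> 'k"
  where "l2_inner I \<zeta> \<eta> = (\<Sum>\<^sub>\<infinity>i\<in>I. kcnj (\<eta> i) * \<zeta> i)"

definition fscale :: "'k::field \<Rightarrow> ('i \<Rightarrow> 'k) \<Rightarrow> 'i \<Rightarrow> 'k"
  where "fscale c \<zeta> = (\<lambda>i. c * \<zeta> i)"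

lemma vector_space_fscale: "vector_space fscale"
  by standard (auto simp: fscale_def fun_eq_iff algebra_simps)

text \<open>
  The singular values of \<open>x\<close> are the eigenvalues \<open>\<sigma>\<close> of \<open>\<bar>x\<bar>\<close>, the square root of \<open>x\<^sup>*x\<close>; as \<open>\<bar>x\<bar> \<ge> 0\<close>,
  the eigenspace of \<open>\<bar>x\<bar>\<close> for \<open>\<sigma> > 0\<close> is that of \<open>x\<^sup>*x\<close> for \<open>\<sigma>\<^sup>2\<close>. For compact \<open>x\<close> it is finite-dimensional and
  there is exactly one sequence \<open>\<theta>\<close> as below. Since \<open>dim\<close> and \<open>card\<close> are \<open>0\<close> in the infinite
  case, the definition is meaningful for compact \<open>x\<close> only. Sequences start at index \<open>0\<close>.
\<close>

definition sing_eigenspace :: "'i set \<Rightarrow> (('i \<Rightarrow> 'k::real_or_complex) \<Rightarrow> ('i \<Rightarrow> 'k)) \<Rightarrow> real \<Rightarrow> ('i \<Rightarrow> 'k) set"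
  where "sing_eigenspace I x \<sigma> =
    {\<zeta> \<in> l2 I. adjoint_on (l2 I) (l2_inner I) x (x \<zeta>) = fscale (of_real (\<sigma>\<^sup>2)) \<zeta>}"

definition singular_values :: "'i set \<Rightarrow> (('i \<Rightarrow> 'k::real_or_complex) \<Rightarrow> ('i \<Rightarrow> 'k)) \<Rightarrow> nat \<Rightarrow> real"
  where "singular_values I x = (THE \<theta>. decseq \<theta> \<and> (\<forall>n. 0 \<le> \<theta> n) \<and> \<theta> \<longlonglongrightarrow> 0 \<and>
    (\<forall>\<sigma>>0. card {n. \<theta> n = \<sigma>} = vector_space.dim fscale (sing_eigenspace I x \<sigma>)))"

definition psi :: "('i \<Rightarrow> 'k::real_or_complex) \<Rightarrow> 'i \<Rightarrow> ('t::topological_space \<Rightarrow>\<^sub>C 'k)"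
  where "psi \<zeta> = (\<lambda>i. const_bcontfun (\<zeta> i))"

definition psi_at :: "'t \<Rightarrow> ('i \<Rightarrow> ('t::topological_space \<Rightarrow>\<^sub>C 'k::real_or_complex)) \<Rightarrow> 'i \<Rightarrow> 'k"
  where "psi_at t \<xi> = (\<lambda>i. apply_bcontfun (\<xi> i) t)"

definition phi :: "'i set \<Rightarrow> 't \<Rightarrow> (('i \<Rightarrow> ('t::topological_space \<Rightarrow>\<^sub>C 'k::real_or_complex))
    \<Rightarrow> ('i \<Rightarrow> ('t \<Rightarrow>\<^sub>C 'k))) \<Rightarrow> ('i \<Rightarrow> 'k) \<Rightarrow> ('i \<Rightarrow> 'k)"
  where "phi I t u = (\<lambda>\<zeta>\<in>l2 I. psi_at t (u (psi \<zeta>)))"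

definition theta :: "'i set \<Rightarrow> (('i \<Rightarrow> ('t::topological_space \<Rightarrow>\<^sub>C 'k::real_or_complex))
    \<Rightarrow> ('i \<Rightarrow> ('t \<Rightarrow>\<^sub>C 'k))) \<Rightarrow> nat \<Rightarrow> 't \<Rightarrow>\<^sub>C 'k"
  where "theta I u n = Bcontfun (\<lambda>t. of_real (singular_values I (phi I t u) n))"

definition hilbert_schmidt_ops :: "'i set \<Rightarrow> (('i \<Rightarrow> ('t::topological_space \<Rightarrow>\<^sub>C 'k::real_or_complex))
    \<Rightarrow> ('i \<Rightarrow> ('t \<Rightarrow>\<^sub>C 'k))) set"
  where "hilbert_schmidt_ops I = {u \<in> compact_ops I. (\<lambda>n. (theta I u n)\<^sup>2) summable_on UNIV}"

section \<open>The integral operator with kernel \<open>w\<close>\<close>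

definition tensor_coords :: "'s measure \<Rightarrow> 'i set \<Rightarrow> ('i \<Rightarrow> 's \<Rightarrow> 'k::real_or_complex)
    \<Rightarrow> ('s \<Rightarrow> 'k) \<Rightarrow> ('t::topological_space \<Rightarrow>\<^sub>C 'k) \<Rightarrow> 'i \<Rightarrow> ('t \<Rightarrow>\<^sub>C 'k)"
  where "tensor_coords \<mu> I h f x = (\<lambda>i. if i \<in> I then const_bcontfun (Lsq_inner \<mu> f (h i)) * x else 0)"

definition continuous_coords :: "'s measure \<Rightarrow> 'i set \<Rightarrow> ('i \<Rightarrow> 's \<Rightarrow> 'k::real_or_complex)
    \<Rightarrow> ('s \<Rightarrow> ('t::topological_space \<Rightarrow>\<^sub>C 'k)) \<Rightarrow> 'i \<Rightarrow> ('t \<Rightarrow>\<^sub>C 'k)"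
  where "continuous_coords \<mu> I h g =
    (\<lambda>i. if i \<in> I then Eintegral \<mu> (\<lambda>r. g r * const_bcontfun (kcnj (h i r))) else 0)"

definition kernel_map :: "'s measure \<Rightarrow> ('s \<times> 's \<Rightarrow> ('t::topological_space \<Rightarrow>\<^sub>C 'k::real_or_complex))
    \<Rightarrow> ('s \<Rightarrow> 'k) \<Rightarrow> 's \<Rightarrow> ('t \<Rightarrow>\<^sub>C 'k)"
  where "kernel_map \<mu> w f r = Eintegral \<mu> (\<lambda>s. w (r, s) * const_bcontfun (f s))"

text \<open>
  The extension by continuity: the bounded linear operator on \<open>H\<close> with the prescribed values on the
  elementary tensors \<open>f \<otimes> x\<close>, whose linear span \<open>L\<^sup>2(\<mu>) \<odot> E\<close> is dense in \<open>H\<close>.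
\<close>

definition integral_op :: "'s measure \<Rightarrow> 'i set \<Rightarrow> ('i \<Rightarrow> 's \<Rightarrow> 'k::real_or_complex)
    \<Rightarrow> ('s \<times> 's \<Rightarrow> ('t::topological_space \<Rightarrow>\<^sub>C 'k))
    \<Rightarrow> ('i \<Rightarrow> ('t \<Rightarrow>\<^sub>C 'k)) \<Rightarrow> ('i \<Rightarrow> ('t \<Rightarrow>\<^sub>C 'k))"
  where "integral_op \<mu> I h w = (THE W. W \<in> Hmod I \<rightarrow>\<^sub>E Hmod I \<and>
    (\<forall>\<xi>\<in>Hmod I. \<forall>\<eta>\<in>Hmod I. W (\<xi> + \<eta>) = W \<xi> + W \<eta>) \<and>
    (\<forall>c. \<forall>\<xi>\<in>Hmod I. W (Hscale c \<xi>) = Hscale c (W \<xi>)) \<and>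
    (\<exists>C. \<forall>\<xi>\<in>Hmod I. Hnorm I (W \<xi>) \<le> C * Hnorm I \<xi>) \<and>
    (\<forall>f\<in>Lsq \<mu>. \<forall>x. W (tensor_coords \<mu> I h f x) =
       continuous_coords \<mu> I h (\<lambda>r. kernel_map \<mu> w f r * x)))"

end

theory Submission
  imports Defs
begin

text \<open>
  With respect to the basis \<open>h\<close>, the integral operator has the matrix
  \<open>a\<^sub>i\<^sub>j = \<integral>\<integral> w(r,s) h\<^sub>j(s) h\<^sub>i(r)\<^sup>* d\<mu>(s) d\<mu>(r)\<close>, whose entries are continuous functions on \<open>T\<close>
  (\<open>kernel_matrix\<close>), and everything follows from one property of this matrix: the family
  \<open>a\<^sub>i\<^sub>j\<^sup>* a\<^sub>i\<^sub>j\<close> is norm-summable in \<open>\<C>(T)\<close> over \<open>I \<times> I\<close>, that is, \<open>a\<close> is itself an element of the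
  Hilbert module over the index set \<open>I \<times> I\<close>.

  This property (\<open>kernel_matrix_Hmod\<close>) holds because \<open>w\<close> is a uniform limit of kernels which are constant
  on the boxes of a finite measurable partition (\<open>continuous_regulated_kernel\<close>). The matrix of such a step
  kernel is a finite sum of matrices \<open>\<alpha>\<^sub>i \<beta>\<^sub>j x\<close> with \<open>\<alpha>, \<beta>\<close> square-summable and \<open>x\<close> in \<open>\<C>(T)\<close>, and
  Bessel's inequality in each of the two variables bounds the square sum of the coefficients by the
  supremum norm of the kernel, uniformly on \<open>T\<close> (\<open>kernel_form_square_sum_le\<close>). Exchanging the order of
  integration shows that \<open>w'\<close> has the conjugate transpose of \<open>a\<close> as its matrix (\<open>kernel_matrix_adjoint\<close>),
  and the operator with matrix \<open>a\<close> is the unique one with the prescribed values on elementary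
  tensors (\<open>integral_op_eq_matrix_operator\<close>).

  It remains to see that a matrix in the Hilbert module defines a Hilbert-Schmidt operator
  (\<open>matrix_operator_hilbert_schmidt\<close>). Its finite truncations are sums of operators of rank one and
  approximate it in norm. At a point \<open>t\<close> of \<open>T\<close> it is an ordinary Hilbert-Schmidt matrix on \<open>l\<^sup>2(I)\<close>, whose
  singular values and vectors are found by successive maximisation of the norm: the unit ball is
  compact for coordinatewise convergence, and the matrix has a continuous norm function there
  (\<open>singular_system_exists\<close>). Weyl's inequality (\<open>singular_value_le\<close>) then does the rest. Comparing the
  matrix at two points gives the continuity of the singular values in \<open>t\<close>; comparing it with its
  remainder after a truncation to \<open>N\<close> columns shows that the square sum of the singular values from the
  \<open>N\<close>-th on is at most that of the entries of the remainder, which is small uniformly on \<open>T\<close>.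
\<close>


section \<open>Conjugation and sesquilinear forms\<close>

lemma kcnj_one [simp]: "kcnj (1::'k::real_or_complex) = 1"
  using mult_kcnj [of "1::'k"] by simp

lemma kcnj_of_real [simp]: "kcnj (of_real r :: 'k::real_or_complex) = of_real r"
proof (cases "r = 0")
  case False
  have "of_real r * kcnj (of_real r) = (of_real r * of_real r :: 'k)"
    using mult_kcnj [of "of_real r :: 'k"] by (simp add: scaleR_conv_of_real power2_eq_square flip: of_real_mult)
  with False show ?thesis by simp
qed simp

lemma mult_kcnj_of_real: "x * kcnj x = of_real ((norm (x::'k::real_or_complex))\<^sup>2)"
  by (simp add: mult_kcnj scaleR_conv_of_real)

lemma kcnj_mult_of_real: "kcnj x * x = of_real ((norm (x::'k::real_or_complex))\<^sup>2)"
  by (metis mult.commute mult_kcnj_of_real)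

lemma kcnj_minus: "kcnj (- x) = - kcnj (x::'k::real_or_complex)"
  using kcnj_diff [of 0 x] by simp

lemma bounded_linear_kcnj: "bounded_linear (kcnj :: 'k::real_or_complex \<Rightarrow> 'k)"
proof (rule bounded_linear_intro [where K = 1])
  show "kcnj (scaleR r x) = scaleR r (kcnj x)" for r and x :: 'k
    by (simp add: scaleR_conv_of_real kcnj_mult)
qed (simp_all add: kcnj_add)

lemma sum_fun_apply: "(sum f A) x = (\<Sum>i\<in>A. f i x)"
  by (induction A rule: infinite_finite_induct) simp_all

lemma fscale_apply [simp]: "fscale c f x = c * f x"
  by (simp add: fscale_def)

text \<open>
  The instances are \<open>l\<^sup>2(I)\<close> and \<open>L\<^sup>2(\<mu>)\<close>. The form is only positive semidefinite, because
  functions equal almost everywhere are not identified in the latter.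
\<close>

locale semi_inner_space =
  fixes X :: "('x \<Rightarrow> 'k::real_or_complex) set" and ip :: "('x \<Rightarrow> 'k) \<Rightarrow> ('x \<Rightarrow> 'k) \<Rightarrow> 'k"
  assumes zero_mem: "0 \<in> X"
    and add_mem: "\<And>x y. x \<in> X \<Longrightarrow> y \<in> X \<Longrightarrow> x + y \<in> X"
    and scale_mem: "\<And>c x. x \<in> X \<Longrightarrow> fscale c x \<in> X"
    and ip_add: "\<And>x y z. x \<in> X \<Longrightarrow> y \<in> X \<Longrightarrow> z \<in> X \<Longrightarrow> ip (x + y) z = ip x z + ip y z"
    and ip_scale: "\<And>c x z. x \<in> X \<Longrightarrow> z \<in> X \<Longrightarrow> ip (fscale c x) z = c * ip x z"
    and ip_herm: "\<And>x y. x \<in> X \<Longrightarrow> y \<in> X \<Longrightarrow> ip y x = kcnj (ip x y)"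
    and ip_nonneg: "\<And>x. x \<in> X \<Longrightarrow> \<exists>r\<ge>0. ip x x = of_real r"
begin

definition nsq :: "('x \<Rightarrow> 'k) \<Rightarrow> real"
  where "nsq x = norm (ip x x)"

lemma nsq_nonneg [simp]: "0 \<le> nsq x"
  by (simp add: nsq_def)

lemma ip_self: "x \<in> X \<Longrightarrow> ip x x = of_real (nsq x)"
  using ip_nonneg [of x] by (auto simp: nsq_def)

lemma diff_mem: assumes "x \<in> X" "y \<in> X" shows "x - y \<in> X"
proof -
  have "x - y = x + fscale (-1) y" by (auto simp: fscale_def)
  with assms show ?thesis by (metis add_mem scale_mem)
qed

lemma sum_mem: "(\<And>j. j \<in> J \<Longrightarrow> e j \<in> X) \<Longrightarrow> sum e J \<in> X"
  by (induction J rule: infinite_finite_induct) (auto intro: zero_mem add_mem)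

lemma ip_zero: "z \<in> X \<Longrightarrow> ip 0 z = 0"
  using ip_add [of 0 0 z] zero_mem by simp

lemma ip_add_right: "x \<in> X \<Longrightarrow> y \<in> X \<Longrightarrow> z \<in> X \<Longrightarrow> ip z (x + y) = ip z x + ip z y"
  by (simp add: ip_herm [of _ z] add_mem ip_add kcnj_add)

lemma ip_scale_right: "x \<in> X \<Longrightarrow> z \<in> X \<Longrightarrow> ip z (fscale c x) = kcnj c * ip z x"
  by (simp add: ip_herm [of _ z] scale_mem ip_scale kcnj_mult)

lemma ip_diff: assumes "x \<in> X" "y \<in> X" "z \<in> X" shows "ip (x - y) z = ip x z - ip y z"
  using ip_add [of "x - y" y z] assms diff_mem by simp

lemma ip_diff_right: assumes "x \<in> X" "y \<in> X" "z \<in> X" shows "ip z (x - y) = ip z x - ip z y"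
  using ip_add_right [of "x - y" y z] assms diff_mem by simp

lemma ip_sum:
  "(\<And>j. j \<in> J \<Longrightarrow> e j \<in> X) \<Longrightarrow> z \<in> X \<Longrightarrow> ip (sum e J) z = (\<Sum>j\<in>J. ip (e j) z)"
proof (induction J rule: infinite_finite_induct)
  case (insert j J)
  then have "ip (e j + sum e J) z = ip (e j) z + ip (sum e J) z"
    by (intro ip_add sum_mem) auto
  with insert show ?case by (metis (no_types, lifting) insertCI sum.insert)
qed (simp_all add: ip_zero)

lemma nsq_scale: assumes "x \<in> X" shows "nsq (fscale c x) = (norm c)\<^sup>2 * nsq x"
proof -
  have "ip (fscale c x) (fscale c x) = c * (kcnj c * ip x x)"
    using assms by (simp add: ip_scale ip_scale_right scale_mem)
  then show ?thesis by (simp add: nsq_def norm_mult power2_eq_square)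
qed

lemma nsq_add:
  assumes "x \<in> X" "y \<in> X"
  shows "of_real (nsq (x + y)) = of_real (nsq x) + of_real (nsq y) + (ip x y + kcnj (ip x y))"
proof -
  have "of_real (nsq (x + y)) = ip (x + y) (x + y)" using assms by (simp add: ip_self add_mem)
  also have "\<dots> = ip x x + ip y x + (ip x y + ip y y)"
    using assms by (simp add: ip_add ip_add_right add_mem)
  finally show ?thesis using assms by (simp add: ip_self ip_herm [of x y] algebra_simps)
qed

text \<open>
  The polynomial \<open>\<parallel>x - s\<langle>x|y\<rangle>y\<parallel>\<^sup>2\<close> in the real variable \<open>s\<close> is nonnegative. For \<open>\<parallel>y\<parallel> = 0\<close> it is affine,
  which forces its slope to vanish.
\<close>

lemma Cauchy_Schwarz:
  assumes x: "x \<in> X" and y: "y \<in> X"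
  shows "(norm (ip x y))\<^sup>2 \<le> nsq x * nsq y"
proof -
  define z where "z = ip x y"
  define n where "n = (norm z)\<^sup>2"
  have key: "0 \<le> nsq x - 2 * s * n + s\<^sup>2 * n * nsq y" for s :: real
  proof -
    define u where "u = fscale (- of_real s * z) y"
    have u: "u \<in> X" using y by (simp add: u_def scale_mem)
    have "ip x u = - of_real (s * n)"
      using x y by (simp add: u_def ip_scale_right kcnj_mult kcnj_minus z_def [symmetric] mult.assoc
          kcnj_mult_of_real n_def)
    moreover have "nsq u = s\<^sup>2 * n * nsq y"
      using y by (simp add: u_def nsq_scale norm_mult n_def power_mult_distrib)
    ultimately have "of_real (nsq (x + u)) = (of_real (nsq x - 2 * s * n + s\<^sup>2 * n * nsq y) :: 'k)"
      using nsq_add [OF x u] by (simp add: kcnj_minus kcnj_mult algebra_simps)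
    then have "nsq (x + u) = nsq x - 2 * s * n + s\<^sup>2 * n * nsq y" by (simp only: of_real_eq_iff)
    then show ?thesis by (metis nsq_nonneg)
  qed
  show ?thesis
  proof (cases "nsq y = 0")
    case True
    have "n = 0"
    proof (rule ccontr)
      assume "n \<noteq> 0"
      then have "n > 0" by (simp add: n_def)
      \<comment> \<open>at this \<open>s\<close> the affine function has the value \<open>-1\<close>\<close>
      then show False using key [of "(nsq x + 1) / (2 * n)"] True by simp
    qed
    then show ?thesis using True by (simp add: n_def z_def)
  next
    case False
    then have pos: "nsq y > 0" using nsq_nonneg [of y] by linarith
    have "0 \<le> nsq x - n / nsq y"
      using key [of "1 / nsq y"] pos by (simp add: power2_eq_square field_simps)
    then have "n \<le> nsq x * nsq y" using pos by (simp add: field_simps)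
    then show ?thesis by (simp add: n_def z_def)
  qed
qed

lemma nsq_triangle:
  assumes x: "x \<in> X" and y: "y \<in> X"
  shows "sqrt (nsq (x + y)) \<le> sqrt (nsq x) + sqrt (nsq y)"
proof -
  have "norm (ip x y) \<le> sqrt (nsq x) * sqrt (nsq y)"
    using real_sqrt_le_mono [OF Cauchy_Schwarz [OF x y]] by (simp add: real_sqrt_mult)
  moreover have "norm (ip x y + kcnj (ip x y)) \<le> norm (ip x y) + norm (ip x y)"
    using norm_triangle_ineq [of "ip x y" "kcnj (ip x y)"] by simp
  moreover have "nsq (x + y) \<le> nsq x + nsq y + norm (ip x y + kcnj (ip x y))"
  proof -
    have "nsq (x + y) = norm (of_real (nsq x + nsq y) + (ip x y + kcnj (ip x y)))"
      using arg_cong [OF nsq_add [OF x y], of norm] by simp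
    also have "\<dots> \<le> norm (of_real (nsq x + nsq y) :: 'k) + norm (ip x y + kcnj (ip x y))"
      by (rule norm_triangle_ineq)
    finally show ?thesis unfolding norm_of_real by simp
  qed
  ultimately have "nsq (x + y) \<le> (sqrt (nsq x) + sqrt (nsq y))\<^sup>2"
    by (simp add: power2_sum)
  then show ?thesis by (rule real_le_lsqrt [rotated]) (simp_all)
qed

lemma nsq_minus: "x \<in> X \<Longrightarrow> y \<in> X \<Longrightarrow> nsq (x - y) = nsq (y - x)"
proof -
  assume "x \<in> X" "y \<in> X"
  then have "nsq (fscale (-1) (y - x)) = nsq (y - x)" by (simp add: nsq_scale diff_mem)
  moreover have "fscale (-1) (y - x) = x - y" by (auto simp: fscale_def)
  ultimately show ?thesis by simp
qed

definition orthonormal_on :: "'j set \<Rightarrow> ('j \<Rightarrow> 'x \<Rightarrow> 'k) \<Rightarrow> bool"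
  where "orthonormal_on J e \<longleftrightarrow>
    (\<forall>i\<in>J. e i \<in> X) \<and> (\<forall>i\<in>J. \<forall>j\<in>J. ip (e i) (e j) = (if i = j then 1 else 0))"

lemma orthonormal_on_subset: "orthonormal_on J e \<Longrightarrow> K \<subseteq> J \<Longrightarrow> orthonormal_on K e"
  unfolding orthonormal_on_def by (meson subsetD)

definition combination :: "'j set \<Rightarrow> ('j \<Rightarrow> 'k) \<Rightarrow> ('j \<Rightarrow> 'x \<Rightarrow> 'k) \<Rightarrow> 'x \<Rightarrow> 'k"
  where "combination J c e = (\<Sum>j\<in>J. fscale (c j) (e j))"

lemma combination_mem: "orthonormal_on J e \<Longrightarrow> combination J c e \<in> X"
  by (auto simp: combination_def orthonormal_on_def intro!: sum_mem scale_mem)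

lemma ip_combination:
  assumes "orthonormal_on J e" "z \<in> X"
  shows "ip (combination J c e) z = (\<Sum>j\<in>J. c j * ip (e j) z)"
proof -
  have e: "\<And>j. j \<in> J \<Longrightarrow> e j \<in> X" using assms by (auto simp: orthonormal_on_def)
  show ?thesis
    unfolding combination_def using assms(2) e
    by (subst ip_sum) (auto simp: scale_mem ip_scale intro!: sum.cong)
qed

lemma ip_combination_basis:
  assumes "orthonormal_on J e" "finite J" "k \<in> J"
  shows "ip (combination J c e) (e k) = c k"
proof -
  have k: "e k \<in> X" using assms by (auto simp: orthonormal_on_def)
  have "ip (combination J c e) (e k) = (\<Sum>j\<in>J. if j = k then c j else 0)"
    unfolding ip_combination [OF assms(1) k]
    using assms by (intro sum.cong) (auto simp: orthonormal_on_def)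
  with assms show ?thesis by simp
qed

lemma Pythagoras:
  assumes e: "orthonormal_on J e" "finite J" and y: "y \<in> X" "\<And>j. j \<in> J \<Longrightarrow> ip y (e j) = 0"
  shows "nsq (y + combination J c e) = nsq y + (\<Sum>j\<in>J. (norm (c j))\<^sup>2)"
proof -
  let ?u = "combination J c e"
  have eX: "\<And>j. j \<in> J \<Longrightarrow> e j \<in> X" using e by (auto simp: orthonormal_on_def)
  have u: "?u \<in> X" using e(1) by (rule combination_mem)
  have "ip ?u y = 0"
    using e y eX by (subst ip_combination) (auto intro!: sum.neutral simp: ip_herm [of y])
  then have 0: "ip y ?u = 0" using u y ip_herm [of ?u y] by simp
  have "ip ?u ?u = (\<Sum>j\<in>J. c j * ip (e j) ?u)" using e(1) u by (rule ip_combination)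
  also have "\<dots> = (\<Sum>j\<in>J. of_real ((norm (c j))\<^sup>2))"
  proof (rule sum.cong)
    fix j assume j: "j \<in> J"
    then have "ip (e j) ?u = kcnj (c j)"
      using ip_herm [OF u eX [OF j]] ip_combination_basis [OF e j] by simp
    then show "c j * ip (e j) ?u = of_real ((norm (c j))\<^sup>2)" by (simp add: mult_kcnj_of_real)
  qed simp
  finally have "(of_real (nsq ?u) :: 'k) = of_real (\<Sum>j\<in>J. (norm (c j))\<^sup>2)"
    unfolding ip_self [OF u] of_real_sum .
  then have "nsq ?u = (\<Sum>j\<in>J. (norm (c j))\<^sup>2)" by (simp only: of_real_eq_iff)
  moreover have "(of_real (nsq (y + ?u)) :: 'k) = of_real (nsq y + nsq ?u)"
    using nsq_add [OF y(1) u] 0 by simp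
  then have "nsq (y + ?u) = nsq y + nsq ?u" by (simp only: of_real_eq_iff)
  ultimately show ?thesis by simp
qed

text \<open>Both Bessel's inequality and the best approximation property are read off from this decomposition.\<close>

lemma nsq_projection:
  assumes e: "orthonormal_on J e" "finite J" and x: "x \<in> X"
  shows "nsq (x - combination J c e) =
    nsq (x - combination J (\<lambda>j. ip x (e j)) e) + (\<Sum>j\<in>J. (norm (ip x (e j) - c j))\<^sup>2)"
proof -
  let ?p = "combination J (\<lambda>j. ip x (e j)) e"
  have p: "?p \<in> X" using e(1) by (rule combination_mem)
  have eX: "\<And>j. j \<in> J \<Longrightarrow> e j \<in> X" using e by (auto simp: orthonormal_on_def)
  have *: "x - combination J c e = (x - ?p) + combination J (\<lambda>j. ip x (e j) - c j) e"
    by (rule ext) (simp add: combination_def sum_fun_apply sum_subtractf algebra_simps)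
  have "ip (x - ?p) (e j) = 0" if "j \<in> J" for j
    using that x p eX e by (simp add: ip_diff ip_combination_basis)
  then show ?thesis
    unfolding * by (rule Pythagoras [OF e diff_mem [OF x p]])
qed

lemma Bessel:
  assumes "orthonormal_on J e" "finite J" "x \<in> X"
  shows "(\<Sum>j\<in>J. (norm (ip x (e j)))\<^sup>2) \<le> nsq x"
proof -
  have "combination J (\<lambda>_. 0) e = 0" by (rule ext) (simp add: combination_def sum_fun_apply)
  then show ?thesis using nsq_projection [OF assms, of "\<lambda>_. 0"] nsq_nonneg by simp
qed

lemma nsq_projection_le:
  assumes "orthonormal_on J e" "finite J" "x \<in> X"
  shows "nsq (x - combination J (\<lambda>j. ip x (e j)) e) \<le> nsq (x - combination J c e)"
  unfolding nsq_projection [OF assms, of c] by (simp add: sum_nonneg)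

end


section \<open>Square-summable families and Hilbert-Schmidt matrices\<close>

lemma continuous_on_uniform_approx:
  fixes f :: "'a::topological_space \<Rightarrow> 'b::metric_space"
  assumes "\<And>\<epsilon>. \<epsilon> > 0 \<Longrightarrow> \<exists>g. continuous_on S g \<and> (\<forall>x\<in>S. dist (f x) (g x) \<le> \<epsilon>)"
  shows "continuous_on S f"
proof -
  have "\<forall>n::nat. \<exists>g. continuous_on S g \<and> (\<forall>x\<in>S. dist (f x) (g x) \<le> inverse (Suc n))"
    by (intro allI assms) simp
  then obtain g where g: "\<And>n::nat. continuous_on S (g n)"
    "\<And>n x. x \<in> S \<Longrightarrow> dist (f x) (g n x) \<le> inverse (Suc n)" by metis
  have "uniform_limit S g f sequentially"
  proof (rule uniform_limitI)
    fix e :: real assume "e > 0"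
    then have "\<forall>\<^sub>F n in sequentially. inverse (real (Suc n)) < e"
      using LIMSEQ_inverse_real_of_nat order_tendstoD(2) by blast
    then show "\<forall>\<^sub>F n in sequentially. \<forall>x\<in>S. dist (g n x) (f x) < e"
      by eventually_elim (metis dist_commute g(2) le_less_trans)
  qed
  then show ?thesis
    using g(1) by (intro uniform_limit_theorem [of S g sequentially f]) auto
qed

lemma infsum_kcnj:
  fixes f :: "'a \<Rightarrow> 'k::real_or_complex"
  assumes "f summable_on A"
  shows "(\<Sum>\<^sub>\<infinity>i\<in>A. kcnj (f i)) = kcnj (infsum f A)"
  by (rule infsumI, rule has_sum_bounded_linear [OF bounded_linear_kcnj has_sum_infsum [OF assms]])

lemma has_sum_finite_sum:
  fixes f :: "'j \<Rightarrow> 'a \<Rightarrow> 'b::topological_comm_monoid_add"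
  assumes "\<And>n. n \<in> J \<Longrightarrow> (f n has_sum S n) A"
  shows "((\<lambda>i. \<Sum>n\<in>J. f n i) has_sum (\<Sum>n\<in>J. S n)) A"
  using assms by (induction J rule: infinite_finite_induct) (auto intro: has_sum_add)

lemma l2_iff: "\<zeta> \<in> l2 I \<longleftrightarrow> (\<forall>i. i \<notin> I \<longrightarrow> \<zeta> i = 0) \<and> (\<lambda>i. (norm (\<zeta> i))\<^sup>2) summable_on I"
  by (simp add: l2_def)

lemma l2_prod_abs_summable:
  assumes "\<zeta> \<in> l2 I" "\<eta> \<in> l2 I"
  shows "(\<lambda>i. norm (\<eta> i * \<zeta> i)) summable_on I"
  by (rule abs_summable_product)
     (use assms in \<open>simp_all add: l2_iff norm_power flip: power2_eq_square\<close>)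

lemma kcnj_l2: "\<zeta> \<in> l2 I \<Longrightarrow> (\<lambda>i. kcnj (\<zeta> i)) \<in> l2 I"
  by (simp add: l2_iff)

lemma l2_inner_summable:
  assumes "\<zeta> \<in> l2 I" "\<eta> \<in> l2 I"
  shows "(\<lambda>i. kcnj (\<eta> i) * \<zeta> i) summable_on I"
  using l2_prod_abs_summable [OF assms(1) kcnj_l2 [OF assms(2)]] by (rule abs_summable_summable)

lemma norm_add_sq_le: "(norm (a + b))\<^sup>2 \<le> 2 * (norm a)\<^sup>2 + 2 * (norm (b::'a::real_normed_vector))\<^sup>2"
proof -
  have "(norm (a + b))\<^sup>2 \<le> (norm a + norm b)\<^sup>2"
    by (intro power_mono norm_triangle_ineq) simp
  also have "\<dots> \<le> 2 * (norm a)\<^sup>2 + 2 * (norm b)\<^sup>2"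
    using zero_le_power2 [of "norm a - norm b"] by (simp add: power2_sum power2_diff)
  finally show ?thesis .
qed

lemma l2_add: assumes "x \<in> l2 I" "y \<in> l2 I" shows "x + y \<in> l2 I"
proof -
  have "(\<lambda>i. 2 * (norm (x i))\<^sup>2 + 2 * (norm (y i))\<^sup>2) summable_on I"
    using assms by (intro summable_on_add summable_on_cmult_right) (auto simp: l2_iff)
  then have "(\<lambda>i. (norm (x i + y i))\<^sup>2) summable_on I"
    by (rule summable_on_comparison_test) (auto intro: norm_add_sq_le)
  with assms show ?thesis by (auto simp: l2_iff)
qed

lemma l2_scale: assumes "x \<in> l2 I" shows "fscale c x \<in> l2 I"
  using assms by (auto simp: l2_iff norm_mult power_mult_distrib intro!: summable_on_cmult_right)

interpretation l2: semi_inner_space "l2 I :: ('i \<Rightarrow> 'k::real_or_complex) set" "l2_inner I" for I :: "'i set"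
proof
  fix x y z :: "'i \<Rightarrow> 'k" and c
  show "(0::'i \<Rightarrow> 'k) \<in> l2 I" by (simp add: l2_iff)
  show "x \<in> l2 I \<Longrightarrow> fscale c x \<in> l2 I" by (rule l2_scale)
  show "x \<in> l2 I \<Longrightarrow> y \<in> l2 I \<Longrightarrow> x + y \<in> l2 I" by (rule l2_add)
  show "l2_inner I (x + y) z = l2_inner I x z + l2_inner I y z"
    if "x \<in> l2 I" "y \<in> l2 I" "z \<in> l2 I"
    using that by (simp add: l2_inner_def distrib_left infsum_add l2_inner_summable)
  show "l2_inner I (fscale c x) z = c * l2_inner I x z" if "x \<in> l2 I" "z \<in> l2 I"
    using infsum_cmult_right [OF l2_inner_summable [OF that], of c]
    by (simp add: l2_inner_def mult.left_commute)
  show "l2_inner I y x = kcnj (l2_inner I x y)" if "x \<in> l2 I" "y \<in> l2 I"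
    using infsum_kcnj [OF l2_inner_summable [OF that]]
    by (simp add: l2_inner_def kcnj_mult kcnj_kcnj mult.commute)
  show "\<exists>r\<ge>0. l2_inner I x x = of_real r" if "x \<in> l2 I"
  proof (intro exI conjI)
    show "0 \<le> (\<Sum>\<^sub>\<infinity>i\<in>I. (norm (x i))\<^sup>2)" by (rule infsum_nonneg) simp
    have "((\<lambda>i. of_real ((norm (x i))\<^sup>2)) has_sum (of_real (\<Sum>\<^sub>\<infinity>i\<in>I. (norm (x i))\<^sup>2) :: 'k)) I"
      using that by (intro has_sum_of_real has_sum_infsum) (simp add: l2_iff)
    then show "l2_inner I x x = of_real (\<Sum>\<^sub>\<infinity>i\<in>I. (norm (x i))\<^sup>2)"
      unfolding l2_inner_def kcnj_mult_of_real by (rule infsumI)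
  qed
qed

lemma l2_nsq_has_sum: assumes "\<zeta> \<in> l2 I" shows "((\<lambda>i. (norm (\<zeta> i))\<^sup>2) has_sum l2.nsq I \<zeta>) I"
proof -
  let ?S = "\<Sum>\<^sub>\<infinity>i\<in>I. (norm (\<zeta> i))\<^sup>2"
  have S: "((\<lambda>i. (norm (\<zeta> i))\<^sup>2) has_sum ?S) I" using assms by (simp add: l2_iff)
  then have "((\<lambda>i. of_real ((norm (\<zeta> i))\<^sup>2)) has_sum (of_real ?S :: 'b)) I" by (rule has_sum_of_real)
  then have "l2_inner I \<zeta> \<zeta> = of_real ?S"
    unfolding l2_inner_def kcnj_mult_of_real by (rule infsumI)
  moreover have "?S \<ge> 0" by (rule infsum_nonneg) simp
  ultimately have "l2.nsq I \<zeta> = ?S" by (simp add: l2.nsq_def)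
  with S show ?thesis by simp
qed

lemma l2_sum_le:
  assumes "\<zeta> \<in> l2 I" "finite F" "F \<subseteq> I"
  shows "(\<Sum>i\<in>F. (norm (\<zeta> i))\<^sup>2) \<le> l2.nsq I \<zeta>"
  by (rule finite_sum_le_has_sum [OF l2_nsq_has_sum [OF assms(1)]]) (use assms in auto)

lemma l2_component_le: assumes "\<zeta> \<in> l2 I" shows "(norm (\<zeta> i))\<^sup>2 \<le> l2.nsq I \<zeta>"
proof (cases "i \<in> I")
  case True then show ?thesis using l2_sum_le [OF assms, of "{i}"] by simp
next
  case False then show ?thesis using assms by (simp add: l2_iff)
qed

lemma l2_nsq_leI:
  assumes "\<zeta> \<in> l2 I" "\<And>F. finite F \<Longrightarrow> F \<subseteq> I \<Longrightarrow> (\<Sum>i\<in>F. (norm (\<zeta> i))\<^sup>2) \<le> B"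
  shows "l2.nsq I \<zeta> \<le> B"
  by (rule has_sum_le_finite_sums [OF l2_nsq_has_sum [OF assms(1)]]) (use assms in auto)

lemma l2_nsq_zero: assumes "\<zeta> \<in> l2 I" "l2.nsq I \<zeta> = 0" shows "\<zeta> = 0"
proof
  show "\<zeta> i = 0 i" for i using l2_component_le [OF assms(1), of i] assms(2) by simp
qed

lemma l2I:
  assumes "\<And>i. i \<notin> I \<Longrightarrow> \<zeta> i = 0"
    and "\<And>F. finite F \<Longrightarrow> F \<subseteq> I \<Longrightarrow> (\<Sum>i\<in>F. (norm (\<zeta> i))\<^sup>2) \<le> B"
  shows "\<zeta> \<in> l2 I"
  using assms unfolding l2_iff
  by (intro conjI allI impI nonneg_bdd_above_summable_on bdd_aboveI [of _ B]) auto

lemma l2_finite_support: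
  assumes "finite F" "F \<subseteq> I" "\<And>i. i \<notin> F \<Longrightarrow> \<zeta> i = 0"
  shows "\<zeta> \<in> l2 I"
proof (rule l2I)
  show "i \<notin> I \<Longrightarrow> \<zeta> i = 0" for i using assms by blast
  show "(\<Sum>i\<in>G. (norm (\<zeta> i))\<^sup>2) \<le> (\<Sum>i\<in>F. (norm (\<zeta> i))\<^sup>2)" if "finite G" "G \<subseteq> I" for G
  proof -
    have "(\<Sum>i\<in>G. (norm (\<zeta> i))\<^sup>2) = (\<Sum>i\<in>G \<inter> F. (norm (\<zeta> i))\<^sup>2)"
      using that assms by (intro sum.mono_neutral_right) auto
    also have "\<dots> \<le> (\<Sum>i\<in>F. (norm (\<zeta> i))\<^sup>2)" using assms by (intro sum_mono2) auto
    finally show ?thesis .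
  qed
qed

definition truncation :: "'i set \<Rightarrow> ('i \<Rightarrow> 'a::zero) \<Rightarrow> 'i \<Rightarrow> 'a"
  where "truncation F \<zeta> = (\<lambda>i. if i \<in> F then \<zeta> i else 0)"

lemma truncation_l2: "finite F \<Longrightarrow> F \<subseteq> I \<Longrightarrow> truncation F \<zeta> \<in> l2 I"
  by (rule l2_finite_support [of F]) (auto simp: truncation_def)

lemma l2_truncation_approx:
  assumes "\<zeta> \<in> l2 I" "\<epsilon> > 0"
  shows "\<exists>F. finite F \<and> F \<subseteq> I \<and> l2.nsq I (\<zeta> - truncation F \<zeta>) \<le> \<epsilon>"
proof -
  obtain F where F: "finite F" "F \<subseteq> I" "dist (\<Sum>i\<in>F. (norm (\<zeta> i))\<^sup>2) (l2.nsq I \<zeta>) \<le> \<epsilon>"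
    using has_sum_finite_approximation [OF l2_nsq_has_sum [OF assms(1)] assms(2)] by blast
  have "l2.nsq I (\<zeta> - truncation F \<zeta>) \<le> \<epsilon>"
  proof (rule l2_nsq_leI)
    show "\<zeta> - truncation F \<zeta> \<in> l2 I" using F assms by (intro l2.diff_mem truncation_l2)
    fix G assume G: "finite G" "G \<subseteq> I"
    have "(\<Sum>i\<in>G. (norm ((\<zeta> - truncation F \<zeta>) i))\<^sup>2) = (\<Sum>i\<in>G - F. (norm (\<zeta> i))\<^sup>2)"
      using G by (intro sum.mono_neutral_cong_right) (auto simp: truncation_def)
    moreover have "(\<Sum>i\<in>(G - F) \<union> F. (norm (\<zeta> i))\<^sup>2) = (\<Sum>i\<in>G - F. (norm (\<zeta> i))\<^sup>2) + (\<Sum>i\<in>F. (norm (\<zeta> i))\<^sup>2)"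
      using F G by (intro sum.union_disjoint) auto
    moreover have "(\<Sum>i\<in>(G - F) \<union> F. (norm (\<zeta> i))\<^sup>2) \<le> l2.nsq I \<zeta>"
      using F G assms by (intro l2_sum_le) auto
    ultimately show "(\<Sum>i\<in>G. (norm ((\<zeta> - truncation F \<zeta>) i))\<^sup>2) \<le> \<epsilon>"
      using F(3) by (simp add: dist_real_def)
  qed
  with F show ?thesis by blast
qed

text \<open>
  One definition serves for scalar entries and for entries in \<open>\<C>(T)\<close>; evaluation at a point of \<open>T\<close>
  carries the latter into the former.
\<close>

definition mat_op :: "'i set \<Rightarrow> ('i \<times> 'i \<Rightarrow> 'a::{times,comm_monoid_add,t2_space}) \<Rightarrow> ('i \<Rightarrow> 'a) \<Rightarrow> 'i \<Rightarrow> 'a"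
  where "mat_op I a x = (\<lambda>i. if i \<in> I then \<Sum>\<^sub>\<infinity>j\<in>I. a (i, j) * x j else 0)"

text \<open>The vector whose inner product with \<open>x\<close> is the \<open>i\<close>-th coordinate of the image of \<open>x\<close>.\<close>

definition conj_row :: "('i \<times> 'i \<Rightarrow> 'k::real_or_complex) \<Rightarrow> 'i \<Rightarrow> 'i \<Rightarrow> 'k"
  where "conj_row a i = (\<lambda>j. kcnj (a (i, j)))"

lemma mat_op_eq_inner: "i \<in> I \<Longrightarrow> mat_op I a x i = l2_inner I x (conj_row a i)"
  by (simp add: mat_op_def l2_inner_def conj_row_def kcnj_kcnj)

lemma mat_op_off: "i \<notin> I \<Longrightarrow> mat_op I a x i = 0"
  by (simp add: mat_op_def)

lemma conj_row_l2: assumes a: "a \<in> l2 (I \<times> I)" shows "conj_row a i \<in> l2 I"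
proof (rule l2I)
  show "j \<notin> I \<Longrightarrow> conj_row a i j = 0" for j using a by (simp add: l2_iff conj_row_def)
  fix F assume F: "finite F" "F \<subseteq> I"
  show "(\<Sum>j\<in>F. (norm (conj_row a i j))\<^sup>2) \<le> l2.nsq (I \<times> I) a"
  proof (cases "i \<in> I")
    case True
    have "(\<Sum>j\<in>F. (norm (conj_row a i j))\<^sup>2) = (\<Sum>p\<in>Pair i ` F. (norm (a p))\<^sup>2)"
      by (subst sum.reindex) (auto simp: conj_row_def intro: inj_onI)
    also have "\<dots> \<le> l2.nsq (I \<times> I) a" using F True by (intro l2_sum_le a) auto
    finally show ?thesis .
  next
    case False
    then have "conj_row a i j = 0" for j using a by (simp add: l2_iff conj_row_def)
    then show ?thesis by simp
  qed
qed

lemma conj_rows_sum: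
  assumes a: "a \<in> l2 (I \<times> I)" and F: "finite F" "F \<subseteq> I"
  shows "(\<Sum>i\<in>F. l2.nsq I (conj_row a i)) \<le> l2.nsq (I \<times> I) a"
proof -
  have "((\<lambda>i. l2.nsq I (conj_row a i)) has_sum l2.nsq (I \<times> I) a) I"
  proof (rule has_sum_SigmaD [OF l2_nsq_has_sum [OF a]])
    fix i assume "i \<in> I"
    show "((\<lambda>j. (norm (a (i, j)))\<^sup>2) has_sum l2.nsq I (conj_row a i)) I"
      using l2_nsq_has_sum [OF conj_row_l2 [OF a, of i]] by (simp add: conj_row_def)
  qed
  then show ?thesis by (rule finite_sum_le_has_sum) (use F in auto)
qed

text \<open>
  Bessel's inequality for every row, summed over the rows: the Hilbert-Schmidt norm of a matrix
  bounds the square sum of the operator on every orthonormal family.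
\<close>

lemma mat_op_orthonormal_partial:
  assumes a: "a \<in> l2 (I \<times> I)" and v: "l2.orthonormal_on I J v" "finite J" and F: "finite F" "F \<subseteq> I"
  shows "(\<Sum>i\<in>F. \<Sum>n\<in>J. (norm (mat_op I a (v n) i))\<^sup>2) \<le> l2.nsq (I \<times> I) a"
proof -
  have "(\<Sum>n\<in>J. (norm (mat_op I a (v n) i))\<^sup>2) \<le> l2.nsq I (conj_row a i)" if "i \<in> F" for i
  proof -
    have "norm (mat_op I a (v n) i) = norm (l2_inner I (conj_row a i) (v n))" if n: "n \<in> J" for n
    proof -
      have "v n \<in> l2 I" using v n by (auto simp: l2.orthonormal_on_def)
      then show ?thesis
        using \<open>i \<in> F\<close> F mat_op_eq_inner [of i I a "v n"] l2.ip_herm [of "conj_row a i" I "v n"] conj_row_l2 [OF a]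
        by auto
    qed
    then show ?thesis using l2.Bessel [OF v conj_row_l2 [OF a, of i]] by simp
  qed
  then have "(\<Sum>i\<in>F. \<Sum>n\<in>J. (norm (mat_op I a (v n) i))\<^sup>2) \<le> (\<Sum>i\<in>F. l2.nsq I (conj_row a i))"
    by (rule sum_mono)
  also have "\<dots> \<le> l2.nsq (I \<times> I) a" by (rule conj_rows_sum [OF a F])
  finally show ?thesis .
qed

lemma mat_op_partial:
  assumes a: "a \<in> l2 (I \<times> I)" and x: "x \<in> l2 I" and F: "finite F" "F \<subseteq> I"
  shows "(\<Sum>i\<in>F. (norm (mat_op I a x i))\<^sup>2) \<le> l2.nsq (I \<times> I) a * l2.nsq I x"
proof -
  have "(\<Sum>i\<in>F. (norm (mat_op I a x i))\<^sup>2) \<le> (\<Sum>i\<in>F. l2.nsq I (conj_row a i) * l2.nsq I x)"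
  proof (rule sum_mono)
    fix i assume "i \<in> F"
    then show "(norm (mat_op I a x i))\<^sup>2 \<le> l2.nsq I (conj_row a i) * l2.nsq I x"
      using F l2.Cauchy_Schwarz [OF x conj_row_l2 [OF a]] by (auto simp: mat_op_eq_inner mult.commute)
  qed
  also have "\<dots> = (\<Sum>i\<in>F. l2.nsq I (conj_row a i)) * l2.nsq I x" by (simp add: sum_distrib_right)
  also have "\<dots> \<le> l2.nsq (I \<times> I) a * l2.nsq I x"
    by (intro mult_right_mono conj_rows_sum [OF a F]) simp
  finally show ?thesis .
qed

lemma mat_op_l2: "a \<in> l2 (I \<times> I) \<Longrightarrow> x \<in> l2 I \<Longrightarrow> mat_op I a x \<in> l2 I"
  by (rule l2I [OF mat_op_off mat_op_partial])

lemma mat_op_nsq_le: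
  "a \<in> l2 (I \<times> I) \<Longrightarrow> x \<in> l2 I \<Longrightarrow> l2.nsq I (mat_op I a x) \<le> l2.nsq (I \<times> I) a * l2.nsq I x"
  by (rule l2_nsq_leI [OF mat_op_l2 mat_op_partial])

lemma mat_op_orthonormal:
  assumes a: "a \<in> l2 (I \<times> I)" and v: "l2.orthonormal_on I J v" "finite J"
  shows "(\<Sum>n\<in>J. l2.nsq I (mat_op I a (v n))) \<le> l2.nsq (I \<times> I) a"
proof -
  have "((\<lambda>i. \<Sum>n\<in>J. (norm (mat_op I a (v n) i))\<^sup>2) has_sum (\<Sum>n\<in>J. l2.nsq I (mat_op I a (v n)))) I"
  proof (rule has_sum_finite_sum)
    fix n assume "n \<in> J"
    then have "v n \<in> l2 I" using v by (auto simp: l2.orthonormal_on_def)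
    then show "((\<lambda>i. (norm (mat_op I a (v n) i))\<^sup>2) has_sum l2.nsq I (mat_op I a (v n))) I"
      by (intro l2_nsq_has_sum mat_op_l2 a)
  qed
  then show ?thesis
    by (rule has_sum_le_finite_sums) (use mat_op_orthonormal_partial [OF a v] in auto)
qed

lemma mat_op_add:
  assumes "a \<in> l2 (I \<times> I)" "x \<in> l2 I" "y \<in> l2 I"
  shows "mat_op I a (x + y) = mat_op I a x + mat_op I a y"
proof
  show "mat_op I a (x + y) i = (mat_op I a x + mat_op I a y) i" for i
    using l2.ip_add [OF assms(2,3) conj_row_l2 [OF assms(1)]]
    by (cases "i \<in> I") (simp_all add: mat_op_eq_inner mat_op_off)
qed

lemma mat_op_scale:
  assumes "a \<in> l2 (I \<times> I)" "x \<in> l2 I"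
  shows "mat_op I a (fscale c x) = fscale c (mat_op I a x)"
proof
  show "mat_op I a (fscale c x) i = (fscale c (mat_op I a x)) i" for i
    using l2.ip_scale [OF assms(2) conj_row_l2 [OF assms(1)]]
    by (cases "i \<in> I") (simp_all add: mat_op_eq_inner mat_op_off)
qed

lemma mat_op_diff:
  assumes "a \<in> l2 (I \<times> I)" "x \<in> l2 I" "y \<in> l2 I"
  shows "mat_op I a (x - y) = mat_op I a x - mat_op I a y"
  using mat_op_add [OF assms(1) l2.diff_mem [OF assms(2,3)] assms(3)] by simp

lemma mat_op_matrix_diff:
  assumes "a \<in> l2 (I \<times> I)" "b \<in> l2 (I \<times> I)" "x \<in> l2 I"
  shows "mat_op I (a - b) x = mat_op I a x - mat_op I b x"
proof
  show "mat_op I (a - b) x i = (mat_op I a x - mat_op I b x) i" for i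
  proof (cases "i \<in> I")
    case True
    have "conj_row (a - b) i = conj_row a i - conj_row b i" by (auto simp: conj_row_def kcnj_diff)
    then show ?thesis
      using True assms by (simp add: mat_op_eq_inner l2.ip_diff_right conj_row_l2)
  qed (simp add: mat_op_off)
qed

definition conj_transpose :: "('i \<times> 'i \<Rightarrow> 'k::real_or_complex) \<Rightarrow> 'i \<times> 'i \<Rightarrow> 'k"
  where "conj_transpose a = (\<lambda>(i, j). kcnj (a (j, i)))"

lemma conj_transpose_l2: assumes "a \<in> l2 (I \<times> I)" shows "conj_transpose a \<in> l2 (I \<times> I)"
proof -
  have "(\<lambda>p. (norm (conj_transpose a p))\<^sup>2) summable_on I \<times> I"
    using assms summable_on_reindex_bij_betw [of prod.swap "I \<times> I" "I \<times> I" "\<lambda>p. (norm (a p))\<^sup>2"]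
    by (auto simp: l2_iff conj_transpose_def prod.swap_def case_prod_unfold bij_betw_def
        inj_on_def image_def)
  with assms show ?thesis by (auto simp: l2_iff conj_transpose_def)
qed

lemma l2_tensor: assumes "x \<in> l2 I" "y \<in> l2 J" shows "(\<lambda>(i, j). x i * y j) \<in> l2 (I \<times> J)"
proof (rule l2I)
  show "p \<notin> I \<times> J \<Longrightarrow> (\<lambda>(i, j). x i * y j) p = 0" for p
    using assms by (cases p) (auto simp: l2_iff)
  fix F assume F: "finite F" "F \<subseteq> I \<times> J"
  have "(\<Sum>p\<in>F. (norm ((\<lambda>(i, j). x i * y j) p))\<^sup>2)
      \<le> (\<Sum>p\<in>fst ` F \<times> snd ` F. (norm ((\<lambda>(i, j). x i * y j) p))\<^sup>2)"
    using F by (intro sum_mono2) force+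
  also have "\<dots> = (\<Sum>i\<in>fst ` F. (norm (x i))\<^sup>2) * (\<Sum>j\<in>snd ` F. (norm (y j))\<^sup>2)"
    by (simp add: sum_product sum.cartesian_product case_prod_unfold norm_mult power_mult_distrib)
  also have "\<dots> \<le> l2.nsq I x * l2.nsq J y"
    using F by (intro mult_mono l2_sum_le assms sum_nonneg) auto
  finally show "(\<Sum>p\<in>F. (norm ((\<lambda>(i, j). x i * y j) p))\<^sup>2) \<le> l2.nsq I x * l2.nsq J y" .
qed

text \<open>
  The double series may be rearranged: \<open>a\<close> and the family \<open>y\<^sub>i x\<^sub>j\<close> are square-summable, so it converges
  absolutely.
\<close>

lemma mat_op_adjoint:
  assumes a: "a \<in> l2 (I \<times> I)" and x: "x \<in> l2 I" and y: "y \<in> l2 I"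
  shows "l2_inner I (mat_op I a x) y = l2_inner I x (mat_op I (conj_transpose a) y)"
proof -
  let ?f = "\<lambda>i j. kcnj (y i) * (a (i, j) * x j)"
  have row: "(\<lambda>j. a (i, j) * x j) summable_on I" for i
    using l2_inner_summable [OF x conj_row_l2 [OF a, of i]] by (simp add: conj_row_def kcnj_kcnj)
  have col: "(\<lambda>i. conj_transpose a (j, i) * y i) summable_on I" for j
    using l2_inner_summable [OF y conj_row_l2 [OF conj_transpose_l2 [OF a], of j]]
    by (simp add: conj_row_def kcnj_kcnj)
  have "(\<lambda>p. norm (a p * (\<lambda>(i, j). kcnj (y i) * x j) p)) summable_on (I \<times> I)"
    by (intro l2_prod_abs_summable a l2_tensor kcnj_l2 x y)
  then have "(\<lambda>p. a p * (\<lambda>(i, j). kcnj (y i) * x j) p) summable_on (I \<times> I)"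
    by (rule abs_summable_summable)
  also have "(\<lambda>p. a p * (\<lambda>(i, j). kcnj (y i) * x j) p) = (\<lambda>(i, j). ?f i j)"
    by (auto simp: mult.left_commute)
  finally have sw: "(\<lambda>(i, j). ?f i j) summable_on (I \<times> I)" .
  have "l2_inner I (mat_op I a x) y = (\<Sum>\<^sub>\<infinity>i\<in>I. \<Sum>\<^sub>\<infinity>j\<in>I. ?f i j)"
    unfolding l2_inner_def
    by (rule infsum_cong) (simp add: mat_op_def infsum_cmult_right row)
  also have "\<dots> = (\<Sum>\<^sub>\<infinity>j\<in>I. \<Sum>\<^sub>\<infinity>i\<in>I. ?f i j)" by (rule infsum_swap_banach [OF sw])
  also have "\<dots> = l2_inner I x (mat_op I (conj_transpose a) y)"
    unfolding l2_inner_def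
  proof (rule infsum_cong)
    fix j assume j: "j \<in> I"
    have "kcnj (mat_op I (conj_transpose a) y j) = (\<Sum>\<^sub>\<infinity>i\<in>I. kcnj (conj_transpose a (j, i) * y i))"
      using j infsum_kcnj [OF col, of j] by (simp add: mat_op_def)
    also have "\<dots> = (\<Sum>\<^sub>\<infinity>i\<in>I. kcnj (y i) * a (i, j))"
      by (simp add: conj_transpose_def kcnj_mult kcnj_kcnj mult.commute)
    finally have "kcnj (mat_op I (conj_transpose a) y j) * x j = (\<Sum>\<^sub>\<infinity>i\<in>I. kcnj (y i) * a (i, j)) * x j"
      by simp
    also have "\<dots> = (\<Sum>\<^sub>\<infinity>i\<in>I. ?f i j)"
    proof (subst infsum_cmult_left [symmetric])
      have "(\<lambda>i. kcnj (conj_transpose a (j, i) * y i)) summable_on I"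
        by (rule summable_on_bounded_linear [OF bounded_linear_kcnj col])
      then show "(\<lambda>i. kcnj (y i) * a (i, j)) summable_on I"
        by (simp add: conj_transpose_def kcnj_mult kcnj_kcnj mult.commute)
    qed (simp add: mult.assoc)
    finally show "(\<Sum>\<^sub>\<infinity>i\<in>I. ?f i j) = kcnj (mat_op I (conj_transpose a) y j) * x j" by simp
  qed
  finally show ?thesis .
qed


section \<open>Singular values of a Hilbert-Schmidt matrix\<close>

lemma l2_inner_continuous:
  assumes \<eta>: "\<eta> \<in> l2 I"
  shows "continuous_on {x \<in> l2 I. l2.nsq I x \<le> 1} (\<lambda>x. l2_inner I x \<eta>)"
proof (rule continuous_on_uniform_approx)
  fix \<epsilon> :: real assume "\<epsilon> > 0"
  then obtain F where F: "finite F" "F \<subseteq> I" "l2.nsq I (\<eta> - truncation F \<eta>) \<le> \<epsilon>\<^sup>2"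
    using l2_truncation_approx [OF \<eta>, of "\<epsilon>\<^sup>2"] by auto
  let ?g = "\<lambda>x. \<Sum>i\<in>F. kcnj (\<eta> i) * x i"
  have "dist (l2_inner I x \<eta>) (?g x) \<le> \<epsilon>" if x: "x \<in> l2 I" "l2.nsq I x \<le> 1" for x
  proof -
    have "l2_inner I x (truncation F \<eta>) = (\<Sum>\<^sub>\<infinity>i\<in>F. kcnj (\<eta> i) * x i)"
      unfolding l2_inner_def by (rule infsum_cong_neutral) (use F in \<open>auto simp: truncation_def\<close>)
    then have g: "?g x = l2_inner I x (truncation F \<eta>)" using F by simp
    have "(dist (l2_inner I x \<eta>) (?g x))\<^sup>2 = (norm (l2_inner I x (\<eta> - truncation F \<eta>)))\<^sup>2"
      unfolding g dist_norm using l2.ip_diff_right [OF \<eta> truncation_l2 [OF F(1,2)] x(1)] by simp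
    also have "\<dots> \<le> l2.nsq I x * l2.nsq I (\<eta> - truncation F \<eta>)"
      using x F \<eta> by (intro l2.Cauchy_Schwarz l2.diff_mem truncation_l2)
    also have "\<dots> \<le> 1 * \<epsilon>\<^sup>2" by (intro mult_mono x F) simp_all
    finally show ?thesis using \<open>\<epsilon> > 0\<close> by (simp add: abs_le_square_iff [symmetric])
  qed
  moreover have "continuous_on {x \<in> l2 I. l2.nsq I x \<le> 1} ?g"
    by (intro continuous_intros continuous_on_product_then_coordinatewise continuous_on_id)
  ultimately show "\<exists>g. continuous_on {x \<in> l2 I. l2.nsq I x \<le> 1} g \<and>
      (\<forall>x\<in>{x \<in> l2 I. l2.nsq I x \<le> 1}. dist (l2_inner I x \<eta>) (g x) \<le> \<epsilon>)" by blast
qed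

lemma mat_op_sqrt_nsq_diff:
  assumes "a \<in> l2 (I \<times> I)" "b \<in> l2 (I \<times> I)" "x \<in> l2 I"
  shows "sqrt (l2.nsq I (mat_op I a x)) \<le>
    sqrt (l2.nsq I (mat_op I b x)) + sqrt (l2.nsq (I \<times> I) (a - b)) * sqrt (l2.nsq I x)"
proof -
  have ab: "a - b \<in> l2 (I \<times> I)" using assms by (intro l2.diff_mem)
  have "mat_op I a x = mat_op I b x + mat_op I (a - b) x"
    by (simp add: mat_op_matrix_diff [OF assms])
  then have "sqrt (l2.nsq I (mat_op I a x)) \<le>
      sqrt (l2.nsq I (mat_op I b x)) + sqrt (l2.nsq I (mat_op I (a - b) x))"
    using l2.nsq_triangle [OF mat_op_l2 [OF assms(2,3)] mat_op_l2 [OF ab assms(3)]] by simp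
  also have "sqrt (l2.nsq I (mat_op I (a - b) x)) \<le> sqrt (l2.nsq (I \<times> I) (a - b)) * sqrt (l2.nsq I x)"
    using mat_op_nsq_le [OF ab assms(3)] by (simp flip: real_sqrt_mult)
  finally show ?thesis by simp
qed

text \<open>
  For the topology of coordinatewise convergence: a truncation depends on finitely many coordinates,
  and the remainder is small in norm on the whole unit ball.
\<close>

lemma mat_op_norm_continuous:
  assumes a: "a \<in> l2 (I \<times> I)"
  shows "continuous_on {x \<in> l2 I. l2.nsq I x \<le> 1} (\<lambda>x. sqrt (l2.nsq I (mat_op I a x)))"
proof (rule continuous_on_uniform_approx)
  fix \<epsilon> :: real assume \<epsilon>: "\<epsilon> > 0"
  then obtain F where F: "finite F" "F \<subseteq> I \<times> I" "l2.nsq (I \<times> I) (a - truncation F a) \<le> \<epsilon>\<^sup>2"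
    using l2_truncation_approx [OF a, of "\<epsilon>\<^sup>2"] by auto
  let ?b = "truncation F a"
  have b: "?b \<in> l2 (I \<times> I)" by (rule truncation_l2 [OF F(1,2)])
  have s: "sqrt (l2.nsq (I \<times> I) (a - ?b)) \<le> \<epsilon>"
    using F(3) \<epsilon> by (intro real_le_lsqrt) auto
  have s': "sqrt (l2.nsq (I \<times> I) (?b - a)) \<le> \<epsilon>" using s l2.nsq_minus [OF a b] by simp
  let ?g = "\<lambda>x. sqrt (l2.nsq I (mat_op I ?b x))"
  have "dist (sqrt (l2.nsq I (mat_op I a x))) (?g x) \<le> \<epsilon>" if x: "x \<in> l2 I" "l2.nsq I x \<le> 1" for x
  proof -
    have "p * sqrt (l2.nsq I x) \<le> \<epsilon> * 1" if "p \<le> \<epsilon>" for p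
      using that x \<epsilon> by (intro mult_mono) auto
    then have "sqrt (l2.nsq (I \<times> I) (a - ?b)) * sqrt (l2.nsq I x) \<le> \<epsilon> * 1"
      "sqrt (l2.nsq (I \<times> I) (?b - a)) * sqrt (l2.nsq I x) \<le> \<epsilon> * 1"
      using s s' by blast+
    with mat_op_sqrt_nsq_diff [OF a b x(1)] mat_op_sqrt_nsq_diff [OF b a x(1)]
    show ?thesis by (simp add: dist_real_def)
  qed
  moreover have "continuous_on {x \<in> l2 I. l2.nsq I x \<le> 1} ?g"
  proof -
    let ?c = "\<lambda>x i. \<Sum>j\<in>snd ` F. ?b (i, j) * x j"
    have "?g x = sqrt (\<Sum>i\<in>fst ` F. (norm (?c x i))\<^sup>2)" if x: "x \<in> l2 I" for x
    proof -
      have c: "mat_op I ?b x i = (if i \<in> fst ` F then ?c x i else 0)" for i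
      proof (cases "i \<in> fst ` F")
        case True
        have "(\<Sum>\<^sub>\<infinity>j\<in>I. ?b (i, j) * x j) = (\<Sum>\<^sub>\<infinity>j\<in>snd ` F. ?b (i, j) * x j)"
          by (rule infsum_cong_neutral) (use F in \<open>force simp: truncation_def\<close>)+
        moreover have "i \<in> I" using True F by auto
        ultimately have "mat_op I ?b x i = (\<Sum>\<^sub>\<infinity>j\<in>snd ` F. ?b (i, j) * x j)"
          by (simp add: mat_op_def)
        then show ?thesis using True F by simp
      next
        case False
        then have "?b (i, j) = 0" for j by (force simp: truncation_def)
        then show ?thesis using False by (simp add: mat_op_def)
      qed
      have "((\<lambda>i. (norm (mat_op I ?b x i))\<^sup>2) has_sum (\<Sum>i\<in>fst ` F. (norm (?c x i))\<^sup>2)) I"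
        by (rule has_sum_finite_neutralI [of "fst ` F"]) (use F c in auto)
      then have "l2.nsq I (mat_op I ?b x) = (\<Sum>i\<in>fst ` F. (norm (?c x i))\<^sup>2)"
        using l2_nsq_has_sum [OF mat_op_l2 [OF b x]] has_sum_unique by blast
      then show ?thesis by simp
    qed
    moreover have "continuous_on {x \<in> l2 I. l2.nsq I x \<le> 1} (\<lambda>x. sqrt (\<Sum>i\<in>fst ` F. (norm (?c x i))\<^sup>2))"
      by (intro continuous_intros continuous_on_product_then_coordinatewise continuous_on_id)
    ultimately show ?thesis by (subst continuous_on_cong [OF refl]) auto
  qed
  ultimately show "\<exists>g. continuous_on {x \<in> l2 I. l2.nsq I x \<le> 1} g \<and>
      (\<forall>x\<in>{x \<in> l2 I. l2.nsq I x \<le> 1}. dist (sqrt (l2.nsq I (mat_op I a x))) (g x) \<le> \<epsilon>)" by blast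
qed

lemma l2_unit_ball_closed:
  "{x \<in> l2 I. l2.nsq I x \<le> 1} =
    (\<Inter>i\<in>-I. {x. x i = (0::'k::real_or_complex)}) \<inter> (\<Inter>F\<in>{F. finite F \<and> F \<subseteq> I}. {x. (\<Sum>i\<in>F. (norm (x i))\<^sup>2) \<le> 1})"
  (is "?B = ?C")
proof
  show "?B \<subseteq> ?C"
  proof
    fix x assume "x \<in> ?B"
    then have x: "x \<in> l2 I" "l2.nsq I x \<le> 1" by simp_all
    have "(\<Sum>i\<in>F. (norm (x i))\<^sup>2) \<le> 1" if "finite F" "F \<subseteq> I" for F
      using l2_sum_le [OF x(1) that] x(2) by linarith
    moreover have "x i = 0" if "i \<notin> I" for i using x(1) that by (simp add: l2_iff)
    ultimately show "x \<in> ?C" by blast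
  qed
  show "?C \<subseteq> ?B"
  proof
    fix x assume x: "x \<in> ?C"
    then have "x \<in> l2 I" by (intro l2I [of I x 1]) auto
    moreover from this have "l2.nsq I x \<le> 1" using x by (intro l2_nsq_leI) auto
    ultimately show "x \<in> ?B" by simp
  qed
qed

text \<open>A closed subset of a product of compact balls of the scalar field.\<close>

lemma l2_unit_ball_compact: "compact {x \<in> (l2 I :: ('i \<Rightarrow> 'k::real_or_complex) set). l2.nsq I x \<le> 1}"
proof -
  let ?B = "{x \<in> (l2 I :: ('i \<Rightarrow> 'k) set). l2.nsq I x \<le> 1}"
  let ?P = "PiE UNIV (\<lambda>_. cball 0 1) :: ('i \<Rightarrow> 'k) set"
  have "compactin (product_topology (\<lambda>_. euclidean) UNIV) ?P"
    unfolding compactin_PiE by (simp add: compactin_euclidean_iff)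
  then have P: "compact ?P" by (simp add: euclidean_product_topology compactin_euclidean_iff)
  have B: "closed ?B"
    unfolding l2_unit_ball_closed
    by (intro closed_Int closed_INT ballI closed_Collect_eq closed_Collect_le continuous_intros
        continuous_on_product_then_coordinatewise continuous_on_id)
  have "?B \<subseteq> ?P"
  proof
    fix x assume x: "x \<in> ?B"
    have "norm (x i) \<le> 1" for i
    proof (rule power2_le_imp_le)
      have "(norm (x i))\<^sup>2 \<le> l2.nsq I x" using x by (intro l2_component_le) simp
      then show "(norm (x i))\<^sup>2 \<le> 1\<^sup>2" using x by simp
    qed simp
    then show "x \<in> ?P" by (simp add: PiE_iff)
  qed
  then have "?P \<inter> ?B = ?B" by blast
  with compact_Int_closed [OF P B] show ?thesis by simp
qed

lemma mat_op_zero: "mat_op I a 0 = (0 :: 'i \<Rightarrow> 'k::real_or_complex)"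
  by (rule ext) (simp add: mat_op_def)

text \<open>
  The unit ball is compact in the topology of coordinatewise convergence, for which the matrix has a
  continuous norm function; so the norm attains its maximum on the orthogonal complement of finitely
  many vectors.
\<close>

lemma mat_op_maximiser:
  fixes g :: "nat \<Rightarrow> 'i \<Rightarrow> 'k::real_or_complex"
  assumes a: "a \<in> l2 (I \<times> I)" and g: "\<And>k. k < n \<Longrightarrow> g k \<in> l2 I"
  obtains \<sigma> x where "\<sigma> \<ge> 0" "x \<in> l2 I" "\<And>k. k < n \<Longrightarrow> l2_inner I x (g k) = 0"
    "l2.nsq I x = (if \<sigma> = 0 then 0 else 1)" "l2.nsq I (mat_op I a x) = \<sigma>\<^sup>2"
    "\<And>y. y \<in> l2 I \<Longrightarrow> (\<And>k. k < n \<Longrightarrow> l2_inner I y (g k) = 0) \<Longrightarrow>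
      l2.nsq I (mat_op I a y) \<le> \<sigma>\<^sup>2 * l2.nsq I y"
proof -
  let ?B = "{x \<in> l2 I. l2.nsq I x \<le> 1}"
  let ?K = "{x \<in> ?B. \<forall>k<n. l2_inner I x (g k) = 0}"
  have B: "closed ?B"
    unfolding l2_unit_ball_closed
    by (intro closed_Int closed_INT ballI closed_Collect_eq closed_Collect_le continuous_intros
        continuous_on_product_then_coordinatewise continuous_on_id)
  have "closed (?B \<inter> (\<lambda>x. l2_inner I x (g k)) -` {0})" if "k < n" for k
    by (intro continuous_closed_preimage l2_inner_continuous g that B closed_singleton)
  then have "closed (\<Inter>k\<in>{..<n}. ?B \<inter> (\<lambda>x. l2_inner I x (g k)) -` {0})" by (intro closed_INT) auto
  then have "compact (?B \<inter> (\<Inter>k\<in>{..<n}. ?B \<inter> (\<lambda>x. l2_inner I x (g k)) -` {0}))"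
    by (rule compact_Int_closed [OF l2_unit_ball_compact])
  also have "?B \<inter> (\<Inter>k\<in>{..<n}. ?B \<inter> (\<lambda>x. l2_inner I x (g k)) -` {0}) = ?K" by auto
  finally have "compact ?K" .
  moreover have "0 \<in> ?K"
    using l2.zero_mem [of I] g by (auto simp: l2.ip_zero l2.nsq_def)
  moreover have "continuous_on ?K (\<lambda>x. sqrt (l2.nsq I (mat_op I a x)))"
    by (rule continuous_on_subset [OF mat_op_norm_continuous [OF a]]) auto
  ultimately obtain x where x: "x \<in> ?K"
    and max: "\<And>y. y \<in> ?K \<Longrightarrow> sqrt (l2.nsq I (mat_op I a y)) \<le> sqrt (l2.nsq I (mat_op I a x))"
    using continuous_attains_sup [of ?K "\<lambda>x. sqrt (l2.nsq I (mat_op I a x))"] by blast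
  define \<sigma> where "\<sigma> = sqrt (l2.nsq I (mat_op I a x))"
  have \<sigma>: "\<sigma> \<ge> 0" "l2.nsq I (mat_op I a x) = \<sigma>\<^sup>2" by (simp_all add: \<sigma>_def)
  have bound: "l2.nsq I (mat_op I a y) \<le> \<sigma>\<^sup>2 * l2.nsq I y"
    if y: "y \<in> l2 I" "\<And>k. k < n \<Longrightarrow> l2_inner I y (g k) = 0" for y
  proof (cases "l2.nsq I y = 0")
    case True
    then have "y = 0" by (rule l2_nsq_zero [OF y(1)])
    then show ?thesis using True by (simp add: mat_op_zero)
  next
    case False
    then have pos: "l2.nsq I y > 0" using l2.nsq_nonneg [of I y] by linarith
    define s where "s = 1 / sqrt (l2.nsq I y)"
    have s: "s\<^sup>2 = 1 / l2.nsq I y" using pos by (simp add: s_def power_divide)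
    let ?z = "fscale (of_real s) y"
    have "l2.nsq I ?z = 1"
      using pos by (simp add: l2.nsq_scale [OF y(1)] s)
    then have "?z \<in> ?K" using y g by (auto simp: l2_scale l2.ip_scale)
    then have "l2.nsq I (mat_op I a ?z) \<le> \<sigma>\<^sup>2"
      unfolding \<sigma>(2) [symmetric] by (rule max [THEN real_sqrt_le_iff [THEN iffD1]])
    then have "l2.nsq I (mat_op I a y) / l2.nsq I y \<le> \<sigma>\<^sup>2"
      by (simp add: mat_op_scale [OF a y(1)] l2.nsq_scale [OF mat_op_l2 [OF a y(1)]] s)
    then show ?thesis using pos by (simp add: field_simps)
  qed
  show ?thesis
  proof (cases "\<sigma> = 0")
    case True
    have "l2.nsq I (0 :: 'i \<Rightarrow> 'k) = 0" by (simp add: l2.nsq_def l2.ip_zero l2.zero_mem)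
    then show ?thesis
      using True bound g by (intro that [of \<sigma> 0]) (auto simp: mat_op_zero l2.zero_mem l2.ip_zero)
  next
    case False
    have "\<sigma>\<^sup>2 * 1 \<le> \<sigma>\<^sup>2 * l2.nsq I x" using bound [of x] x \<sigma> by simp
    then have "1 \<le> l2.nsq I x" using False by (subst (asm) mult_le_cancel_left_pos) auto
    then have "l2.nsq I x = 1" using x by simp
    then show ?thesis using False \<sigma> bound x by (intro that [of \<sigma> x]) auto
  qed
qed

text \<open>The operator \<open>a\<^sup>* a\<close>.\<close>

definition gram :: "'i set \<Rightarrow> ('i \<times> 'i \<Rightarrow> 'k::real_or_complex) \<Rightarrow> ('i \<Rightarrow> 'k) \<Rightarrow> 'i \<Rightarrow> 'k"
  where "gram I a x = mat_op I (conj_transpose a) (mat_op I a x)"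

lemma gram_l2: "a \<in> l2 (I \<times> I) \<Longrightarrow> x \<in> l2 I \<Longrightarrow> gram I a x \<in> l2 I"
  by (simp add: gram_def mat_op_l2 conj_transpose_l2)

lemma gram_inner:
  assumes a: "a \<in> l2 (I \<times> I)" and x: "x \<in> l2 I" and y: "y \<in> l2 I"
  shows "l2_inner I x (gram I a y) = l2_inner I (mat_op I a x) (mat_op I a y)"
  unfolding gram_def by (rule mat_op_adjoint [OF a x mat_op_l2 [OF a y], symmetric])

lemma gram_symmetric:
  assumes a: "a \<in> l2 (I \<times> I)" and x: "x \<in> l2 I" and y: "y \<in> l2 I"
  shows "l2_inner I (gram I a x) y = l2_inner I x (gram I a y)"
proof -
  have "l2_inner I (gram I a x) y = kcnj (l2_inner I y (gram I a x))"
    by (rule l2.ip_herm [OF y gram_l2 [OF a x]])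
  also have "\<dots> = kcnj (l2_inner I (mat_op I a y) (mat_op I a x))" by (simp add: gram_inner [OF a y x])
  also have "\<dots> = l2_inner I (mat_op I a x) (mat_op I a y)"
    by (rule l2.ip_herm [symmetric]) (intro mat_op_l2 a x y)+
  finally show ?thesis by (simp add: gram_inner [OF a x y])
qed

text \<open>
  The residual \<open>y = a\<^sup>* a x - \<sigma>\<^sup>2 x\<close> is orthogonal to \<open>x\<close>, and \<open>\<langle>a x|a y\<rangle> = \<parallel>y\<parallel>\<^sup>2\<close>. So the step from the
  maximiser \<open>x\<close> to \<open>x + y/\<sigma>\<^sup>2\<close> would increase the quotient of the norms unless \<open>y = 0\<close>.
\<close>

lemma maximiser_eigenvector:
  fixes x :: "'i \<Rightarrow> 'k::real_or_complex"
  assumes a: "a \<in> l2 (I \<times> I)" and x: "x \<in> l2 I" "l2.nsq I x = 1" and \<sigma>: "\<sigma> > 0"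
    and Ax: "l2.nsq I (mat_op I a x) = \<sigma>\<^sup>2"
    and max: "\<And>s. l2.nsq I (mat_op I a (x + fscale (of_real s) (gram I a x - fscale (of_real (\<sigma>\<^sup>2)) x)))
      \<le> \<sigma>\<^sup>2 * l2.nsq I (x + fscale (of_real s) (gram I a x - fscale (of_real (\<sigma>\<^sup>2)) x))"
  shows "gram I a x = fscale (of_real (\<sigma>\<^sup>2)) x"
proof -
  define y where "y = gram I a x - fscale (of_real (\<sigma>\<^sup>2)) x"
  have Bx: "gram I a x \<in> l2 I" by (rule gram_l2 [OF a x(1)])
  have y: "y \<in> l2 I" unfolding y_def by (intro l2.diff_mem Bx l2_scale x)
  have xx: "l2_inner I x x = 1" using l2.ip_self [OF x(1)] x(2) by simp
  have "l2_inner I x (gram I a x) = of_real (\<sigma>\<^sup>2)"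
    using gram_inner [OF a x(1) x(1)] l2.ip_self [OF mat_op_l2 [OF a x(1)]] Ax by simp
  then have xy: "l2_inner I x y = 0"
    using xx by (simp add: y_def l2.ip_diff_right Bx l2_scale x l2.ip_scale_right
        del: of_real_power)
  then have yx: "l2_inner I y x = 0" using l2.ip_herm [OF x(1) y] by simp
  have yBx: "l2_inner I y (gram I a x) = of_real (l2.nsq I y)"
  proof -
    have "gram I a x = y + fscale (of_real (\<sigma>\<^sup>2)) x" by (simp add: y_def)
    then have "l2_inner I y (gram I a x) = l2_inner I y y + kcnj (of_real (\<sigma>\<^sup>2)) * l2_inner I y x"
      using y x by (simp add: l2.ip_add_right l2_scale l2.ip_scale_right del: of_real_power)
    then show ?thesis using yx l2.ip_self [OF y] by simp
  qed
  define s where "s = 1 / \<sigma>\<^sup>2"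
  have s: "s > 0" "\<sigma>\<^sup>2 * s = 1" using \<sigma> by (simp_all add: s_def)
  let ?z = "fscale (of_real s) y"
  have z: "?z \<in> l2 I" by (rule l2_scale [OF y])
  have "l2_inner I (mat_op I a ?z) (mat_op I a x) = of_real (s * l2.nsq I y)"
    using yBx gram_inner [OF a z x(1)] by (simp add: l2.ip_scale y Bx)
  then have Azx: "l2_inner I (mat_op I a x) (mat_op I a ?z) = of_real (s * l2.nsq I y)"
    using l2.ip_herm [OF mat_op_l2 [OF a z] mat_op_l2 [OF a x(1)]] by (metis kcnj_of_real)
  have "(of_real (l2.nsq I (mat_op I a (x + ?z))) :: 'k) =
      of_real (\<sigma>\<^sup>2 + l2.nsq I (mat_op I a ?z) + (s * l2.nsq I y + s * l2.nsq I y))"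
    unfolding mat_op_add [OF a x(1) z] l2.nsq_add [OF mat_op_l2 [OF a x(1)] mat_op_l2 [OF a z]]
      Azx Ax kcnj_of_real of_real_add ..
  then have "l2.nsq I (mat_op I a (x + ?z)) = \<sigma>\<^sup>2 + l2.nsq I (mat_op I a ?z) + (s * l2.nsq I y + s * l2.nsq I y)"
    by (simp only: of_real_eq_iff)
  moreover have "(of_real (l2.nsq I (x + ?z)) :: 'k) = of_real (1 + s\<^sup>2 * l2.nsq I y)"
    unfolding l2.nsq_add [OF x(1) z] using x y xy
    by (simp add: l2.ip_scale_right l2.nsq_scale)
  then have "l2.nsq I (x + ?z) = 1 + s\<^sup>2 * l2.nsq I y" by (simp only: of_real_eq_iff)
  moreover have "l2.nsq I (mat_op I a (x + ?z)) \<le> \<sigma>\<^sup>2 * l2.nsq I (x + ?z)"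
    unfolding y_def by (rule max)
  ultimately have "\<sigma>\<^sup>2 + l2.nsq I (mat_op I a ?z) + (s * l2.nsq I y + s * l2.nsq I y)
      \<le> \<sigma>\<^sup>2 * (1 + s\<^sup>2 * l2.nsq I y)" by (simp only:)
  then have "\<sigma>\<^sup>2 + (s * l2.nsq I y + s * l2.nsq I y) \<le> \<sigma>\<^sup>2 * (1 + s\<^sup>2 * l2.nsq I y)"
    using l2.nsq_nonneg [of I "mat_op I a ?z"] by linarith
  also have "\<dots> = \<sigma>\<^sup>2 + (\<sigma>\<^sup>2 * s) * (s * l2.nsq I y)" by (simp add: power2_eq_square algebra_simps)
  also have "\<dots> = \<sigma>\<^sup>2 + s * l2.nsq I y" by (simp add: s(2))
  finally have "s * l2.nsq I y \<le> 0" by linarith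
  then have "l2.nsq I y = 0" using s l2.nsq_nonneg [of I y] by (simp add: mult_le_0_iff)
  then have "y = 0" by (rule l2_nsq_zero [OF y])
  then show ?thesis by (simp add: y_def)
qed

text \<open>
  The singular values with orthonormal eigenvectors of \<open>a\<^sup>* a\<close>. The last condition is the maximum
  property of each singular value. When the rank is finite, the sequence is continued by zero vectors.
\<close>

definition singular_system ::
    "'i set \<Rightarrow> ('i \<times> 'i \<Rightarrow> 'k::real_or_complex) \<Rightarrow> (nat \<Rightarrow> real) \<Rightarrow> (nat \<Rightarrow> 'i \<Rightarrow> 'k) \<Rightarrow> bool"
  where "singular_system I a \<sigma> v \<longleftrightarrow>
    (\<forall>n. \<sigma> n \<ge> 0 \<and> v n \<in> l2 I \<and> gram I a (v n) = fscale (of_real ((\<sigma> n)\<^sup>2)) (v n) \<and>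
      l2.nsq I (mat_op I a (v n)) = (\<sigma> n)\<^sup>2) \<and>
    (\<forall>m n. l2_inner I (v m) (v n) = (if m = n \<and> \<sigma> n \<noteq> 0 then 1 else 0)) \<and>
    (\<forall>n. \<forall>y\<in>l2 I. (\<forall>k<n. l2_inner I y (v k) = 0) \<longrightarrow>
      l2.nsq I (mat_op I a y) \<le> (\<sigma> n)\<^sup>2 * l2.nsq I y)"

text \<open>
  Each vector maximises the norm on the complement of the earlier ones. That complement is invariant under
  \<open>a\<^sup>* a\<close>, since the earlier vectors are eigenvectors, so the new vector is an eigenvector too.
\<close>

lemma singular_system_exists:
  fixes a :: "'i \<times> 'i \<Rightarrow> 'k::real_or_complex"
  assumes a: "a \<in> l2 (I \<times> I)"
  obtains \<sigma> v where "singular_system I a \<sigma> v"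
proof -
  define P where "P f n r \<longleftrightarrow> fst r \<ge> 0 \<and> snd r \<in> l2 I \<and>
      gram I a (snd r) = fscale (of_real ((fst r)\<^sup>2)) (snd r) \<and>
      l2.nsq I (mat_op I a (snd r)) = (fst r)\<^sup>2 \<and> l2.nsq I (snd r) = (if fst r = 0 then 0 else 1) \<and>
      (\<forall>k<n. l2_inner I (snd r) (snd (f k)) = 0) \<and>
      (\<forall>y\<in>l2 I. (\<forall>k<n. l2_inner I y (snd (f k)) = 0) \<longrightarrow>
        l2.nsq I (mat_op I a y) \<le> (fst r)\<^sup>2 * l2.nsq I y)"
    for f :: "nat \<Rightarrow> real \<times> ('i \<Rightarrow> 'k)" and n r
  have "\<exists>f. \<forall>n. P f n (f n)"
  proof (rule dependent_wf_choice [of less_than])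
    show "P f n r = P g n r" if "\<And>m. (m, n) \<in> less_than \<Longrightarrow> f m = g m" for f g n r
      using that by (simp add: P_def cong: imp_cong)
    fix n and f :: "nat \<Rightarrow> real \<times> ('i \<Rightarrow> 'k)"
    assume *: "\<And>m. (m, n) \<in> less_than \<Longrightarrow> P f m (f m)"
    have prev: "snd (f k) \<in> l2 I" "gram I a (snd (f k)) = fscale (of_real ((fst (f k))\<^sup>2)) (snd (f k))"
      if "k < n" for k using * [of k] that by (auto simp: P_def)
    obtain \<sigma> x where x: "\<sigma> \<ge> 0" "x \<in> l2 I" "\<And>k. k < n \<Longrightarrow> l2_inner I x (snd (f k)) = 0"
      "l2.nsq I x = (if \<sigma> = 0 then 0 else 1)" "l2.nsq I (mat_op I a x) = \<sigma>\<^sup>2"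
      and max: "\<And>y. y \<in> l2 I \<Longrightarrow> (\<And>k. k < n \<Longrightarrow> l2_inner I y (snd (f k)) = 0) \<Longrightarrow>
        l2.nsq I (mat_op I a y) \<le> \<sigma>\<^sup>2 * l2.nsq I y"
      using mat_op_maximiser [OF a, of n "\<lambda>k. snd (f k)"] prev by blast
    have "gram I a x = fscale (of_real (\<sigma>\<^sup>2)) x"
    proof (cases "\<sigma> = 0")
      case True
      then have "x = 0" using x by (intro l2_nsq_zero) auto
      then show ?thesis by (auto simp: gram_def mat_op_zero fscale_def)
    next
      case False
      let ?y = "gram I a x - fscale (of_real (\<sigma>\<^sup>2)) x"
      have y: "?y \<in> l2 I" using a x by (intro l2.diff_mem gram_l2 l2_scale)
      \<comment> \<open>the earlier vectors are eigenvectors, so the residual stays orthogonal to them\<close>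
      have "l2_inner I (x + fscale (of_real s) ?y) (snd (f k)) = 0" if k: "k < n" for k s
      proof -
        have "l2_inner I (gram I a x) (snd (f k)) = 0"
          using gram_symmetric [OF a x(2) prev(1) [OF k]] prev [OF k] x(2,3) k
          by (simp add: l2.ip_scale_right del: of_real_power)
        then show ?thesis
          using x(2,3) k prev(1) [OF k] y
          by (simp add: l2.ip_add l2_scale l2.ip_scale l2.ip_diff gram_l2 [OF a] del: of_real_power)
      qed
      then show ?thesis
        using False x y by (intro maximiser_eigenvector [OF a] max l2_add l2_scale) auto
    qed
    then have "P f n (\<sigma>, x)" using x max by (auto simp: P_def)
    then show "\<exists>r. P f n r" by blast
  qed simp
  then obtain f where f: "\<And>n. P f n (f n)" by blast
  let ?\<sigma> = "\<lambda>n. fst (f n)" and ?v = "\<lambda>n. snd (f n)"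
  have l: "?v n \<in> l2 I" for n using f [of n] by (simp add: P_def)
  have "l2_inner I (?v m) (?v n) = (if m = n \<and> ?\<sigma> n \<noteq> 0 then 1 else 0)" for m n
  proof (rule linorder_cases [of m n])
    assume "m = n"
    then show ?thesis using l2.ip_self [OF l, of n] f [of n] by (auto simp: P_def)
  next
    assume mn: "m < n"
    then have "l2_inner I (?v n) (?v m) = 0" using f [of n] by (auto simp: P_def)
    then show ?thesis using mn l2.ip_herm [OF l l, of m n] by simp
  next
    assume "n < m"
    then show ?thesis using f [of m] by (auto simp: P_def)
  qed
  then have "singular_system I a ?\<sigma> ?v" using f unfolding singular_system_def P_def by blast
  then show ?thesis by (rule that)
qed


section \<open>Eigenspaces and Weyl's inequality\<close>

context
  fixes I :: "'i set" and a :: "'i \<times> 'i \<Rightarrow> 'k::real_or_complex" and \<sigma> v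
  assumes a: "a \<in> l2 (I \<times> I)" and sys: "singular_system I a \<sigma> v"
begin

lemma sys_nonneg: "\<sigma> n \<ge> 0"
  and sys_l2: "v n \<in> l2 I"
  and sys_gram: "gram I a (v n) = fscale (of_real ((\<sigma> n)\<^sup>2)) (v n)"
  and sys_nsq: "l2.nsq I (mat_op I a (v n)) = (\<sigma> n)\<^sup>2"
  and sys_inner: "l2_inner I (v m) (v n) = (if m = n \<and> \<sigma> n \<noteq> 0 then 1 else 0)"
  and sys_bound: "y \<in> l2 I \<Longrightarrow> (\<And>k. k < n \<Longrightarrow> l2_inner I y (v k) = 0) \<Longrightarrow>
      l2.nsq I (mat_op I a y) \<le> (\<sigma> n)\<^sup>2 * l2.nsq I y"
  using sys unfolding singular_system_def by blast+

lemma sys_orthonormal: "(\<And>n. n \<in> J \<Longrightarrow> \<sigma> n \<noteq> 0) \<Longrightarrow> l2.orthonormal_on I J v"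
  unfolding l2.orthonormal_on_def by (auto simp: sys_l2 sys_inner)

lemma sys_decseq: "decseq \<sigma>"
proof (rule decseq_SucI)
  fix n
  have "(\<sigma> (Suc n))\<^sup>2 \<le> (\<sigma> n)\<^sup>2 * l2.nsq I (v (Suc n))"
    using sys_bound [of "v (Suc n)" n] by (simp add: sys_l2 sys_inner sys_nsq)
  also have "\<dots> \<le> (\<sigma> n)\<^sup>2 * 1" by (intro mult_left_mono) (simp_all add: l2.nsq_def sys_inner)
  finally show "\<sigma> (Suc n) \<le> \<sigma> n" using sys_nonneg by (simp add: power2_le_iff_abs_le)
qed

lemma sys_sum_le: assumes "finite J" shows "(\<Sum>n\<in>J. (\<sigma> n)\<^sup>2) \<le> l2.nsq (I \<times> I) a"
proof -
  have "(\<Sum>n\<in>J. (\<sigma> n)\<^sup>2) = (\<Sum>n\<in>{n\<in>J. \<sigma> n \<noteq> 0}. (\<sigma> n)\<^sup>2)"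
    using assms by (intro sum.mono_neutral_right) auto
  also have "\<dots> = (\<Sum>n\<in>{n\<in>J. \<sigma> n \<noteq> 0}. l2.nsq I (mat_op I a (v n)))" by (simp add: sys_nsq)
  also have "\<dots> \<le> l2.nsq (I \<times> I) a"
    using assms by (intro mat_op_orthonormal a sys_orthonormal) auto
  finally show ?thesis .
qed

lemma sys_tendsto_zero: "\<sigma> \<longlonglongrightarrow> 0"
proof -
  have "summable (\<lambda>n. (\<sigma> n)\<^sup>2)"
    by (rule bounded_imp_summable [of _ "l2.nsq (I \<times> I) a"]) (simp_all add: sys_sum_le)
  then have "(\<lambda>n. (\<sigma> n)\<^sup>2) \<longlonglongrightarrow> 0" by (rule summable_LIMSEQ_zero)
  then have "(\<lambda>n. sqrt ((\<sigma> n)\<^sup>2)) \<longlonglongrightarrow> sqrt 0" by (rule tendsto_real_sqrt)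
  then show ?thesis by (simp add: sys_nonneg)
qed

lemma sys_gram_combination:
  assumes "finite J"
  shows "gram I a (l2.combination J c v) = l2.combination J (\<lambda>n. c n * of_real ((\<sigma> n)\<^sup>2)) v"
proof -
  have add: "gram I a (x + y) = gram I a x + gram I a y" if "x \<in> l2 I" "y \<in> l2 I" for x y
    using that by (simp add: gram_def mat_op_add [OF a] mat_op_add [OF conj_transpose_l2 [OF a]] mat_op_l2 [OF a])
  have scale: "gram I a (fscale c x) = fscale c (gram I a x)" if "x \<in> l2 I" for x c
    using that by (simp add: gram_def mat_op_scale [OF a] mat_op_scale [OF conj_transpose_l2 [OF a]] mat_op_l2 [OF a])
  have "gram I a (\<Sum>n\<in>J. fscale (c n) (v n)) = (\<Sum>n\<in>J. gram I a (fscale (c n) (v n)))"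
    using assms
  proof (induction J)
    case empty
    then show ?case by (simp only: sum.empty gram_def mat_op_zero)
  next
    case (insert n J)
    have "gram I a (fscale (c n) (v n) + (\<Sum>n\<in>J. fscale (c n) (v n))) =
        gram I a (fscale (c n) (v n)) + gram I a (\<Sum>n\<in>J. fscale (c n) (v n))"
      by (intro add l2_scale sys_l2 l2.sum_mem)
    then show ?case by (simp only: sum.insert [OF insert.hyps] insert.IH)
  qed
  also have "\<dots> = (\<Sum>n\<in>J. fscale (c n * of_real ((\<sigma> n)\<^sup>2)) (v n))"
  proof (rule sum.cong [OF refl])
    fix n
    show "gram I a (fscale (c n) (v n)) = fscale (c n * of_real ((\<sigma> n)\<^sup>2)) (v n)"
      unfolding scale [OF sys_l2] sys_gram by (simp add: fscale_def mult.assoc)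
  qed
  finally show ?thesis by (simp add: l2.combination_def)
qed

text \<open>
  The images of the singular vectors are orthogonal, so on the span of those with singular value at
  least \<open>s\<close> the matrix stretches by at least \<open>s\<close>.
\<close>

lemma sys_combination_lower:
  fixes c :: "nat \<Rightarrow> 'k"
  assumes J: "finite J" "\<And>n. n \<in> J \<Longrightarrow> s \<le> \<sigma> n" and s: "s > 0"
  defines "y \<equiv> l2.combination J c v"
  shows "y \<in> l2 I" "l2.nsq I y = (\<Sum>n\<in>J. (norm (c n))\<^sup>2)"
    "s\<^sup>2 * l2.nsq I y \<le> l2.nsq I (mat_op I a y)"
proof -
  have e: "l2.orthonormal_on I J v" using J s by (intro sys_orthonormal) force
  show y: "y \<in> l2 I" unfolding y_def by (rule l2.combination_mem [OF e])
  have *: "l2_inner I (l2.combination J d v) y = (\<Sum>n\<in>J. d n * kcnj (c n))" for d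
  proof -
    have "l2_inner I (v n) y = kcnj (c n)" if n: "n \<in> J" for n
      using l2.ip_herm [OF y sys_l2 [of n]] l2.ip_combination_basis [OF e J(1) n] by (simp add: y_def)
    then show ?thesis by (simp add: l2.ip_combination [OF e y])
  qed
  have "(of_real (l2.nsq I y) :: 'k) = of_real (\<Sum>n\<in>J. (norm (c n))\<^sup>2)"
    using * [of c] l2.ip_self [OF y] by (simp add: y_def mult_kcnj_of_real)
  then show n: "l2.nsq I y = (\<Sum>n\<in>J. (norm (c n))\<^sup>2)" by (simp only: of_real_eq_iff)
  have "(of_real (l2.nsq I (mat_op I a y)) :: 'k) = l2_inner I (gram I a y) y"
    using gram_inner [OF a y y] gram_symmetric [OF a y y] l2.ip_self [OF mat_op_l2 [OF a y]] by simp
  also have "\<dots> = (\<Sum>n\<in>J. c n * of_real ((\<sigma> n)\<^sup>2) * kcnj (c n))"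
    using * sys_gram_combination [OF J(1), of c] by (simp add: y_def del: of_real_power)
  also have "\<dots> = of_real (\<Sum>n\<in>J. (\<sigma> n)\<^sup>2 * (norm (c n))\<^sup>2)"
    unfolding of_real_sum of_real_mult mult_kcnj_of_real [symmetric]
    by (intro sum.cong) (simp_all add: mult_ac)
  finally have "l2.nsq I (mat_op I a y) = (\<Sum>n\<in>J. (\<sigma> n)\<^sup>2 * (norm (c n))\<^sup>2)"
    by (simp only: of_real_eq_iff)
  also have "\<dots> \<ge> (\<Sum>n\<in>J. s\<^sup>2 * (norm (c n))\<^sup>2)"
    using J s by (intro sum_mono mult_right_mono power_mono) auto
  finally show "s\<^sup>2 * l2.nsq I y \<le> l2.nsq I (mat_op I a y)" by (simp add: n sum_distrib_left)
qed

text \<open>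
  The vectors with singular value \<open>s\<close> span the eigenspace: what they leave of an eigenvector is
  orthogonal to the whole system and hence in the kernel of the matrix.
\<close>

lemma sys_eigenspace_dim:
  assumes s: "s > 0"
  shows "card {n. \<sigma> n = s} =
    vector_space.dim fscale {\<zeta> \<in> l2 I. gram I a \<zeta> = fscale (of_real (s\<^sup>2)) \<zeta>}"
proof -
  interpret V: vector_space "fscale :: 'k \<Rightarrow> ('i \<Rightarrow> 'k) \<Rightarrow> 'i \<Rightarrow> 'k" by (rule vector_space_fscale)
  let ?N = "{n. \<sigma> n = s}"
  let ?E = "{\<zeta> \<in> l2 I. gram I a \<zeta> = fscale (of_real (s\<^sup>2)) \<zeta>}"
  have "eventually (\<lambda>n. \<sigma> n < s) sequentially"
    by (rule order_tendstoD(2) [OF sys_tendsto_zero s])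
  then obtain m where m: "\<And>n. n \<ge> m \<Longrightarrow> \<sigma> n < s" by (auto simp: eventually_sequentially)
  have "?N \<subseteq> {..<m}" using m by (force simp: not_less [symmetric])
  then have fin: "finite ?N" by (rule finite_subset) simp
  have e: "l2.orthonormal_on I ?N v" using s by (intro sys_orthonormal) auto
  have inj: "inj_on v ?N"
  proof (rule inj_onI)
    fix m n assume "m \<in> ?N" "n \<in> ?N" "v m = v n"
    then show "m = n" using sys_inner [of m n] sys_inner [of n n] s by (auto split: if_splits)
  qed
  have "V.dim ?E = card (v ` ?N)"
  proof (rule V.dim_unique)
    show "v ` ?N \<subseteq> ?E" using sys_l2 sys_gram by auto
    show "V.independent (v ` ?N)"
    proof (rule V.independent_if_scalars_zero)
      show "finite (v ` ?N)" using fin by simp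
      fix f x assume 0: "(\<Sum>x\<in>v ` ?N. fscale (f x) x) = 0" and "x \<in> v ` ?N"
      then obtain n where n: "n \<in> ?N" "x = v n" by blast
      have "l2.combination ?N (\<lambda>n. f (v n)) v = 0"
        using 0 by (simp add: l2.combination_def sum.reindex [OF inj])
      then show "f x = 0"
        using l2.ip_combination_basis [OF e fin n(1), of "\<lambda>n. f (v n)"] n(2)
        by (simp only: l2.ip_zero [OF sys_l2])
    qed
    show "?E \<subseteq> V.span (v ` ?N)"
    proof
      fix \<zeta> assume "\<zeta> \<in> ?E"
      then have \<zeta>: "\<zeta> \<in> l2 I" "gram I a \<zeta> = fscale (of_real (s\<^sup>2)) \<zeta>" by auto
      let ?p = "l2.combination ?N (\<lambda>n. l2_inner I \<zeta> (v n)) v"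
      define y where "y = \<zeta> - ?p"
      have p: "?p \<in> l2 I" by (rule l2.combination_mem [OF e])
      have y: "y \<in> l2 I" unfolding y_def by (intro l2.diff_mem \<zeta> p)
      have "l2_inner I y (v n) = 0" for n
      proof (cases "n \<in> ?N")
        case True
        then show ?thesis
          using l2.ip_combination_basis [OF e fin True] by (simp add: y_def l2.ip_diff \<zeta> p sys_l2)
      next
        case False
        have "of_real (s\<^sup>2) * l2_inner I \<zeta> (v n) = of_real ((\<sigma> n)\<^sup>2) * l2_inner I \<zeta> (v n)"
          using gram_symmetric [OF a \<zeta>(1) sys_l2 [of n]] \<zeta> sys_gram [of n] sys_l2 [of n]
          by (simp add: l2.ip_scale l2.ip_scale_right del: of_real_power)
        moreover have "(of_real (s\<^sup>2) :: 'k) \<noteq> of_real ((\<sigma> n)\<^sup>2)"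
          using False s sys_nonneg [of n] by (simp only: of_real_eq_iff) (auto simp: power2_eq_iff)
        ultimately have "l2_inner I \<zeta> (v n) = 0" by (metis mult_cancel_right)
        moreover have "l2_inner I ?p (v n) = 0"
          using False by (subst l2.ip_combination [OF e sys_l2]) (auto simp: sys_inner intro!: sum.neutral)
        ultimately show ?thesis by (simp add: y_def l2.ip_diff \<zeta> p sys_l2)
      qed
      then have b: "l2.nsq I (mat_op I a y) \<le> (\<sigma> n)\<^sup>2 * l2.nsq I y" for n
        using sys_bound [OF y] by blast
      have "(\<lambda>n. (\<sigma> n)\<^sup>2 * l2.nsq I y) \<longlonglongrightarrow> 0\<^sup>2 * l2.nsq I y"
        by (intro tendsto_intros sys_tendsto_zero)
      then have "l2.nsq I (mat_op I a y) \<le> 0"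
        using b by (intro LIMSEQ_le_const) auto
      then have "l2.nsq I (mat_op I a y) = 0" using l2.nsq_nonneg antisym by blast
      then have "mat_op I a y = 0" using l2_nsq_zero mat_op_l2 [OF a y] by blast
      then have "gram I a y = 0" by (simp add: gram_def mat_op_zero)
      moreover have "gram I a y = fscale (of_real (s\<^sup>2)) y"
      proof -
        have "gram I a ?p = fscale (of_real (s\<^sup>2)) ?p"
          unfolding sys_gram_combination [OF fin]
          by (rule ext) (auto simp: l2.combination_def sum_fun_apply sum_distrib_left intro!: sum.cong)
        moreover have "gram I a y = gram I a \<zeta> - gram I a ?p"
          unfolding y_def gram_def
          by (simp add: mat_op_diff [OF a \<zeta>(1) p] mat_op_diff [OF conj_transpose_l2 [OF a]] mat_op_l2 [OF a] \<zeta> p)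
        ultimately have "gram I a y = fscale (of_real (s\<^sup>2)) \<zeta> - fscale (of_real (s\<^sup>2)) ?p"
          using \<zeta>(2) by (simp only:)
        also have "\<dots> = fscale (of_real (s\<^sup>2)) y" by (rule ext) (simp add: y_def algebra_simps)
        finally show ?thesis .
      qed
      ultimately have "of_real (s\<^sup>2) * y i = 0" for i by (metis fscale_apply zero_fun_apply)
      then have "y = 0" using s by auto
      then have "\<zeta> = ?p" by (simp add: y_def)
      also have "?p \<in> V.span (v ` ?N)"
        unfolding l2.combination_def by (intro V.span_sum V.span_scale V.span_base) auto
      finally show "\<zeta> \<in> V.span (v ` ?N)" .
    qed
  qed simp
  then show ?thesis by (simp add: card_image [OF inj])
qed

end

text \<open>Gaussian elimination: an equation with a nonzero coefficient is used to eliminate one unknown.\<close>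

lemma homogeneous_system_nontrivial:
  fixes m :: "'e \<Rightarrow> 'j \<Rightarrow> 'k::field"
  assumes "finite E" "finite J" "card E < card J"
  shows "\<exists>c. (\<exists>j\<in>J. c j \<noteq> 0) \<and> (\<forall>i\<in>E. (\<Sum>j\<in>J. c j * m i j) = 0)"
  using assms
proof (induction E arbitrary: J m rule: finite_induct)
  case empty
  then have "J \<noteq> {}" by auto
  then show ?case by (intro exI [of _ "\<lambda>_. 1"]) auto
next
  case (insert e E)
  show ?case
  proof (cases "\<forall>j\<in>J. m e j = 0")
    case True
    obtain c where "\<exists>j\<in>J. c j \<noteq> 0" "\<forall>i\<in>E. (\<Sum>j\<in>J. c j * m i j) = 0"
      using insert.IH [of J m] insert.prems insert.hyps by auto
    with True show ?thesis by (intro exI [of _ c]) auto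
  next
    case False
    then obtain p where p: "p \<in> J" "m e p \<noteq> 0" by blast
    let ?J = "J - {p}"
    have "card E < card ?J" using insert.prems insert.hyps p by (simp add: card_Diff_singleton)
    then obtain c where c: "\<exists>j\<in>?J. c j \<noteq> 0"
      "\<forall>i\<in>E. (\<Sum>j\<in>?J. c j * (m i j - m i p * m e j / m e p)) = 0"
      using insert.IH [of ?J "\<lambda>i j. m i j - m i p * m e j / m e p"] insert.prems by auto
    \<comment> \<open>the value at \<open>p\<close> solves the equation \<open>e\<close>\<close>
    define d where "d = c(p := - (\<Sum>j\<in>?J. c j * m e j) / m e p)"
    have split: "(\<Sum>j\<in>J. d j * m i j) = (\<Sum>j\<in>?J. c j * m i j) - (\<Sum>j\<in>?J. c j * m e j) / m e p * m i p" for i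
    proof -
      have "(\<Sum>j\<in>J. d j * m i j) = d p * m i p + (\<Sum>j\<in>?J. d j * m i j)"
        using p insert.prems by (intro sum.remove)
      moreover have "(\<Sum>j\<in>?J. d j * m i j) = (\<Sum>j\<in>?J. c j * m i j)"
        by (intro sum.cong) (auto simp: d_def)
      ultimately show ?thesis by (simp add: d_def)
    qed
    have "(\<Sum>j\<in>J. d j * m i j) = 0" if "i \<in> insert e E" for i
    proof (cases "i = e")
      case True then show ?thesis unfolding split using p by simp
    next
      case False
      then have "(\<Sum>j\<in>?J. c j * (m i j - m i p * m e j / m e p)) = 0" using that c by auto
      moreover have "(\<Sum>j\<in>?J. c j * (m i j - m i p * m e j / m e p)) =
          (\<Sum>j\<in>?J. c j * m i j) - (\<Sum>j\<in>?J. c j * m e j) / m e p * m i p"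
        by (simp add: right_diff_distrib sum_subtractf sum_divide_distrib sum_distrib_left sum_distrib_right mult_ac)
      ultimately show ?thesis by (simp add: split)
    qed
    moreover have "\<exists>j\<in>J. d j \<noteq> 0" using c(1) by (auto simp: d_def)
    ultimately show ?thesis by blast
  qed
qed

text \<open>
  Weyl's inequality. Among the combinations of the first \<open>n + N + 1\<close> vectors of the system of \<open>a\<close>,
  which \<open>a\<close> stretches by at least \<open>\<sigma> (n + N)\<close>, one is orthogonal to the first \<open>n\<close> vectors of the
  system of \<open>b\<close> and to the \<open>N\<close> vectors \<open>g\<close>.
\<close>

lemma singular_value_le:
  fixes a b :: "'i \<times> 'i \<Rightarrow> 'k::real_or_complex"
  assumes a: "a \<in> l2 (I \<times> I)" "singular_system I a \<sigma> v"
    and b: "b \<in> l2 (I \<times> I)" "singular_system I b \<tau> u"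
    and g: "\<And>k. k < N \<Longrightarrow> g k \<in> l2 I" and \<delta>: "\<delta> \<ge> 0"
    and le: "\<And>y. y \<in> l2 I \<Longrightarrow> (\<And>k. k < N \<Longrightarrow> l2_inner I y (g k) = 0) \<Longrightarrow>
      sqrt (l2.nsq I (mat_op I a y)) \<le> sqrt (l2.nsq I (mat_op I b y)) + \<delta> * sqrt (l2.nsq I y)"
  shows "\<sigma> (n + N) \<le> \<tau> n + \<delta>"
proof (cases "\<sigma> (n + N) = 0")
  case True
  then show ?thesis using sys_nonneg [OF b, of n] \<delta> by simp
next
  case False
  define s where "s = \<sigma> (n + N)"
  have s: "s > 0" using False sys_nonneg [OF a, of "n + N"] by (simp add: s_def)
  \<comment> \<open>the \<open>n + N\<close> vectors to which the combination is made orthogonal\<close>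
  define w where "w = (\<lambda>k. if k < n then u k else g (k - n))"
  have w: "w k \<in> l2 I" if "k < n + N" for k
    using that g sys_l2 [OF b] by (auto simp: w_def)
  obtain c where c: "\<exists>j\<in>{..n + N}. c j \<noteq> 0"
    "\<forall>k\<in>{..<n + N}. (\<Sum>j\<in>{..n + N}. c j * l2_inner I (v j) (w k)) = 0"
    using homogeneous_system_nontrivial [of "{..<n + N}" "{..n + N}" "\<lambda>k j. l2_inner I (v j) (w k)"]
    by auto
  have J: "s \<le> \<sigma> j" if "j \<in> {..n + N}" for j
    using decseqD [OF sys_decseq [OF a]] that by (auto simp: s_def)
  define y where "y = l2.combination {..n + N} c v"
  have y: "y \<in> l2 I" "l2.nsq I y = (\<Sum>j\<le>n + N. (norm (c j))\<^sup>2)"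
    "s\<^sup>2 * l2.nsq I y \<le> l2.nsq I (mat_op I a y)"
    unfolding y_def by (rule sys_combination_lower [OF a _ J s]; simp)+
  have pos: "l2.nsq I y > 0"
  proof -
    obtain j where "j \<in> {..n + N}" "c j \<noteq> 0" using c(1) by blast
    then show ?thesis unfolding y(2) by (intro sum_pos2 [of _ j]) auto
  qed
  have "l2.orthonormal_on I {..n + N} v"
    using J s by (intro sys_orthonormal [OF a]) force
  then have orth: "l2_inner I y (w k) = 0" if "k < n + N" for k
    unfolding y_def using c(2) that w [OF that] by (subst l2.ip_combination) auto
  have "s * sqrt (l2.nsq I y) \<le> sqrt (l2.nsq I (mat_op I a y))"
    using real_sqrt_le_mono [OF y(3)] s by (simp add: real_sqrt_mult)
  also have "\<dots> \<le> sqrt (l2.nsq I (mat_op I b y)) + \<delta> * sqrt (l2.nsq I y)"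
  proof (rule le [OF y(1)])
    fix k assume "k < N"
    then show "l2_inner I y (g k) = 0" using orth [of "n + k"] by (simp add: w_def)
  qed
  also have "sqrt (l2.nsq I (mat_op I b y)) \<le> \<tau> n * sqrt (l2.nsq I y)"
  proof -
    have "l2.nsq I (mat_op I b y) \<le> (\<tau> n)\<^sup>2 * l2.nsq I y"
    proof (rule sys_bound [OF b y(1)])
      fix k assume "k < n"
      then show "l2_inner I y (u k) = 0" using orth [of k] by (simp add: w_def)
    qed
    then show ?thesis
      using real_sqrt_le_mono sys_nonneg [OF b, of n] by (fastforce simp: real_sqrt_mult)
  qed
  finally have "s * sqrt (l2.nsq I y) \<le> (\<tau> n + \<delta>) * sqrt (l2.nsq I y)" by (simp add: distrib_right)
  then show ?thesis using pos by (simp add: s_def)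
qed

text \<open>
  If the sequences first differ at \<open>n\<close>, the larger of the two values there occurs in the other
  sequence only before \<open>n\<close>, where both agree, and hence less often.
\<close>

lemma decreasing_sequence_unique:
  fixes \<theta> \<tau> :: "nat \<Rightarrow> real"
  assumes "decseq \<theta>" "\<And>n. 0 \<le> \<theta> n" "decseq \<tau>" "\<And>n. 0 \<le> \<tau> n"
    and "\<And>s. s > 0 \<Longrightarrow> card {n. \<theta> n = s} = card {n. \<tau> n = s}"
    and "\<theta> \<longlonglongrightarrow> 0" "\<tau> \<longlonglongrightarrow> 0"
  shows "\<theta> = \<tau>"
proof -
  have step: "\<theta> n \<le> \<tau> n"
    if d: "decseq \<theta>" "\<And>n. 0 \<le> \<theta> n" "decseq \<tau>" "\<And>n. 0 \<le> \<tau> n"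
      and c: "\<And>s. s > 0 \<Longrightarrow> card {n. \<theta> n = s} = card {n. \<tau> n = s}"
      and lim: "\<theta> \<longlonglongrightarrow> 0"
      and eq: "\<And>m. m < n \<Longrightarrow> \<theta> m = \<tau> m" for n and \<theta> \<tau> :: "nat \<Rightarrow> real"
  proof (rule ccontr)
    assume "\<not> \<theta> n \<le> \<tau> n"
    then have gt: "\<tau> n < \<theta> n" by simp
    then have s: "\<theta> n > 0" using d(4) [of n] by linarith
    have "{m. \<tau> m = \<theta> n} \<subset> {m. \<theta> m = \<theta> n}"
    proof
      show "{m. \<tau> m = \<theta> n} \<subseteq> {m. \<theta> m = \<theta> n}"
      proof
        fix m assume "m \<in> {m. \<tau> m = \<theta> n}"
        then have "m < n" using decseqD [OF d(3), of n m] gt by (cases "m < n") auto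
        then show "m \<in> {m. \<theta> m = \<theta> n}" using \<open>m \<in> _\<close> eq by simp
      qed
      show "{m. \<tau> m = \<theta> n} \<noteq> {m. \<theta> m = \<theta> n}"
      proof
        assume eq: "{m. \<tau> m = \<theta> n} = {m. \<theta> m = \<theta> n}"
        have "n \<in> {m. \<tau> m = \<theta> n}" unfolding eq by simp
        then show False using gt by simp
      qed
    qed
    moreover have "finite {m. \<theta> m = \<theta> n}"
    proof -
      have "eventually (\<lambda>m. \<theta> m < \<theta> n) sequentially" by (rule order_tendstoD(2) [OF lim s])
      then obtain k where "\<And>m. m \<ge> k \<Longrightarrow> \<theta> m < \<theta> n" by (auto simp: eventually_sequentially)
      then have "{m. \<theta> m = \<theta> n} \<subseteq> {..<k}" by (force simp: not_less [symmetric])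
      then show ?thesis by (rule finite_subset) simp
    qed
    ultimately have "card {m. \<tau> m = \<theta> n} < card {m. \<theta> m = \<theta> n}"
      by (metis psubset_card_mono)
    with c [OF s] show False by simp
  qed
  have "\<theta> n = \<tau> n" for n
  proof (induction n rule: less_induct)
    case (less n)
    show ?case
      by (rule antisym; rule step) (use assms less in auto)
  qed
  then show ?thesis by blast
qed

lemma is_adjoint_on_unique:
  assumes "is_adjoint_on X ip u v"
    and "\<And>\<xi> \<eta>. \<xi> \<in> X \<Longrightarrow> \<eta> \<in> X \<Longrightarrow> (\<And>\<zeta>. \<zeta> \<in> X \<Longrightarrow> ip \<zeta> \<xi> = ip \<zeta> \<eta>) \<Longrightarrow> \<xi> = \<eta>"
  shows "adjoint_on X ip u = v"
  unfolding adjoint_on_def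
proof (rule the_equality [of _ v])
  fix v' assume v': "is_adjoint_on X ip u v'"
  show "v' = v"
  proof (rule PiE_ext [of v' X "\<lambda>_. X" v])
    show "v' \<in> X \<rightarrow>\<^sub>E X" "v \<in> X \<rightarrow>\<^sub>E X" using assms(1) v' by (auto simp: is_adjoint_on_def)
    fix \<eta> assume \<eta>: "\<eta> \<in> X"
    show "v' \<eta> = v \<eta>"
    proof (rule assms(2))
      show "v' \<eta> \<in> X" "v \<eta> \<in> X" using assms(1) v' \<eta> by (auto simp: is_adjoint_on_def)
      show "ip \<zeta> (v' \<eta>) = ip \<zeta> (v \<eta>)" if "\<zeta> \<in> X" for \<zeta>
        using assms(1) v' \<eta> that unfolding is_adjoint_on_def by metis
    qed
  qed
qed (rule assms(1))

lemma mat_op_adjoint_on: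
  fixes a :: "'i \<times> 'i \<Rightarrow> 'k::real_or_complex"
  assumes a: "a \<in> l2 (I \<times> I)"
  shows "adjoint_on (l2 I) (l2_inner I) (restrict (mat_op I a) (l2 I)) =
    restrict (mat_op I (conj_transpose a)) (l2 I)"
proof (rule is_adjoint_on_unique)
  show "is_adjoint_on (l2 I) (l2_inner I) (restrict (mat_op I a) (l2 I))
      (restrict (mat_op I (conj_transpose a)) (l2 I))"
    using mat_op_l2 [OF a] mat_op_l2 [OF conj_transpose_l2 [OF a]] mat_op_adjoint [OF a]
    by (simp add: is_adjoint_on_def)
  fix \<xi> \<eta> :: "'i \<Rightarrow> 'k"
  assume *: "\<xi> \<in> l2 I" "\<eta> \<in> l2 I" "\<And>\<zeta>. \<zeta> \<in> l2 I \<Longrightarrow> l2_inner I \<zeta> \<xi> = l2_inner I \<zeta> \<eta>"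
  have d: "\<xi> - \<eta> \<in> l2 I" using * by (intro l2.diff_mem)
  have "l2_inner I (\<xi> - \<eta>) (\<xi> - \<eta>) = 0" using * d by (simp add: l2.ip_diff_right)
  then have "\<xi> - \<eta> = 0" using l2_nsq_zero [OF d] by (simp add: l2.nsq_def)
  then show "\<xi> = \<eta>" by simp
qed

text \<open>A singular system has the multiplicities that characterise the sequence of singular values.\<close>

lemma singular_values_eq:
  assumes a: "a \<in> l2 (I \<times> I)" and sys: "singular_system I a \<sigma> v"
  shows "singular_values I (restrict (mat_op I a) (l2 I)) = \<sigma>"
proof -
  have E: "sing_eigenspace I (restrict (mat_op I a) (l2 I)) s =
      {\<zeta> \<in> l2 I. gram I a \<zeta> = fscale (of_real (s\<^sup>2)) \<zeta>}" for s
    unfolding sing_eigenspace_def mat_op_adjoint_on [OF a] gram_def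
    using mat_op_l2 [OF a] by auto
  have P: "decseq \<sigma> \<and> (\<forall>n. 0 \<le> \<sigma> n) \<and> \<sigma> \<longlonglongrightarrow> 0 \<and> (\<forall>s>0. card {n. \<sigma> n = s} =
      vector_space.dim fscale (sing_eigenspace I (restrict (mat_op I a) (l2 I)) s))"
    unfolding E using sys_decseq [OF a sys] sys_nonneg [OF a sys] sys_tendsto_zero [OF a sys]
      sys_eigenspace_dim [OF a sys] by blast
  show ?thesis
    unfolding singular_values_def
    by (rule the_equality, rule P, rule decreasing_sequence_unique) (use P in auto)
qed


section \<open>The Hilbert module over the continuous functions\<close>

lemmas bcontfun_apply = times_bcontfun.rep_eq plus_bcontfun.rep_eq minus_bcontfun.rep_eq
  zero_bcontfun.rep_eq one_bcontfun.rep_eq star.rep_eq const_bcontfun.rep_eq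

lemma bounded_linear_apply_bcontfun:
  "bounded_linear (\<lambda>f :: 't::topological_space \<Rightarrow>\<^sub>C 'k::real_normed_field. apply_bcontfun f t)"
  by (rule bounded_linear_intro [where K = 1]) (simp_all add: norm_bounded)

lemma has_sum_apply_bcontfun:
  fixes f :: "'i \<Rightarrow> 't::topological_space \<Rightarrow>\<^sub>C 'k::real_normed_field"
  shows "(f has_sum S) A \<Longrightarrow> ((\<lambda>i. apply_bcontfun (f i) t) has_sum apply_bcontfun S t) A"
  by (rule has_sum_bounded_linear [OF bounded_linear_apply_bcontfun])

lemma has_sum_metric:
  fixes f :: "'i \<Rightarrow> 'a::{comm_monoid_add,metric_space}"
  shows "(f has_sum S) A \<longleftrightarrow> (\<forall>e>0. \<exists>X. finite X \<and> X \<subseteq> A \<and>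
    (\<forall>Y. finite Y \<and> X \<subseteq> Y \<and> Y \<subseteq> A \<longrightarrow> dist (sum f Y) S < e))"
  by (simp add: has_sum_def tendsto_iff eventually_finite_subsets_at_top)

lemma sum_apply_bcontfun:
  fixes f :: "'i \<Rightarrow> 't::topological_space \<Rightarrow>\<^sub>C 'k::real_normed_field"
  shows "apply_bcontfun (sum f A) t = (\<Sum>i\<in>A. apply_bcontfun (f i) t)"
  by (induction A rule: infinite_finite_induct) (simp_all add: bcontfun_apply)

lemma uniform_approx_bcontfun:
  fixes f :: "'t::topological_space \<Rightarrow> 'k::real_normed_field"
  assumes "\<And>\<epsilon>. \<epsilon> > 0 \<Longrightarrow> \<exists>g. \<forall>t. norm (f t - apply_bcontfun g t) \<le> \<epsilon>"
  shows "f \<in> bcontfun"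
proof -
  have "\<exists>g. continuous_on UNIV g \<and> (\<forall>x\<in>UNIV. dist (f x) (g x) \<le> \<epsilon>)" if "\<epsilon> > 0" for \<epsilon>
  proof -
    obtain g where "\<forall>t. norm (f t - apply_bcontfun g t) \<le> \<epsilon>" using assms [OF \<open>\<epsilon> > 0\<close>] by blast
    then show ?thesis by (intro exI [of _ "apply_bcontfun g"]) (simp add: dist_norm)
  qed
  then have c: "continuous_on UNIV f" by (rule continuous_on_uniform_approx)
  obtain g where g: "\<And>t. norm (f t - apply_bcontfun g t) \<le> 1" using assms [of 1] by auto
  have "norm (f t) \<le> 1 + norm g" for t
    using g [of t] norm_bounded [of g t] norm_triangle_sub [of "f t" "apply_bcontfun g t"] by linarith
  with c show ?thesis by (rule bcontfun_normI)
qed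

text \<open>
  The tails of the absolute values are small uniformly on \<open>T\<close>: the sums exist pointwise, and the
  partial sums converge to them uniformly, which makes the limit continuous.
\<close>

lemma summable_on_bcontfun:
  fixes f :: "'i \<Rightarrow> 't::topological_space \<Rightarrow>\<^sub>C 'k::real_or_complex"
  assumes tail: "\<And>\<epsilon>. \<epsilon> > 0 \<Longrightarrow> \<exists>F. finite F \<and> F \<subseteq> A \<and>
    (\<forall>G t. finite G \<and> G \<subseteq> A - F \<longrightarrow> (\<Sum>i\<in>G. norm (apply_bcontfun (f i) t)) \<le> \<epsilon>)"
  shows "f summable_on A"
proof -
  have abs: "(\<lambda>i. norm (apply_bcontfun (f i) t)) summable_on A" for t
  proof -
    obtain F where F: "finite F" "F \<subseteq> A"
      "\<And>G. finite G \<Longrightarrow> G \<subseteq> A - F \<Longrightarrow> (\<Sum>i\<in>G. norm (apply_bcontfun (f i) t)) \<le> 1"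
      using tail [of 1] by auto
    have "(\<lambda>i. norm (apply_bcontfun (f i) t)) summable_on (A - F)"
      using F by (intro nonneg_bdd_above_summable_on bdd_aboveI [of _ 1]) auto
    then have "(\<lambda>i. norm (apply_bcontfun (f i) t)) summable_on (A - F \<union> F)"
      using F by (intro summable_on_Un_disjoint) auto
    then show ?thesis using F by (simp add: Un_absorb2)
  qed
  define L where "L t = (\<Sum>\<^sub>\<infinity>i\<in>A. apply_bcontfun (f i) t)" for t
  have hs: "((\<lambda>i. apply_bcontfun (f i) t) has_sum L t) A" for t
    unfolding L_def by (rule has_sum_infsum [OF abs_summable_summable [OF abs]])
  have approx: "\<exists>F. finite F \<and> F \<subseteq> A \<and> (\<forall>G t. finite G \<and> F \<subseteq> G \<and> G \<subseteq> A \<longrightarrow>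
      norm (L t - apply_bcontfun (sum f G) t) \<le> \<epsilon>)" if \<epsilon>: "\<epsilon> > 0" for \<epsilon>
  proof -
    obtain F where F: "finite F" "F \<subseteq> A"
      "\<And>G t. finite G \<Longrightarrow> G \<subseteq> A - F \<Longrightarrow> (\<Sum>i\<in>G. norm (apply_bcontfun (f i) t)) \<le> \<epsilon>"
      using tail [OF \<epsilon>] by auto
    have *: "norm (L t - apply_bcontfun (sum f G) t) \<le> \<epsilon>" if G: "finite G" "F \<subseteq> G" "G \<subseteq> A" for G t
    proof -
      let ?g = "\<lambda>i. apply_bcontfun (f i) t"
      have "(?g has_sum (L t - sum ?g G)) (A - G)"
        using G by (intro has_sum_Diff hs has_sum_finite) auto
      moreover have "((\<lambda>i. norm (?g i)) has_sum (\<Sum>\<^sub>\<infinity>i\<in>A - G. norm (?g i))) (A - G)"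
        by (intro has_sum_infsum summable_on_subset_banach [OF abs]) auto
      ultimately have "norm (L t - sum ?g G) \<le> (\<Sum>\<^sub>\<infinity>i\<in>A - G. norm (?g i))"
        by (intro norm_has_sum_bound)
      also have "\<dots> \<le> \<epsilon>"
      proof (rule infsum_le_finite_sums)
        show "(\<lambda>i. norm (?g i)) summable_on (A - G)"
          by (intro summable_on_subset_banach [OF abs]) auto
        show "finite H \<Longrightarrow> H \<subseteq> A - G \<Longrightarrow> (\<Sum>i\<in>H. norm (?g i)) \<le> \<epsilon>" for H
          using F(3) [of H t] G(2) by auto
      qed
      finally show ?thesis by (simp add: sum_apply_bcontfun)
    qed
    show ?thesis
      by (intro exI [of _ F] conjI allI impI F(1,2)) (elim conjE, rule *)
  qed
  have "L \<in> bcontfun"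
  proof (rule uniform_approx_bcontfun)
    fix \<epsilon> :: real assume "\<epsilon> > 0"
    then obtain F where F: "finite F" "F \<subseteq> A"
      "\<And>G t. finite G \<Longrightarrow> F \<subseteq> G \<Longrightarrow> G \<subseteq> A \<Longrightarrow> norm (L t - apply_bcontfun (sum f G) t) \<le> \<epsilon>"
      using approx by metis
    then show "\<exists>g. \<forall>t. norm (L t - apply_bcontfun g t) \<le> \<epsilon>"
      by (intro exI [of _ "sum f F"]) auto
  qed
  then have L: "apply_bcontfun (Bcontfun L) = L" by (rule Bcontfun_inverse)
  have "(f has_sum Bcontfun L) A"
    unfolding has_sum_metric
  proof (intro allI impI)
    fix e :: real assume "e > 0"
    then obtain F where F: "finite F" "F \<subseteq> A"
      "\<And>G t. finite G \<Longrightarrow> F \<subseteq> G \<Longrightarrow> G \<subseteq> A \<Longrightarrow> norm (L t - apply_bcontfun (sum f G) t) \<le> e / 2"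
      using approx [of "e / 2"] by (metis half_gt_zero)
    have "dist (sum f G) (Bcontfun L) < e" if "finite G" "F \<subseteq> G" "G \<subseteq> A" for G
    proof -
      have "dist (sum f G) (Bcontfun L) \<le> e / 2"
        using F(3) [OF that] by (intro dist_bound) (simp add: L dist_norm norm_minus_commute)
      then show ?thesis using \<open>e > 0\<close> by simp
    qed
    then show "\<exists>X. finite X \<and> X \<subseteq> A \<and> (\<forall>Y. finite Y \<and> X \<subseteq> Y \<and> Y \<subseteq> A \<longrightarrow> dist (sum f Y) (Bcontfun L) < e)"
      using F(1,2) by blast
  qed
  then show ?thesis by (rule has_sum_imp_summable)
qed

lemma star_mult_self_apply:
  "apply_bcontfun (star x * x) t = of_real ((norm (apply_bcontfun x t))\<^sup>2)"
  by (simp add: bcontfun_apply kcnj_mult_of_real)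

text \<open>
  The summands \<open>\<xi>\<^sub>i\<^sup>* \<xi>\<^sub>i\<close> are nonnegative, so that the norm of a partial sum is a supremum of scalar sums.
  This form of the definition allows all further arguments to be carried out pointwise on \<open>T\<close>.
\<close>

lemma Hmod_iff:
  fixes \<xi> :: "'i \<Rightarrow> 't::topological_space \<Rightarrow>\<^sub>C 'k::real_or_complex"
  shows "\<xi> \<in> Hmod I \<longleftrightarrow> (\<forall>i. i \<notin> I \<longrightarrow> \<xi> i = 0) \<and>
    (\<forall>\<epsilon>>0. \<exists>F. finite F \<and> F \<subseteq> I \<and> (\<forall>G t. finite G \<and> G \<subseteq> I - F \<longrightarrow>
      (\<Sum>i\<in>G. (norm (psi_at t \<xi> i))\<^sup>2) \<le> \<epsilon>))"
proof -
  let ?f = "\<lambda>i. star (\<xi> i) * \<xi> i"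
  have app: "(\<Sum>i\<in>G. apply_bcontfun (?f i) t) = of_real (\<Sum>i\<in>G. (norm (psi_at t \<xi> i))\<^sup>2)" for G t
    unfolding star_mult_self_apply by (simp add: psi_at_def)
  have napp: "norm (apply_bcontfun (?f i) t) = (norm (psi_at t \<xi> i))\<^sup>2" for i t
    unfolding star_mult_self_apply by (simp add: psi_at_def norm_power)
  have "?f summable_on I \<longleftrightarrow> (\<forall>\<epsilon>>0. \<exists>F. finite F \<and> F \<subseteq> I \<and> (\<forall>G t. finite G \<and> G \<subseteq> I - F \<longrightarrow>
      (\<Sum>i\<in>G. (norm (psi_at t \<xi> i))\<^sup>2) \<le> \<epsilon>))" (is "_ \<longleftrightarrow> ?R")
  proof
    assume ?R
    then show "?f summable_on I" by (intro summable_on_bcontfun) (simp add: napp)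
  next
    assume "?f summable_on I"
    then obtain S where S: "(?f has_sum S) I" by (auto simp: summable_on_def)
    show ?R
    proof (intro allI impI)
      fix \<epsilon> :: real assume "\<epsilon> > 0"
      then obtain F where F: "finite F" "F \<subseteq> I"
        "\<And>Y. finite Y \<Longrightarrow> F \<subseteq> Y \<Longrightarrow> Y \<subseteq> I \<Longrightarrow> dist (sum ?f Y) S < \<epsilon> / 2"
        using S unfolding has_sum_metric by (meson half_gt_zero)
      have "(\<Sum>i\<in>G. (norm (psi_at t \<xi> i))\<^sup>2) \<le> \<epsilon>" if G: "finite G" "G \<subseteq> I - F" for G t
      proof -
        have "(\<Sum>i\<in>G. (norm (psi_at t \<xi> i))\<^sup>2) = norm (apply_bcontfun (sum ?f G) t)"
          unfolding sum_apply_bcontfun app norm_of_real by (simp add: sum_nonneg)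
        also have "\<dots> \<le> norm (sum ?f G)" by (rule norm_bounded)
        also have "sum ?f G = sum ?f (G \<union> F) - sum ?f F"
          using F G by (subst sum.union_disjoint) auto
        also have "norm \<dots> \<le> dist (sum ?f (G \<union> F)) S + dist (sum ?f F) S"
          unfolding dist_norm [of "sum ?f (G \<union> F)" "sum ?f F", symmetric] by (rule dist_triangle2)
        also have "\<dots> \<le> \<epsilon> / 2 + \<epsilon> / 2"
        proof (rule add_mono)
          show "dist (sum ?f (G \<union> F)) S \<le> \<epsilon> / 2"
            using F G by (intro less_imp_le [OF F(3)]) auto
          show "dist (sum ?f F) S \<le> \<epsilon> / 2"
            using F by (intro less_imp_le [OF F(3)]) auto
        qed
        also have "\<dots> = \<epsilon>" by simp
        finally show ?thesis .
      qed
      with F(1,2) show "\<exists>F. finite F \<and> F \<subseteq> I \<and> (\<forall>G t. finite G \<and> G \<subseteq> I - F \<longrightarrow>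
          (\<Sum>i\<in>G. (norm (psi_at t \<xi> i))\<^sup>2) \<le> \<epsilon>)" by blast
    qed
  qed
  then show ?thesis by (simp add: Hmod_def)
qed

lemma psi_at_plus: "psi_at t (\<xi> + \<eta>) = psi_at t \<xi> + psi_at t \<eta>"
  and psi_at_minus: "psi_at t (\<xi> - \<eta>) = psi_at t \<xi> - psi_at t \<eta>"
  and psi_at_truncation: "psi_at t (truncation F \<xi>) = truncation F (psi_at t \<xi>)"
  by (auto simp: psi_at_def truncation_def bcontfun_apply)

lemma psi_at_psi: "psi_at t (psi \<zeta>) = \<zeta>"
  by (simp add: psi_at_def psi_def bcontfun_apply)

lemma psi_at_eqI: "(\<And>t. psi_at t \<xi> = psi_at t \<eta>) \<Longrightarrow> \<xi> = \<eta>"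
  by (rule ext, rule bcontfun_eqI) (metis psi_at_def)

lemma Hmod_off: "\<xi> \<in> Hmod I \<Longrightarrow> i \<notin> I \<Longrightarrow> \<xi> i = 0"
  by (simp add: Hmod_def)

lemma psi_at_l2:
  assumes \<xi>: "\<xi> \<in> Hmod I" shows "psi_at t \<xi> \<in> l2 I"
proof -
  obtain F where F: "finite F" "F \<subseteq> I"
    "\<And>G. finite G \<Longrightarrow> G \<subseteq> I - F \<Longrightarrow> (\<Sum>i\<in>G. (norm (psi_at t \<xi> i))\<^sup>2) \<le> 1"
    using \<xi> unfolding Hmod_iff by (meson zero_less_one)
  show ?thesis
  proof (rule l2I)
    show "i \<notin> I \<Longrightarrow> psi_at t \<xi> i = 0" for i
      using Hmod_off [OF \<xi>] by (simp add: psi_at_def bcontfun_apply)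
    fix G assume G: "finite G" "G \<subseteq> I"
    have "(\<Sum>i\<in>G. (norm (psi_at t \<xi> i))\<^sup>2) \<le> (\<Sum>i\<in>F \<union> (G - F). (norm (psi_at t \<xi> i))\<^sup>2)"
      using F G by (intro sum_mono2) auto
    also have "\<dots> = (\<Sum>i\<in>F. (norm (psi_at t \<xi> i))\<^sup>2) + (\<Sum>i\<in>G - F. (norm (psi_at t \<xi> i))\<^sup>2)"
      using F G by (intro sum.union_disjoint) auto
    also have "\<dots> \<le> (\<Sum>i\<in>F. (norm (psi_at t \<xi> i))\<^sup>2) + 1"
      using F(3) [of "G - F"] G by auto
    finally show "(\<Sum>i\<in>G. (norm (psi_at t \<xi> i))\<^sup>2) \<le> (\<Sum>i\<in>F. (norm (psi_at t \<xi> i))\<^sup>2) + 1" .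
  qed
qed

lemma Hmod_limit:
  fixes \<xi> :: "'i \<Rightarrow> 't::topological_space \<Rightarrow>\<^sub>C 'k::real_or_complex"
  assumes off: "\<And>i. i \<notin> I \<Longrightarrow> \<xi> i = 0"
    and lim: "\<And>\<epsilon>. \<epsilon> > 0 \<Longrightarrow> \<exists>\<eta>\<in>Hmod I. \<forall>t F. finite F \<and> F \<subseteq> I \<longrightarrow>
      (\<Sum>i\<in>F. (norm (psi_at t (\<xi> - \<eta>) i))\<^sup>2) \<le> \<epsilon>"
  shows "\<xi> \<in> Hmod I"
  unfolding Hmod_iff
proof (intro conjI allI impI)
  fix \<epsilon> :: real assume "\<epsilon> > 0"
  then have e: "\<epsilon> / 4 > 0" by simp
  obtain \<eta> where \<eta>: "\<eta> \<in> Hmod I"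
    "\<And>t F. finite F \<Longrightarrow> F \<subseteq> I \<Longrightarrow> (\<Sum>i\<in>F. (norm (psi_at t (\<xi> - \<eta>) i))\<^sup>2) \<le> \<epsilon> / 4"
    using lim [OF e] by blast
  obtain F where F: "finite F" "F \<subseteq> I"
    "\<And>G t. finite G \<Longrightarrow> G \<subseteq> I - F \<Longrightarrow> (\<Sum>i\<in>G. (norm (psi_at t \<eta> i))\<^sup>2) \<le> \<epsilon> / 4"
    using \<eta>(1) e unfolding Hmod_iff by meson
  have "(\<Sum>i\<in>G. (norm (psi_at t \<xi> i))\<^sup>2) \<le> \<epsilon>" if G: "finite G" "G \<subseteq> I - F" for G t
  proof -
    have "(\<Sum>i\<in>G. (norm (psi_at t \<xi> i))\<^sup>2) \<le>
        (\<Sum>i\<in>G. 2 * (norm (psi_at t (\<xi> - \<eta>) i))\<^sup>2 + 2 * (norm (psi_at t \<eta> i))\<^sup>2)"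
    proof (rule sum_mono)
      fix i
      show "(norm (psi_at t \<xi> i))\<^sup>2 \<le> 2 * (norm (psi_at t (\<xi> - \<eta>) i))\<^sup>2 + 2 * (norm (psi_at t \<eta> i))\<^sup>2"
        using norm_add_sq_le [of "psi_at t (\<xi> - \<eta>) i" "psi_at t \<eta> i"] by (simp add: psi_at_minus)
    qed
    also have "\<dots> = 2 * (\<Sum>i\<in>G. (norm (psi_at t (\<xi> - \<eta>) i))\<^sup>2) + 2 * (\<Sum>i\<in>G. (norm (psi_at t \<eta> i))\<^sup>2)"
      by (simp add: sum.distrib sum_distrib_left)
    also have "\<dots> \<le> 2 * (\<epsilon> / 4) + 2 * (\<epsilon> / 4)"
      using G by (intro add_mono mult_left_mono \<eta>(2) F(3)) auto
    finally show ?thesis by simp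
  qed
  with F(1,2) show "\<exists>F. finite F \<and> F \<subseteq> I \<and> (\<forall>G t. finite G \<and> G \<subseteq> I - F \<longrightarrow>
      (\<Sum>i\<in>G. (norm (psi_at t \<xi> i))\<^sup>2) \<le> \<epsilon>)" by blast
qed (rule off)

lemma Hmod_finite_support:
  assumes "finite F" "F \<subseteq> I" "\<And>i. i \<notin> F \<Longrightarrow> \<xi> i = 0"
  shows "\<xi> \<in> Hmod I"
  unfolding Hmod_iff
proof (intro conjI allI impI)
  show "i \<notin> I \<Longrightarrow> \<xi> i = 0" for i using assms by blast
  fix \<epsilon> :: real assume "\<epsilon> > 0"
  have "(\<Sum>i\<in>G. (norm (psi_at t \<xi> i))\<^sup>2) = 0" if "G \<subseteq> I - F" for G t
    using that assms(3) by (intro sum.neutral) (auto simp: psi_at_def bcontfun_apply)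
  then show "\<exists>F. finite F \<and> F \<subseteq> I \<and> (\<forall>G t. finite G \<and> G \<subseteq> I - F \<longrightarrow>
      (\<Sum>i\<in>G. (norm (psi_at t \<xi> i))\<^sup>2) \<le> \<epsilon>)"
    using assms \<open>\<epsilon> > 0\<close> by (intro exI [of _ F]) auto
qed

lemma truncation_Hmod: "finite F \<Longrightarrow> F \<subseteq> I \<Longrightarrow> truncation F \<xi> \<in> Hmod I"
  by (rule Hmod_finite_support [of F]) (auto simp: truncation_def)

lemma Hmod_truncation_approx:
  assumes \<xi>: "\<xi> \<in> Hmod I" and \<epsilon>: "\<epsilon> > 0"
  shows "\<exists>F. finite F \<and> F \<subseteq> I \<and> (\<forall>t. l2.nsq I (psi_at t (\<xi> - truncation F \<xi>)) \<le> \<epsilon>)"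
proof -
  obtain F where F: "finite F" "F \<subseteq> I"
    "\<And>G t. finite G \<Longrightarrow> G \<subseteq> I - F \<Longrightarrow> (\<Sum>i\<in>G. (norm (psi_at t \<xi> i))\<^sup>2) \<le> \<epsilon>"
    using \<xi> \<epsilon> unfolding Hmod_iff by meson
  have "l2.nsq I (psi_at t (\<xi> - truncation F \<xi>)) \<le> \<epsilon>" for t
  proof (rule l2_nsq_leI)
    show "psi_at t (\<xi> - truncation F \<xi>) \<in> l2 I"
      unfolding psi_at_minus psi_at_truncation by (intro l2.diff_mem psi_at_l2 \<xi> truncation_l2 F)
    fix G assume G: "finite G" "G \<subseteq> I"
    have "(\<Sum>i\<in>G. (norm (psi_at t (\<xi> - truncation F \<xi>) i))\<^sup>2) = (\<Sum>i\<in>G - F. (norm (psi_at t \<xi> i))\<^sup>2)"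
      using G by (intro sum.mono_neutral_cong_right)
        (auto simp: psi_at_def truncation_def bcontfun_apply)
    also have "\<dots> \<le> \<epsilon>" using G by (intro F(3)) auto
    finally show "(\<Sum>i\<in>G. (norm (psi_at t (\<xi> - truncation F \<xi>) i))\<^sup>2) \<le> \<epsilon>" .
  qed
  with F(1,2) show ?thesis by blast
qed

lemma Hmod_add: assumes "\<xi> \<in> Hmod I" "\<eta> \<in> Hmod I" shows "\<xi> + \<eta> \<in> Hmod I"
proof (rule Hmod_limit)
  show "i \<notin> I \<Longrightarrow> (\<xi> + \<eta>) i = 0" for i using assms by (simp add: Hmod_off)
  fix \<epsilon> :: real assume "\<epsilon> > 0"
  then have e: "\<epsilon> / 4 > 0" by simp
  obtain F where F: "finite F" "F \<subseteq> I" "\<And>t. l2.nsq I (psi_at t (\<xi> - truncation F \<xi>)) \<le> \<epsilon> / 4"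
    using Hmod_truncation_approx [OF assms(1) e] by blast
  obtain G where G: "finite G" "G \<subseteq> I" "\<And>t. l2.nsq I (psi_at t (\<eta> - truncation G \<eta>)) \<le> \<epsilon> / 4"
    using Hmod_truncation_approx [OF assms(2) e] by blast
  let ?\<zeta> = "truncation F \<xi> + truncation G \<eta>"
  have "?\<zeta> \<in> Hmod I"
    using F G by (intro Hmod_finite_support [of "F \<union> G"]) (auto simp: truncation_def)
  moreover have "(\<Sum>i\<in>K. (norm (psi_at t (\<xi> + \<eta> - ?\<zeta>) i))\<^sup>2) \<le> \<epsilon>" if K: "finite K" "K \<subseteq> I" for t K
  proof -
    let ?p = "psi_at t (\<xi> - truncation F \<xi>)" and ?q = "psi_at t (\<eta> - truncation G \<eta>)"
    have p: "?p \<in> l2 I" "?q \<in> l2 I"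
      unfolding psi_at_minus psi_at_truncation using F G
      by (auto intro!: l2.diff_mem psi_at_l2 assms truncation_l2)
    have "psi_at t (\<xi> + \<eta> - ?\<zeta>) i = ?p i + ?q i" for i
      by (simp add: psi_at_def bcontfun_apply)
    then have "(\<Sum>i\<in>K. (norm (psi_at t (\<xi> + \<eta> - ?\<zeta>) i))\<^sup>2) \<le> (\<Sum>i\<in>K. 2 * (norm (?p i))\<^sup>2 + 2 * (norm (?q i))\<^sup>2)"
      by (intro sum_mono) (metis norm_add_sq_le)
    also have "\<dots> = 2 * (\<Sum>i\<in>K. (norm (?p i))\<^sup>2) + 2 * (\<Sum>i\<in>K. (norm (?q i))\<^sup>2)"
      by (simp add: sum.distrib sum_distrib_left)
    also have "\<dots> \<le> 2 * (\<epsilon> / 4) + 2 * (\<epsilon> / 4)"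
      using l2_sum_le [OF p(1) K] l2_sum_le [OF p(2) K] F(3) [of t] G(3) [of t] by linarith
    finally show ?thesis by simp
  qed
  ultimately show "\<exists>\<zeta>\<in>Hmod I. \<forall>t K. finite K \<and> K \<subseteq> I \<longrightarrow>
      (\<Sum>i\<in>K. (norm (psi_at t (\<xi> + \<eta> - \<zeta>) i))\<^sup>2) \<le> \<epsilon>" by blast
qed

lemma Hmod_mult: assumes \<xi>: "\<xi> \<in> Hmod I" shows "(\<lambda>i. x * \<xi> i) \<in> Hmod I"
  unfolding Hmod_iff
proof (intro conjI allI impI)
  show "i \<notin> I \<Longrightarrow> x * \<xi> i = 0" for i using \<xi> by (simp add: Hmod_off)
  fix \<epsilon> :: real assume "\<epsilon> > 0"
  let ?c = "(norm x)\<^sup>2 + 1"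
  have c: "?c > 0" by (simp add: add_nonneg_pos)
  then have e: "\<epsilon> / ?c > 0" using \<open>\<epsilon> > 0\<close> by simp
  obtain F where F: "finite F" "F \<subseteq> I"
    "\<And>G t. finite G \<Longrightarrow> G \<subseteq> I - F \<Longrightarrow> (\<Sum>i\<in>G. (norm (psi_at t \<xi> i))\<^sup>2) \<le> \<epsilon> / ?c"
    using \<xi> e unfolding Hmod_iff by meson
  have "(\<Sum>i\<in>G. (norm (psi_at t (\<lambda>i. x * \<xi> i) i))\<^sup>2) \<le> \<epsilon>" if G: "finite G" "G \<subseteq> I - F" for G t
  proof -
    have "(\<Sum>i\<in>G. (norm (psi_at t (\<lambda>i. x * \<xi> i) i))\<^sup>2) =
        (norm (apply_bcontfun x t))\<^sup>2 * (\<Sum>i\<in>G. (norm (psi_at t \<xi> i))\<^sup>2)"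
      by (simp add: psi_at_def bcontfun_apply norm_mult power_mult_distrib sum_distrib_left)
    also have "\<dots> \<le> ?c * (\<epsilon> / ?c)"
    proof (rule mult_mono)
      have "(norm (apply_bcontfun x t))\<^sup>2 \<le> (norm x)\<^sup>2" by (intro power_mono norm_bounded) simp
      then show "(norm (apply_bcontfun x t))\<^sup>2 \<le> ?c" by linarith
    qed (use F(3) G c in \<open>auto intro!: sum_nonneg\<close>)
    also have "\<dots> = \<epsilon>" using c by simp
    finally show ?thesis .
  qed
  with F(1,2) show "\<exists>F. finite F \<and> F \<subseteq> I \<and> (\<forall>G t. finite G \<and> G \<subseteq> I - F \<longrightarrow>
      (\<Sum>i\<in>G. (norm (psi_at t (\<lambda>i. x * \<xi> i) i))\<^sup>2) \<le> \<epsilon>)" by blast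
qed

lemma Hmod_diff: assumes "\<xi> \<in> Hmod I" "\<eta> \<in> Hmod I" shows "\<xi> - \<eta> \<in> Hmod I"
proof -
  have "\<xi> - \<eta> = \<xi> + (\<lambda>i. (- 1) * \<eta> i)" by (rule ext) simp
  then show ?thesis by (simp only: Hmod_add [OF assms(1) Hmod_mult [OF assms(2)]])
qed

lemma zero_Hmod: "0 \<in> Hmod I"
  by (rule Hmod_finite_support [of "{}"]) auto

lemma psi_Hmod: assumes \<zeta>: "\<zeta> \<in> l2 I" shows "psi \<zeta> \<in> Hmod I"
proof (rule Hmod_limit)
  show "i \<notin> I \<Longrightarrow> psi \<zeta> i = 0" for i using \<zeta> by (simp add: psi_def l2_iff)
  fix \<epsilon> :: real assume "\<epsilon> > 0"
  then obtain F where F: "finite F" "F \<subseteq> I" "l2.nsq I (\<zeta> - truncation F \<zeta>) \<le> \<epsilon>"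
    using l2_truncation_approx [OF \<zeta>] by blast
  have "psi (truncation F \<zeta>) \<in> Hmod I"
    using F by (intro Hmod_finite_support [of F]) (auto simp: psi_def truncation_def)
  moreover have "(\<Sum>i\<in>G. (norm (psi_at t (psi \<zeta> - psi (truncation F \<zeta>)) i))\<^sup>2) \<le> \<epsilon>"
    if "finite G" "G \<subseteq> I" for t G
    unfolding psi_at_minus psi_at_psi
    using l2_sum_le [OF l2.diff_mem [OF \<zeta> truncation_l2 [OF F(1,2)]] that] F(3) by (rule order_trans)
  ultimately show "\<exists>\<eta>\<in>Hmod I. \<forall>t G. finite G \<and> G \<subseteq> I \<longrightarrow>
      (\<Sum>i\<in>G. (norm (psi_at t (psi \<zeta> - \<eta>) i))\<^sup>2) \<le> \<epsilon>" by blast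
qed

lemma Hmod_prod_summable:
  fixes \<xi> \<eta> :: "'i \<Rightarrow> 't::topological_space \<Rightarrow>\<^sub>C 'k::real_or_complex"
  assumes "\<xi> \<in> Hmod I" "\<eta> \<in> Hmod I"
  shows "(\<lambda>i. \<eta> i * \<xi> i) summable_on I"
proof (rule summable_on_bcontfun)
  fix \<epsilon> :: real assume "\<epsilon> > 0"
  then have e: "\<epsilon> / 2 > 0" by simp
  obtain F where F: "finite F" "F \<subseteq> I"
    "\<And>G t. finite G \<Longrightarrow> G \<subseteq> I - F \<Longrightarrow> (\<Sum>i\<in>G. (norm (psi_at t \<xi> i))\<^sup>2) \<le> \<epsilon> / 2"
    using assms(1) e unfolding Hmod_iff by meson
  obtain F' where F': "finite F'" "F' \<subseteq> I"
    "\<And>G t. finite G \<Longrightarrow> G \<subseteq> I - F' \<Longrightarrow> (\<Sum>i\<in>G. (norm (psi_at t \<eta> i))\<^sup>2) \<le> \<epsilon> / 2"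
    using assms(2) e unfolding Hmod_iff by meson
  have "(\<Sum>i\<in>G. norm (apply_bcontfun (\<eta> i * \<xi> i) t)) \<le> \<epsilon>"
    if G: "finite G" "G \<subseteq> I - (F \<union> F')" for G t
  proof -
    have "(\<Sum>i\<in>G. norm (apply_bcontfun (\<eta> i * \<xi> i) t)) \<le>
        (\<Sum>i\<in>G. (norm (psi_at t \<xi> i))\<^sup>2 + (norm (psi_at t \<eta> i))\<^sup>2)"
    proof (rule sum_mono)
      fix i
      let ?x = "norm (psi_at t \<xi> i)" and ?y = "norm (psi_at t \<eta> i)"
      have "2 * (?y * ?x) \<le> ?x\<^sup>2 + ?y\<^sup>2" using sum_squares_bound [of ?y ?x] by simp
      moreover have "0 \<le> ?y * ?x" by simp
      ultimately have "?y * ?x \<le> ?x\<^sup>2 + ?y\<^sup>2" by linarith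
      then show "norm (apply_bcontfun (\<eta> i * \<xi> i) t) \<le> ?x\<^sup>2 + ?y\<^sup>2"
        by (simp add: psi_at_def bcontfun_apply norm_mult)
    qed
    also have "\<dots> \<le> \<epsilon> / 2 + \<epsilon> / 2"
      unfolding sum.distrib using G by (intro add_mono F(3) F'(3)) auto
    finally show ?thesis by simp
  qed
  then show "\<exists>F. finite F \<and> F \<subseteq> I \<and> (\<forall>G t. finite G \<and> G \<subseteq> I - F \<longrightarrow>
      (\<Sum>i\<in>G. norm (apply_bcontfun (\<eta> i * \<xi> i) t)) \<le> \<epsilon>)"
    using F F' by (intro exI [of _ "F \<union> F'"]) auto
qed

lemma star_star [simp]: "star (star x) = x"
  by (rule bcontfun_eqI) (simp add: bcontfun_apply kcnj_kcnj)

lemma star_zero [simp]: "star 0 = 0"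
  by (rule bcontfun_eqI) (simp add: bcontfun_apply)

lemma star_Hmod: "\<xi> \<in> Hmod I \<Longrightarrow> (\<lambda>i. star (\<xi> i)) \<in> Hmod I"
  by (simp add: Hmod_def mult.commute)

lemma Hinner_apply:
  fixes \<xi> \<eta> :: "'i \<Rightarrow> 't::topological_space \<Rightarrow>\<^sub>C 'k::real_or_complex"
  assumes "\<xi> \<in> Hmod I" "\<eta> \<in> Hmod I"
  shows "apply_bcontfun (Hinner I \<xi> \<eta>) t = l2_inner I (psi_at t \<xi>) (psi_at t \<eta>)"
proof -
  have "((\<lambda>i. star (\<eta> i) * \<xi> i) has_sum Hinner I \<xi> \<eta>) I"
    unfolding Hinner_def by (intro has_sum_infsum Hmod_prod_summable assms star_Hmod)
  from has_sum_apply_bcontfun [OF this, of t] show ?thesis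
    unfolding l2_inner_def by (intro infsumI [symmetric]) (simp add: psi_at_def bcontfun_apply)
qed

lemma nsq_le_Hnorm:
  assumes \<xi>: "\<xi> \<in> Hmod I" shows "l2.nsq I (psi_at t \<xi>) \<le> (Hnorm I \<xi>)\<^sup>2"
proof -
  have "l2.nsq I (psi_at t \<xi>) = norm (apply_bcontfun (Hinner I \<xi> \<xi>) t)"
    by (simp add: l2.nsq_def Hinner_apply [OF \<xi> \<xi>])
  also have "\<dots> \<le> norm (Hinner I \<xi> \<xi>)" by (rule norm_bounded)
  finally show ?thesis by (simp add: Hnorm_def)
qed

lemma Hnorm_leI:
  assumes \<xi>: "\<xi> \<in> Hmod I" and "C \<ge> 0" "\<And>t. l2.nsq I (psi_at t \<xi>) \<le> C\<^sup>2"
  shows "Hnorm I \<xi> \<le> C"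
proof -
  have "norm (Hinner I \<xi> \<xi>) \<le> C\<^sup>2"
    using assms(3) by (intro norm_bound) (simp add: Hinner_apply [OF \<xi> \<xi>] l2.nsq_def)
  then show ?thesis unfolding Hnorm_def using \<open>C \<ge> 0\<close> by (intro real_le_lsqrt) auto
qed

lemma Hnorm_nonneg: "Hnorm I \<xi> \<ge> 0"
  by (simp add: Hnorm_def)


section \<open>Operators with a matrix in the Hilbert module\<close>

lemma Hmod_row:
  assumes a: "a \<in> Hmod (I \<times> I)" and i: "i \<in> I"
  shows "(\<lambda>j. a (i, j)) \<in> Hmod I"
  unfolding Hmod_iff
proof (intro conjI allI impI)
  show "j \<notin> I \<Longrightarrow> a (i, j) = 0" for j using a by (simp add: Hmod_off)
  fix \<epsilon> :: real assume "\<epsilon> > 0"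
  then obtain F where F: "finite F" "F \<subseteq> I \<times> I"
    "\<And>G t. finite G \<Longrightarrow> G \<subseteq> I \<times> I - F \<Longrightarrow> (\<Sum>p\<in>G. (norm (psi_at t a p))\<^sup>2) \<le> \<epsilon>"
    using a unfolding Hmod_iff by meson
  have *: "(\<Sum>j\<in>G. (norm (psi_at t (\<lambda>j. a (i, j)) j))\<^sup>2) \<le> \<epsilon>" if G: "finite G" "G \<subseteq> I - snd ` F" for G t
  proof -
    have "(\<Sum>j\<in>G. (norm (psi_at t (\<lambda>j. a (i, j)) j))\<^sup>2) = (\<Sum>p\<in>Pair i ` G. (norm (psi_at t a p))\<^sup>2)"
      by (subst sum.reindex) (auto simp: psi_at_def intro: inj_onI)
    also have "\<dots> \<le> \<epsilon>" using G i by (intro F(3)) force+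
    finally show ?thesis .
  qed
  show "\<exists>F. finite F \<and> F \<subseteq> I \<and> (\<forall>G t. finite G \<and> G \<subseteq> I - F \<longrightarrow>
      (\<Sum>j\<in>G. (norm (psi_at t (\<lambda>j. a (i, j)) j))\<^sup>2) \<le> \<epsilon>)"
    by (rule exI [of _ "snd ` F"]) (use F(1,2) * in auto)
qed

lemma mat_op_apply:
  fixes a :: "'i \<times> 'i \<Rightarrow> 't::topological_space \<Rightarrow>\<^sub>C 'k::real_or_complex"
  assumes a: "a \<in> Hmod (I \<times> I)" and \<xi>: "\<xi> \<in> Hmod I"
  shows "psi_at t (mat_op I a \<xi>) = mat_op I (psi_at t a) (psi_at t \<xi>)"
proof
  fix i
  show "psi_at t (mat_op I a \<xi>) i = mat_op I (psi_at t a) (psi_at t \<xi>) i"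
  proof (cases "i \<in> I")
    case True
    have "((\<lambda>j. a (i, j) * \<xi> j) has_sum (\<Sum>\<^sub>\<infinity>j\<in>I. a (i, j) * \<xi> j)) I"
      by (rule has_sum_infsum [OF Hmod_prod_summable [OF \<xi> Hmod_row [OF a True]]])
    from has_sum_apply_bcontfun [OF this, of t] show ?thesis
      using True by (simp add: mat_op_def psi_at_def bcontfun_apply infsumI)
  qed (simp add: mat_op_def psi_at_def bcontfun_apply)
qed

lemma mat_op_truncation:
  fixes \<xi> :: "'i \<Rightarrow> 't::topological_space \<Rightarrow>\<^sub>C 'k::real_or_complex"
  assumes F: "finite F" "F \<subseteq> I \<times> I"
  shows "mat_op I (truncation F a) \<xi> i = (\<Sum>p\<in>F. if fst p = i then a p * \<xi> (snd p) else 0)"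
proof (cases "i \<in> I")
  case True
  let ?J = "{j. (i, j) \<in> F}"
  have J: "finite ?J" by (rule finite_subset [of _ "snd ` F"]) (use F in force)+
  have "mat_op I (truncation F a) \<xi> i = (\<Sum>\<^sub>\<infinity>j\<in>I. truncation F a (i, j) * \<xi> j)"
    using True by (simp add: mat_op_def)
  also have "\<dots> = (\<Sum>\<^sub>\<infinity>j\<in>?J. a (i, j) * \<xi> j)"
    by (rule infsum_cong_neutral) (use F in \<open>auto simp: truncation_def\<close>)
  also have "\<dots> = (\<Sum>j\<in>?J. a (i, j) * \<xi> j)" using J by simp
  also have "\<dots> = (\<Sum>p\<in>Pair i ` ?J. a p * \<xi> (snd p))"
    by (subst sum.reindex) (auto intro: inj_onI)
  also have "\<dots> = (\<Sum>p\<in>F. if fst p = i then a p * \<xi> (snd p) else 0)"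
    using F by (intro sum.mono_neutral_cong_left) (auto simp: image_iff)
  finally show ?thesis .
next
  case False
  then have "(\<Sum>p\<in>F. if fst p = i then a p * \<xi> (snd p) else 0) = 0"
    using F by (intro sum.neutral) auto
  then show ?thesis using False by (simp add: mat_op_def)
qed

text \<open>The images under the truncated matrices have finite support and converge uniformly on \<open>T\<close>.\<close>

lemma mat_op_Hmod:
  fixes a :: "'i \<times> 'i \<Rightarrow> 't::topological_space \<Rightarrow>\<^sub>C 'k::real_or_complex"
  assumes a: "a \<in> Hmod (I \<times> I)" and \<xi>: "\<xi> \<in> Hmod I"
  shows "mat_op I a \<xi> \<in> Hmod I"
proof (rule Hmod_limit)
  show "i \<notin> I \<Longrightarrow> mat_op I a \<xi> i = 0" for i by (simp add: mat_op_def)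
  fix \<epsilon> :: real assume "\<epsilon> > 0"
  let ?c = "(Hnorm I \<xi>)\<^sup>2 + 1"
  have c: "?c > 0" by (simp add: add_nonneg_pos)
  then obtain F where F: "finite F" "F \<subseteq> I \<times> I"
    "\<And>t. l2.nsq (I \<times> I) (psi_at t (a - truncation F a)) \<le> \<epsilon> / ?c"
    using Hmod_truncation_approx [OF a, of "\<epsilon> / ?c"] \<open>\<epsilon> > 0\<close> by auto
  let ?b = "truncation F a"
  have b: "?b \<in> Hmod (I \<times> I)" by (rule truncation_Hmod [OF F(1,2)])
  have "mat_op I ?b \<xi> \<in> Hmod I"
  proof (rule Hmod_finite_support [of "fst ` F"])
    show "mat_op I ?b \<xi> i = 0" if "i \<notin> fst ` F" for i
      unfolding mat_op_truncation [OF F(1,2)] using that by (intro sum.neutral) auto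
  qed (use F in auto)
  moreover have "(\<Sum>i\<in>G. (norm (psi_at t (mat_op I a \<xi> - mat_op I ?b \<xi>) i))\<^sup>2) \<le> \<epsilon>"
    if G: "finite G" "G \<subseteq> I" for t G
  proof -
    have x: "psi_at t \<xi> \<in> l2 I" by (rule psi_at_l2 [OF \<xi>])
    have d: "psi_at t (a - ?b) \<in> l2 (I \<times> I)" by (intro psi_at_l2 Hmod_diff a b)
    have "psi_at t (mat_op I a \<xi> - mat_op I ?b \<xi>) = mat_op I (psi_at t (a - ?b)) (psi_at t \<xi>)"
      unfolding psi_at_minus mat_op_apply [OF a \<xi>] mat_op_apply [OF b \<xi>]
      by (rule mat_op_matrix_diff [symmetric]) (intro psi_at_l2 a b \<xi>)+
    then have "(\<Sum>i\<in>G. (norm (psi_at t (mat_op I a \<xi> - mat_op I ?b \<xi>) i))\<^sup>2)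
        \<le> l2.nsq (I \<times> I) (psi_at t (a - ?b)) * l2.nsq I (psi_at t \<xi>)"
      using mat_op_partial [OF d x G] by simp
    also have "\<dots> \<le> \<epsilon> / ?c * ?c"
    proof (rule mult_mono [OF F(3)])
      show "l2.nsq I (psi_at t \<xi>) \<le> ?c" using nsq_le_Hnorm [OF \<xi>, of t] by linarith
      show "0 \<le> \<epsilon> / ?c" using c \<open>\<epsilon> > 0\<close> by simp
    qed simp
    also have "\<dots> = \<epsilon>" using c by simp
    finally show ?thesis .
  qed
  ultimately show "\<exists>\<eta>\<in>Hmod I. \<forall>t G. finite G \<and> G \<subseteq> I \<longrightarrow>
      (\<Sum>i\<in>G. (norm (psi_at t (mat_op I a \<xi> - \<eta>) i))\<^sup>2) \<le> \<epsilon>" by blast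
qed

lemma Hnorm_mat_op_le:
  assumes a: "a \<in> Hmod (I \<times> I)" and \<xi>: "\<xi> \<in> Hmod I"
    and C: "C \<ge> 0" "\<And>t. l2.nsq (I \<times> I) (psi_at t a) \<le> C\<^sup>2"
  shows "Hnorm I (mat_op I a \<xi>) \<le> C * Hnorm I \<xi>"
proof (rule Hnorm_leI)
  show "mat_op I a \<xi> \<in> Hmod I" by (rule mat_op_Hmod [OF a \<xi>])
  show "0 \<le> C * Hnorm I \<xi>" using C(1) by (simp add: Hnorm_nonneg)
  fix t
  have "l2.nsq I (psi_at t (mat_op I a \<xi>)) \<le> l2.nsq (I \<times> I) (psi_at t a) * l2.nsq I (psi_at t \<xi>)"
    unfolding mat_op_apply [OF a \<xi>] by (intro mat_op_nsq_le psi_at_l2 a \<xi>)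
  also have "\<dots> \<le> C\<^sup>2 * (Hnorm I \<xi>)\<^sup>2"
    by (intro mult_mono C nsq_le_Hnorm \<xi>) simp_all
  finally show "l2.nsq I (psi_at t (mat_op I a \<xi>)) \<le> (C * Hnorm I \<xi>)\<^sup>2"
    by (simp add: power_mult_distrib)
qed

definition star_transpose :: "('i \<times> 'i \<Rightarrow> 't::topological_space \<Rightarrow>\<^sub>C 'k::real_or_complex) \<Rightarrow> 'i \<times> 'i \<Rightarrow> 't \<Rightarrow>\<^sub>C 'k"
  where "star_transpose a = (\<lambda>(i, j). star (a (j, i)))"

lemma psi_at_star_transpose: "psi_at t (star_transpose a) = conj_transpose (psi_at t a)"
  by (auto simp: psi_at_def star_transpose_def conj_transpose_def bcontfun_apply)

lemma star_transpose_Hmod: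
  assumes "a \<in> Hmod (I \<times> I)" shows "star_transpose a \<in> Hmod (I \<times> I)"
proof -
  have "(\<lambda>p. star (star_transpose a p) * star_transpose a p) summable_on I \<times> I"
    using assms summable_on_reindex_bij_betw [of prod.swap "I \<times> I" "I \<times> I" "\<lambda>p. star (a p) * a p"]
    by (auto simp: Hmod_def star_transpose_def prod.swap_def case_prod_unfold bij_betw_def
        inj_on_def image_def mult.commute)
  with assms show ?thesis by (auto simp: Hmod_def star_transpose_def)
qed

text \<open>Undefined off \<open>H\<close>, so that equality of operators is equality on \<open>H\<close>.\<close>

definition matrix_operator ::
    "'i set \<Rightarrow> ('i \<times> 'i \<Rightarrow> 't::topological_space \<Rightarrow>\<^sub>C 'k::real_or_complex) \<Rightarrow>
      ('i \<Rightarrow> 't \<Rightarrow>\<^sub>C 'k) \<Rightarrow> 'i \<Rightarrow> 't \<Rightarrow>\<^sub>C 'k"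
  where "matrix_operator I a = restrict (mat_op I a) (Hmod I)"

lemma matrix_operator_is_adjoint:
  fixes a :: "'i \<times> 'i \<Rightarrow> 't::topological_space \<Rightarrow>\<^sub>C 'k::real_or_complex"
  assumes a: "a \<in> Hmod (I \<times> I)"
  shows "is_adjoint_on (Hmod I) (Hinner I) (matrix_operator I a) (matrix_operator I (star_transpose a))"
  unfolding is_adjoint_on_def
proof (intro conjI ballI)
  have a': "star_transpose a \<in> Hmod (I \<times> I)" by (rule star_transpose_Hmod [OF a])
  show "matrix_operator I a \<in> Hmod I \<rightarrow>\<^sub>E Hmod I"
    "matrix_operator I (star_transpose a) \<in> Hmod I \<rightarrow>\<^sub>E Hmod I"
    using mat_op_Hmod [OF a] mat_op_Hmod [OF a'] by (simp_all add: matrix_operator_def)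
  fix \<xi> \<eta> :: "'i \<Rightarrow> 't \<Rightarrow>\<^sub>C 'k" assume \<xi>: "\<xi> \<in> Hmod I" and \<eta>: "\<eta> \<in> Hmod I"
  show "Hinner I (matrix_operator I a \<xi>) \<eta> = Hinner I \<xi> (matrix_operator I (star_transpose a) \<eta>)"
  proof (rule bcontfun_eqI)
    fix t
    show "apply_bcontfun (Hinner I (matrix_operator I a \<xi>) \<eta>) t =
        apply_bcontfun (Hinner I \<xi> (matrix_operator I (star_transpose a) \<eta>)) t"
      using mat_op_adjoint [OF psi_at_l2 [OF a] psi_at_l2 [OF \<xi>] psi_at_l2 [OF \<eta>]]
      by (simp add: matrix_operator_def \<xi> \<eta> Hinner_apply mat_op_Hmod a a' mat_op_apply psi_at_star_transpose)
  qed
qed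

text \<open>The choice \<open>\<zeta> = \<xi> - \<eta>\<close> gives \<open>\<langle>\<zeta>|\<zeta>\<rangle> = 0\<close> at every point of \<open>T\<close>.\<close>

lemma Hinner_nondegenerate:
  assumes "\<xi> \<in> Hmod I" "\<eta> \<in> Hmod I" "\<And>\<zeta>. \<zeta> \<in> Hmod I \<Longrightarrow> Hinner I \<zeta> \<xi> = Hinner I \<zeta> \<eta>"
  shows "\<xi> = \<eta>"
proof (rule psi_at_eqI)
  fix t
  let ?d = "psi_at t (\<xi> - \<eta>)"
  have d: "\<xi> - \<eta> \<in> Hmod I" by (rule Hmod_diff [OF assms(1,2)])
  have "l2_inner I ?d (psi_at t \<xi>) = l2_inner I ?d (psi_at t \<eta>)"
    using assms(3) [OF d] by (simp flip: Hinner_apply [OF d assms(1)] Hinner_apply [OF d assms(2)])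
  then have "l2_inner I ?d ?d = 0"
    using psi_at_l2 [OF d] psi_at_l2 [OF assms(1)] psi_at_l2 [OF assms(2)]
    by (simp add: psi_at_minus l2.ip_diff_right)
  then have "?d = 0" by (intro l2_nsq_zero [OF psi_at_l2 [OF d]]) (simp add: l2.nsq_def)
  then show "psi_at t \<xi> = psi_at t \<eta>" by (simp add: psi_at_minus)
qed

lemma matrix_operator_adjoint:
  assumes "a \<in> Hmod (I \<times> I)"
  shows "adjoint_on (Hmod I) (Hinner I) (matrix_operator I a) = matrix_operator I (star_transpose a)"
  by (rule is_adjoint_on_unique [OF matrix_operator_is_adjoint [OF assms] Hinner_nondegenerate])

lemma Hnorm_zero: "Hnorm I 0 = 0"
  by (simp add: Hnorm_def Hinner_def)

lemma Hinner_unit: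
  fixes \<zeta> :: "'i \<Rightarrow> 't::topological_space \<Rightarrow>\<^sub>C 'k::real_or_complex"
  assumes "j \<in> I" shows "Hinner I \<zeta> (\<lambda>i. if i = j then 1 else 0) = \<zeta> j"
proof -
  have star1: "star (1 :: 't \<Rightarrow>\<^sub>C 'k) = 1" by (rule bcontfun_eqI) (simp add: bcontfun_apply)
  have "Hinner I \<zeta> (\<lambda>i. if i = j then 1 else 0) = (\<Sum>\<^sub>\<infinity>i\<in>{j}. \<zeta> i)"
    unfolding Hinner_def by (rule infsum_cong_neutral) (use assms star1 in auto)
  then show ?thesis by simp
qed

text \<open>Cutting the matrix down to finitely many entries gives the approximation by sums of operators of rank one.\<close>

lemma matrix_operator_compact:
  fixes a :: "'i \<times> 'i \<Rightarrow> 't::topological_space \<Rightarrow>\<^sub>C 'k::real_or_complex"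
  assumes a: "a \<in> Hmod (I \<times> I)"
  shows "matrix_operator I a \<in> compact_ops I"
  unfolding compact_ops_def
proof (intro CollectI conjI allI impI)
  show "matrix_operator I a \<in> adjointable_ops I"
    using matrix_operator_is_adjoint [OF a] by (auto simp: adjointable_ops_def)
  fix \<epsilon> :: real assume \<epsilon>: "\<epsilon> > 0"
  obtain F where F: "finite F" "F \<subseteq> I \<times> I"
    "\<And>t. l2.nsq (I \<times> I) (psi_at t (a - truncation F a)) \<le> (\<epsilon> / 2)\<^sup>2"
    using Hmod_truncation_approx [OF a, of "(\<epsilon> / 2)\<^sup>2"] \<epsilon> by auto
  have b: "truncation F a \<in> Hmod (I \<times> I)" by (rule truncation_Hmod [OF F(1,2)])
  have d: "a - truncation F a \<in> Hmod (I \<times> I)" by (rule Hmod_diff [OF a b])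
  obtain q where q: "bij_betw q {..<card F} F"
    using ex_bij_betw_nat_finite [OF F(1)] by (auto simp: atLeast0LessThan)
  define \<xi> where "\<xi> k = (\<lambda>i. if i = fst (q k) then a (q k) else 0)" for k
  define \<eta> where "\<eta> k = (\<lambda>i. if i = snd (q k) then 1 else 0 :: 't \<Rightarrow>\<^sub>C 'k)" for k
  have qF: "q k \<in> F" if "k < card F" for k using q that by (auto simp: bij_betw_def)
  have qI: "fst (q k) \<in> I" "snd (q k) \<in> I" if "k < card F" for k using qF [OF that] F(2) by auto
  have mem: "\<forall>k<card F. \<xi> k \<in> Hmod I \<and> \<eta> k \<in> Hmod I"
  proof (intro allI impI conjI)
    fix k assume k: "k < card F"
    show "\<xi> k \<in> Hmod I" "\<eta> k \<in> Hmod I"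
      using Hmod_finite_support [of "{fst (q k)}" I "\<xi> k"] Hmod_finite_support [of "{snd (q k)}" I "\<eta> k"]
        qI [OF k] by (auto simp: \<xi>_def \<eta>_def)
  qed
  let ?R = "\<lambda>\<zeta>. matrix_operator I a \<zeta> - (\<Sum>k<card F. Hscale 1 (rank_one I (\<xi> k) (\<eta> k) \<zeta>))"
  have R: "?R \<zeta> = mat_op I (a - truncation F a) \<zeta>" if \<zeta>: "\<zeta> \<in> Hmod I" for \<zeta>
  proof -
    have c1: "const_bcontfun 1 = (1 :: 't \<Rightarrow>\<^sub>C 'k)" by (rule bcontfun_eqI) (simp add: bcontfun_apply)
    have "(\<Sum>k<card F. Hscale 1 (rank_one I (\<xi> k) (\<eta> k) \<zeta>)) = mat_op I (truncation F a) \<zeta>"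
    proof
      fix i
      have "(\<Sum>k<card F. Hscale 1 (rank_one I (\<xi> k) (\<eta> k) \<zeta>)) i =
          (\<Sum>k<card F. if fst (q k) = i then a (q k) * \<zeta> (snd (q k)) else 0)"
        unfolding sum_fun_apply
      proof (rule sum.cong [OF refl])
        fix k assume "k \<in> {..<card F}"
        then have "snd (q k) \<in> I" using qI by simp
        then show "Hscale 1 (rank_one I (\<xi> k) (\<eta> k) \<zeta>) i = (if fst (q k) = i then a (q k) * \<zeta> (snd (q k)) else 0)"
          using \<zeta> by (auto simp: Hscale_def c1 rank_one_def \<xi>_def \<eta>_def Hinner_unit)
      qed
      also have "\<dots> = (\<Sum>p\<in>F. if fst p = i then a p * \<zeta> (snd p) else 0)"
        by (rule sum.reindex_bij_betw [OF q])
      finally show "(\<Sum>k<card F. Hscale 1 (rank_one I (\<xi> k) (\<eta> k) \<zeta>)) i = mat_op I (truncation F a) \<zeta> i"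
        by (simp add: mat_op_truncation [OF F(1,2)])
    qed
    then have "?R \<zeta> = mat_op I a \<zeta> - mat_op I (truncation F a) \<zeta>"
      using \<zeta> by (simp add: matrix_operator_def)
    also have "\<dots> = mat_op I (a - truncation F a) \<zeta>"
    proof (rule psi_at_eqI)
      fix t
      show "psi_at t (mat_op I a \<zeta> - mat_op I (truncation F a) \<zeta>) = psi_at t (mat_op I (a - truncation F a) \<zeta>)"
        unfolding psi_at_minus mat_op_apply [OF a \<zeta>] mat_op_apply [OF b \<zeta>] mat_op_apply [OF d \<zeta>]
        by (rule mat_op_matrix_diff [symmetric]) (intro psi_at_l2 a b \<zeta>)+
    qed
    finally show ?thesis .
  qed
  have "Hopnorm I ?R \<le> \<epsilon> / 2"
    unfolding Hopnorm_def
  proof (rule cSUP_least)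
    have "(0 :: 'i \<Rightarrow> 't \<Rightarrow>\<^sub>C 'k) \<in> {\<zeta> \<in> Hmod I. Hnorm I \<zeta> \<le> 1}"
      by (simp add: zero_Hmod Hnorm_zero)
    then show "{\<zeta> \<in> Hmod I :: ('i \<Rightarrow> 't \<Rightarrow>\<^sub>C 'k) set. Hnorm I \<zeta> \<le> 1} \<noteq> {}" by blast
    fix \<zeta> :: "'i \<Rightarrow> 't \<Rightarrow>\<^sub>C 'k" assume "\<zeta> \<in> {\<zeta> \<in> Hmod I. Hnorm I \<zeta> \<le> 1}"
    then have \<zeta>: "\<zeta> \<in> Hmod I" "Hnorm I \<zeta> \<le> 1" by simp_all
    have "Hnorm I (?R \<zeta>) \<le> \<epsilon> / 2 * Hnorm I \<zeta>"
      unfolding R [OF \<zeta>(1)] using \<epsilon> by (intro Hnorm_mat_op_le d \<zeta> F(3)) simp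
    also have "\<dots> \<le> \<epsilon> / 2 * 1" using \<epsilon> \<zeta>(2) by (intro mult_left_mono) auto
    finally show "Hnorm I (?R \<zeta>) \<le> \<epsilon> / 2" by simp
  qed
  also have "\<dots> < \<epsilon>" using \<epsilon> by simp
  finally have "Hopnorm I ?R < \<epsilon>" .
  with mem show "\<exists>(n::nat) c \<xi> \<eta>. (\<forall>k<n. \<xi> k \<in> Hmod I \<and> \<eta> k \<in> Hmod I) \<and>
      Hopnorm I (\<lambda>\<zeta>. matrix_operator I a \<zeta> - (\<Sum>k<n. Hscale (c k) (rank_one I (\<xi> k) (\<eta> k) \<zeta>))) < \<epsilon>"
    by (intro exI [of _ "card F"] exI [of _ "\<lambda>_. 1"] exI [of _ \<xi>] exI [of _ \<eta>] conjI)
qed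

lemma phi_matrix_operator:
  assumes a: "a \<in> Hmod (I \<times> I)"
  shows "phi I t (matrix_operator I a) = restrict (mat_op I (psi_at t a)) (l2 I)"
  unfolding phi_def
  by (rule restrict_ext) (simp add: matrix_operator_def psi_Hmod mat_op_apply [OF a] psi_at_psi)

context
  fixes I :: "'i set" and a :: "'i \<times> 'i \<Rightarrow> 't::t2_space \<Rightarrow>\<^sub>C 'k::real_or_complex" and \<sigma> v
  assumes a: "a \<in> Hmod (I \<times> I)" and sys: "\<And>t. singular_system I (psi_at t a) (\<sigma> t) (v t)"
begin

text \<open>
  By Weyl's inequality, the singular values at \<open>t\<close> and \<open>s\<close> differ by at most the Hilbert-Schmidt norm of
  the difference of the matrices. For fixed \<open>s\<close> this is \<open>\<langle>b|b\<rangle>(t)\<^sup>1\<^sup>/\<^sup>2\<close> for the element \<open>b = a - a(s)\<close> of the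
  Hilbert module, and so a continuous function of \<open>t\<close> which vanishes at \<open>s\<close>.
\<close>

lemma singular_value_continuous: "continuous_on UNIV (\<lambda>t. \<sigma> t n)"
  unfolding continuous_on_eq_continuous_at [OF open_UNIV]
proof (intro ballI)
  fix s
  let ?c = "psi (psi_at s a)"
  let ?b = "a - ?c"
  have b: "?b \<in> Hmod (I \<times> I)" by (intro Hmod_diff a psi_Hmod psi_at_l2)
  let ?D = "\<lambda>t. sqrt (norm (apply_bcontfun (Hinner (I \<times> I) ?b ?b) t))"
  have D: "?D t = sqrt (l2.nsq (I \<times> I) (psi_at t a - psi_at s a))" for t
    by (simp add: Hinner_apply [OF b b] l2.nsq_def psi_at_minus psi_at_psi)
  have le: "\<sigma> t n \<le> \<sigma> t' n + sqrt (l2.nsq (I \<times> I) (psi_at t a - psi_at t' a))" for t t'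
  proof -
    have "\<sigma> t (n + 0) \<le> \<sigma> t' n + sqrt (l2.nsq (I \<times> I) (psi_at t a - psi_at t' a))"
      by (rule singular_value_le [OF psi_at_l2 [OF a] sys psi_at_l2 [OF a] sys, where g = "\<lambda>_. 0"])
         (auto intro: mat_op_sqrt_nsq_diff psi_at_l2 [OF a])
    then show ?thesis by simp
  qed
  have dist: "dist (\<sigma> t n) (\<sigma> s n) \<le> ?D t" for t
    using le [of t s] le [of s t] l2.nsq_minus [OF psi_at_l2 [OF a] psi_at_l2 [OF a], of s t]
    by (simp add: D dist_real_def)
  have lim: "(?D \<longlongrightarrow> 0) (at s)"
  proof -
    have "isCont (apply_bcontfun (Hinner (I \<times> I) ?b ?b)) s"
      using continuous_on_apply_bcontfun [of UNIV "Hinner (I \<times> I) ?b ?b"]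
      unfolding continuous_on_eq_continuous_at [OF open_UNIV] by blast
    then have "(?D \<longlongrightarrow> ?D s) (at s)"
      by (intro tendsto_intros) (simp add: isCont_def)
    moreover have "?D s = 0"
      unfolding D using l2.ip_zero [OF l2.zero_mem] by (simp add: l2.nsq_def)
    ultimately show ?thesis by simp
  qed
  have "((\<lambda>t. dist (\<sigma> t n) (\<sigma> s n)) \<longlongrightarrow> 0) (at s)"
  proof (rule Lim_null_comparison [OF always_eventually lim])
    show "\<forall>t. norm (dist (\<sigma> t n) (\<sigma> s n)) \<le> ?D t" using dist by simp
  qed
  then show "isCont (\<lambda>t. \<sigma> t n) s" unfolding isCont_def by (rule tendsto_dist_iff [THEN iffD2])
qed

lemma theta_apply: "apply_bcontfun (theta I (matrix_operator I a) n) t = of_real (\<sigma> t n)"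
proof -
  have "(\<lambda>t. of_real (\<sigma> t n) :: 'k) \<in> bcontfun"
  proof (rule bcontfun_normI)
    show "continuous_on UNIV (\<lambda>t. of_real (\<sigma> t n) :: 'k)"
      by (intro continuous_on_of_real singular_value_continuous)
    fix t
    have "(\<sigma> t n)\<^sup>2 \<le> l2.nsq (I \<times> I) (psi_at t a)"
      using sys_sum_le [OF psi_at_l2 [OF a] sys, of "{n}" t] by simp
    also have "\<dots> \<le> (Hnorm (I \<times> I) a)\<^sup>2" by (rule nsq_le_Hnorm [OF a])
    finally show "norm (of_real (\<sigma> t n) :: 'k) \<le> Hnorm (I \<times> I) a"
      by (simp add: Hnorm_nonneg abs_le_square_iff [symmetric])
  qed
  then show ?thesis
    by (simp add: theta_def phi_matrix_operator [OF a] singular_values_eq [OF psi_at_l2 [OF a] sys] Bcontfun_inverse)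
qed

text \<open>
  A truncation of the matrix to \<open>N\<close> columns vanishes on the complement of \<open>N\<close> basis vectors. By Weyl's
  inequality, the singular values from the \<open>N\<close>-th on are dominated by those of the remainder,
  whose Hilbert-Schmidt norm is small uniformly in \<open>t\<close>.
\<close>

lemma theta_square_summable: "(\<lambda>n. (theta I (matrix_operator I a) n)\<^sup>2) summable_on UNIV"
proof (rule summable_on_bcontfun)
  fix \<epsilon> :: real assume "\<epsilon> > 0"
  then obtain F where F: "finite F" "F \<subseteq> I \<times> I"
    "\<And>t. l2.nsq (I \<times> I) (psi_at t (a - truncation F a)) \<le> \<epsilon>"
    using Hmod_truncation_approx [OF a \<open>\<epsilon> > 0\<close>] by metis
  \<comment> \<open>the columns which meet the truncation, enumerated as \<open>q 0, \<dots>, q (N - 1)\<close>\<close>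
  define N where "N = card (snd ` F)"
  obtain q where q: "bij_betw q {..<N} (snd ` F)"
    using ex_bij_betw_nat_finite [of "snd ` F"] F(1) by (auto simp: N_def atLeast0LessThan)
  define g where "g k = (\<lambda>i. if i = q k then 1 else 0 :: 'k)" for k
  have qF: "q k \<in> snd ` F" if "k < N" for k using q that by (auto simp: bij_betw_def)
  have qI: "q k \<in> I" if "k < N" for k using qF [OF that] F(2) by auto
  have g: "g k \<in> l2 I" if "k < N" for k
    using qI [OF that] by (intro l2_finite_support [of "{q k}"]) (auto simp: g_def)
  have *: "(\<Sum>n\<in>G. norm (apply_bcontfun ((theta I (matrix_operator I a) n)\<^sup>2) t)) \<le> \<epsilon>"
    if G: "finite G" "G \<subseteq> UNIV - {..<N}" for G t
  proof -
    let ?A = "psi_at t a"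
    let ?C = "psi_at t (a - truncation F a)"
    have b: "truncation F a \<in> Hmod (I \<times> I)" by (rule truncation_Hmod [OF F(1,2)])
    have A: "?A \<in> l2 (I \<times> I)" by (rule psi_at_l2 [OF a])
    have C: "?C \<in> l2 (I \<times> I)" by (intro psi_at_l2 Hmod_diff a b)
    obtain \<tau> u where \<tau>: "singular_system I ?C \<tau> u" by (rule singular_system_exists [OF C])
    have le: "\<sigma> t (n + N) \<le> \<tau> n + 0" for n
    proof (rule singular_value_le [OF A sys C \<tau> g])
      fix y :: "'i \<Rightarrow> 'k" assume y: "y \<in> l2 I" and orth: "\<And>k. k < N \<Longrightarrow> l2_inner I y (g k) = 0"
      have y0: "y j = 0" if "j \<in> snd ` F" for j
      proof -
        obtain k where k: "k < N" "j = q k" using q \<open>j \<in> snd ` F\<close> by (auto simp: bij_betw_def)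
        have "l2_inner I y (g k) = (\<Sum>\<^sub>\<infinity>i\<in>{q k}. y i)"
          unfolding l2_inner_def by (rule infsum_cong_neutral) (use qI [OF k(1)] in \<open>auto simp: g_def\<close>)
        then show ?thesis using orth [OF k(1)] k(2) by simp
      qed
      have "mat_op I (psi_at t (truncation F a)) y = 0"
      proof
        fix i
        have "psi_at t (truncation F a) (i, j) * y j = 0" for j
          using y0 [of j] by (cases "(i, j) \<in> F") (force simp: psi_at_def truncation_def bcontfun_apply)+
        then show "mat_op I (psi_at t (truncation F a)) y i = 0 i"
          unfolding mat_op_def by (simp only: infsum_0_simp if_cancel zero_fun_apply)
      qed
      then have "mat_op I ?C y = mat_op I ?A y"
        using mat_op_matrix_diff [OF A psi_at_l2 [OF b] y] by (simp add: psi_at_minus)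
      then show "sqrt (l2.nsq I (mat_op I ?A y)) \<le> sqrt (l2.nsq I (mat_op I ?C y)) + 0 * sqrt (l2.nsq I y)"
        by simp
    qed simp_all
    have "(\<Sum>n\<in>G. norm (apply_bcontfun ((theta I (matrix_operator I a) n)\<^sup>2) t)) = (\<Sum>n\<in>G. (\<sigma> t n)\<^sup>2)"
      by (simp add: power2_eq_square bcontfun_apply theta_apply norm_mult)
    also have "\<dots> = (\<Sum>m\<in>(\<lambda>n. n - N) ` G. (\<sigma> t (m + N))\<^sup>2)"
    proof -
      have inj: "inj_on (\<lambda>n. n - N) G"
      proof (rule inj_onI)
        fix m n assume "m \<in> G" "n \<in> G" "m - N = n - N"
        moreover from this have "N \<le> m" "N \<le> n" using G(2) by auto
        ultimately show "m = n" by simp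
      qed
      show ?thesis
        unfolding sum.reindex [OF inj]
      proof (rule sum.cong [OF refl])
        fix n assume "n \<in> G"
        then have "N \<le> n" using G(2) by auto
        then show "(\<sigma> t n)\<^sup>2 = ((\<lambda>m. (\<sigma> t (m + N))\<^sup>2) \<circ> (\<lambda>n. n - N)) n" by simp
      qed
    qed
    also have "\<dots> \<le> (\<Sum>m\<in>(\<lambda>n. n - N) ` G. (\<tau> m)\<^sup>2)"
      using le sys_nonneg [OF A sys] by (intro sum_mono power_mono) auto
    also have "\<dots> \<le> l2.nsq (I \<times> I) ?C" using G(1) by (intro sys_sum_le [OF C \<tau>]) simp
    also have "\<dots> \<le> \<epsilon>" by (rule F(3))
    finally show ?thesis .
  qed
  show "\<exists>F. finite F \<and> F \<subseteq> UNIV \<and> (\<forall>G t. finite G \<and> G \<subseteq> UNIV - F \<longrightarrow>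
      (\<Sum>n\<in>G. norm (apply_bcontfun ((theta I (matrix_operator I a) n)\<^sup>2) t)) \<le> \<epsilon>)"
    by (intro exI [of _ "{..<N}"] conjI allI impI) (auto intro!: *)
qed

end

lemma matrix_operator_hilbert_schmidt:
  fixes a :: "'i \<times> 'i \<Rightarrow> 't::t2_space \<Rightarrow>\<^sub>C 'k::real_or_complex"
  assumes a: "a \<in> Hmod (I \<times> I)"
  shows "matrix_operator I a \<in> hilbert_schmidt_ops I"
proof -
  have "\<exists>\<sigma> v. singular_system I (psi_at t a) \<sigma> v" for t
    using singular_system_exists [OF psi_at_l2 [OF a]] by metis
  then obtain \<sigma> v where "\<And>t. singular_system I (psi_at t a) (\<sigma> t) (v t)" by metis
  then have "(\<lambda>n. (theta I (matrix_operator I a) n)\<^sup>2) summable_on UNIV"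
    by (rule theta_square_summable [OF a])
  then show ?thesis using matrix_operator_compact [OF a] by (simp add: hilbert_schmidt_ops_def)
qed


section \<open>Square-integrable functions\<close>

lemma borel_measurable_kcnj [measurable]:
  "f \<in> borel_measurable M \<Longrightarrow> (\<lambda>s. kcnj (f s :: 'k::real_or_complex)) \<in> borel_measurable M"
  by (rule borel_measurable_continuous_on [OF continuous_on_kcnj [OF continuous_on_id]])

lemma integral_kcnj: "(\<integral>s. kcnj (f s) \<partial>M) = kcnj (\<integral>s. (f s :: 'k::real_or_complex) \<partial>M)"
proof (cases "integrable M f")
  case True
  then show ?thesis by (rule integral_bounded_linear [OF bounded_linear_kcnj])
next
  case False
  have "integrable M f" if "integrable M (\<lambda>s. kcnj (f s))"
    using integrable_bounded_linear [OF bounded_linear_kcnj that] by (simp add: kcnj_kcnj)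
  with False have "\<not> integrable M (\<lambda>s. kcnj (f s))" by blast
  with False show ?thesis by (simp add: not_integrable_integral_eq)
qed

lemma Lsq_iff: "f \<in> Lsq \<mu> \<longleftrightarrow> f \<in> borel_measurable \<mu> \<and> integrable \<mu> (\<lambda>s. (norm (f s))\<^sup>2)"
  by (simp add: Lsq_def)

lemma kcnj_Lsq: "f \<in> Lsq \<mu> \<Longrightarrow> (\<lambda>s. kcnj (f s)) \<in> Lsq \<mu>"
  by (auto simp: Lsq_iff intro: borel_measurable_kcnj)

lemma Lsq_prod_integrable:
  assumes "f \<in> Lsq \<mu>" "g \<in> Lsq \<mu>"
  shows "integrable \<mu> (\<lambda>s. f s * g s)"
proof (rule Bochner_Integration.integrable_bound)
  show "integrable \<mu> (\<lambda>s. (norm (f s))\<^sup>2 + (norm (g s))\<^sup>2)"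
    using assms by (intro Bochner_Integration.integrable_add) (auto simp: Lsq_iff)
  show "(\<lambda>s. f s * g s) \<in> borel_measurable \<mu>" using assms by (auto simp: Lsq_iff)
  show "AE s in \<mu>. norm (f s * g s) \<le> norm ((norm (f s))\<^sup>2 + (norm (g s))\<^sup>2)"
  proof (intro always_eventually allI)
    fix s
    have "2 * (norm (f s) * norm (g s)) \<le> (norm (f s))\<^sup>2 + (norm (g s))\<^sup>2"
      using sum_squares_bound [of "norm (f s)" "norm (g s)"] by simp
    moreover have "0 \<le> norm (f s) * norm (g s)" by simp
    ultimately show "norm (f s * g s) \<le> norm ((norm (f s))\<^sup>2 + (norm (g s))\<^sup>2)"
      unfolding norm_mult real_norm_def by linarith
  qed
qed

lemma Lsq_inner_self:
  fixes f :: "'s \<Rightarrow> 'k::real_or_complex"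
  assumes "f \<in> Lsq \<mu>" shows "Lsq_inner \<mu> f f = of_real (\<integral>s. (norm (f s))\<^sup>2 \<partial>\<mu>)"
  unfolding Lsq_inner_def mult_kcnj_of_real
  using assms by (intro integral_bounded_linear bounded_linear_of_real) (simp add: Lsq_iff)

interpretation Lsq: semi_inner_space "Lsq \<mu> :: ('s \<Rightarrow> 'k::real_or_complex) set" "Lsq_inner \<mu>" for \<mu> :: "'s measure"
proof
  fix x y z :: "'s \<Rightarrow> 'k" and c
  show "(0::'s \<Rightarrow> 'k) \<in> Lsq \<mu>" by (simp add: Lsq_iff zero_fun_def)
  show "x + y \<in> Lsq \<mu>" if "x \<in> Lsq \<mu>" "y \<in> Lsq \<mu>"
  proof -
    have m: "(\<lambda>s. x s + y s) \<in> borel_measurable \<mu>" using that by (auto simp: Lsq_iff)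
    have "integrable \<mu> (\<lambda>s. (norm (x s + y s))\<^sup>2)"
    proof (rule Bochner_Integration.integrable_bound)
      show "integrable \<mu> (\<lambda>s. 2 * (norm (x s))\<^sup>2 + 2 * (norm (y s))\<^sup>2)"
        using that by (auto simp: Lsq_iff)
      show "(\<lambda>s. (norm (x s + y s))\<^sup>2) \<in> borel_measurable \<mu>" using m by simp
      show "AE s in \<mu>. norm ((norm (x s + y s))\<^sup>2) \<le> norm (2 * (norm (x s))\<^sup>2 + 2 * (norm (y s))\<^sup>2)"
        using norm_add_sq_le by (intro always_eventually allI) simp
    qed
    with m show ?thesis by (simp add: Lsq_iff plus_fun_def)
  qed
  show "fscale c x \<in> Lsq \<mu>" if "x \<in> Lsq \<mu>"
    using that by (auto simp: Lsq_iff fscale_def norm_mult power_mult_distrib)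
  show "Lsq_inner \<mu> (x + y) z = Lsq_inner \<mu> x z + Lsq_inner \<mu> y z"
    if "x \<in> Lsq \<mu>" "y \<in> Lsq \<mu>" "z \<in> Lsq \<mu>"
    using Lsq_prod_integrable [OF that(1) kcnj_Lsq [OF that(3)]]
      Lsq_prod_integrable [OF that(2) kcnj_Lsq [OF that(3)]] by (simp add: Lsq_inner_def distrib_right)
  show "Lsq_inner \<mu> (fscale c x) z = c * Lsq_inner \<mu> x z" for c
    by (simp add: Lsq_inner_def mult.assoc)
  show "Lsq_inner \<mu> y x = kcnj (Lsq_inner \<mu> x y)"
    by (simp add: Lsq_inner_def kcnj_mult kcnj_kcnj mult.commute flip: integral_kcnj)
  show "\<exists>r\<ge>0. Lsq_inner \<mu> x x = of_real r" if "x \<in> Lsq \<mu>"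
    unfolding Lsq_inner_self [OF that] by (intro exI [of _ "\<integral>s. (norm (x s))\<^sup>2 \<partial>\<mu>"]) simp
qed

lemma Lsq_nsq_eq: assumes "f \<in> Lsq \<mu>" shows "Lsq.nsq \<mu> f = (\<integral>s. (norm (f s))\<^sup>2 \<partial>\<mu>)"
  unfolding Lsq.nsq_def Lsq_inner_self [OF assms] by simp

lemma Lsq_norm_eq: "f \<in> Lsq \<mu> \<Longrightarrow> Lsq_norm \<mu> f = sqrt (Lsq.nsq \<mu> f)"
  by (simp add: Lsq_norm_def Lsq_nsq_eq)

lemma orthonormal_basis_orthonormal:
  assumes "orthonormal_basis \<mu> I h" "J \<subseteq> I" shows "Lsq.orthonormal_on \<mu> J h"
proof -
  have "Lsq.orthonormal_on \<mu> I h"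
    using assms(1) unfolding orthonormal_basis_def Lsq.orthonormal_on_def by simp
  then show ?thesis by (rule Lsq.orthonormal_on_subset [OF _ assms(2)])
qed

lemma orthonormal_basis_approx:
  assumes h: "orthonormal_basis \<mu> I h" and f: "f \<in> Lsq \<mu>" and \<epsilon>: "\<epsilon> > 0"
  shows "\<exists>J. finite J \<and> J \<subseteq> I \<and> (\<forall>K. finite K \<and> J \<subseteq> K \<and> K \<subseteq> I \<longrightarrow>
    sqrt (Lsq.nsq \<mu> (f - Lsq.combination K (\<lambda>j. Lsq_inner \<mu> f (h j)) h)) \<le> \<epsilon>)"
proof -
  obtain J c where J: "finite J" "J \<subseteq> I" and lt: "Lsq_norm \<mu> (\<lambda>s. f s - (\<Sum>i\<in>J. c i * h i s)) < \<epsilon>"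
    using h f \<epsilon> unfolding orthonormal_basis_def by blast
  have *: "sqrt (Lsq.nsq \<mu> (f - Lsq.combination K (\<lambda>j. Lsq_inner \<mu> f (h j)) h)) \<le> \<epsilon>"
    if K: "finite K" "J \<subseteq> K" "K \<subseteq> I" for K
  proof -
    have le: "Lsq.nsq \<mu> (f - Lsq.combination K (\<lambda>j. Lsq_inner \<mu> f (h j)) h)
        \<le> Lsq.nsq \<mu> (f - Lsq.combination K (\<lambda>j. if j \<in> J then c j else 0) h)"
      by (rule Lsq.nsq_projection_le [OF orthonormal_basis_orthonormal [OF h K(3)] K(1) f])
    have eq: "f - Lsq.combination K (\<lambda>j. if j \<in> J then c j else 0) h = (\<lambda>s. f s - (\<Sum>i\<in>J. c i * h i s))"
    proof
      fix s
      have "(\<Sum>j\<in>K. (if j \<in> J then c j else 0) * h j s) = (\<Sum>i\<in>J. c i * h i s)"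
        using K by (intro sum.mono_neutral_cong_right) auto
      then show "(f - Lsq.combination K (\<lambda>j. if j \<in> J then c j else 0) h) s = f s - (\<Sum>i\<in>J. c i * h i s)"
        by (simp add: Lsq.combination_def sum_fun_apply)
    qed
    have "f - Lsq.combination K (\<lambda>j. if j \<in> J then c j else 0) h \<in> Lsq \<mu>"
      by (intro Lsq.diff_mem f Lsq.combination_mem orthonormal_basis_orthonormal [OF h K(3)])
    then have "Lsq_norm \<mu> (\<lambda>s. f s - (\<Sum>i\<in>J. c i * h i s)) =
        sqrt (Lsq.nsq \<mu> (f - Lsq.combination K (\<lambda>j. if j \<in> J then c j else 0) h))"
      unfolding eq by (rule Lsq_norm_eq)
    then have "sqrt (Lsq.nsq \<mu> (f - Lsq.combination K (\<lambda>j. Lsq_inner \<mu> f (h j)) h))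
        \<le> Lsq_norm \<mu> (\<lambda>s. f s - (\<Sum>i\<in>J. c i * h i s))"
      using real_sqrt_le_mono [OF le] by simp
    then show ?thesis using lt by linarith
  qed
  show ?thesis by (rule exI [of _ J]) (use J * in blast)
qed

section \<open>Uniform limits of step maps\<close>

text \<open>
  As \<open>T\<close> need not be first countable, dominated convergence does not show that integrals over \<open>S\<close> depend
  continuously on \<open>t\<close>. Step maps provide this: the integral of a step map is a finite combination of
  elements of \<open>\<C>(T)\<close>, and it depends continuously on the map in the supremum norm.
\<close>

inductive step_map :: "'s measure \<Rightarrow> ('s \<Rightarrow> 'e::real_vector) \<Rightarrow> bool" for \<mu> where
  step_map_zero: "step_map \<mu> (\<lambda>s. 0)"
| step_map_add_box: "A \<in> sets \<mu> \<Longrightarrow> step_map \<mu> g \<Longrightarrow> step_map \<mu> (\<lambda>s. g s + indicat_real A s *\<^sub>R x)"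

inductive step_kernel :: "'s measure \<Rightarrow> ('s \<times> 's \<Rightarrow> 'e::real_vector) \<Rightarrow> bool" for \<mu> where
  step_kernel_zero: "step_kernel \<mu> (\<lambda>p. 0)"
| step_kernel_add_box: "A \<in> sets \<mu> \<Longrightarrow> B \<in> sets \<mu> \<Longrightarrow> step_kernel \<mu> v \<Longrightarrow>
    step_kernel \<mu> (\<lambda>p. v p + (indicat_real A (fst p) * indicat_real B (snd p)) *\<^sub>R x)"

definition regulated :: "'s measure \<Rightarrow> ('s \<Rightarrow> 'e::real_normed_vector) \<Rightarrow> bool"
  where "regulated \<mu> g \<longleftrightarrow> (\<forall>\<epsilon>>0. \<exists>v. step_map \<mu> v \<and> (\<forall>s. norm (g s - v s) \<le> \<epsilon>))"

definition regulated_kernel :: "'s measure \<Rightarrow> ('s \<times> 's \<Rightarrow> 'e::real_normed_vector) \<Rightarrow> bool"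
  where "regulated_kernel \<mu> w \<longleftrightarrow> (\<forall>\<epsilon>>0. \<exists>v. step_kernel \<mu> v \<and> (\<forall>p. norm (w p - v p) \<le> \<epsilon>))"

lemma step_map_linear:
  assumes T: "linear T" and g: "step_map \<mu> g" shows "step_map \<mu> (\<lambda>s. T (g s))"
  using g
proof induction
  case step_map_zero
  then show ?case using step_map.step_map_zero by (simp add: linear_0 [OF T])
next
  case (step_map_add_box A g x)
  then show ?case
    using step_map.step_map_add_box [of A \<mu> "\<lambda>s. T (g s)" "T x"]
    by (simp add: linear_add [OF T] linear_scale [OF T])
qed

lemma step_kernel_linear:
  assumes T: "linear T" and g: "step_kernel \<mu> g" shows "step_kernel \<mu> (\<lambda>s. T (g s))"
  using g
proof induction
  case step_kernel_zero
  then show ?case using step_kernel.step_kernel_zero by (simp add: linear_0 [OF T])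
next
  case (step_kernel_add_box A B g x)
  then show ?case
    using step_kernel.step_kernel_add_box [of A \<mu> B "\<lambda>s. T (g s)" "T x"]
    by (simp add: linear_add [OF T] linear_scale [OF T])
qed

lemma step_kernel_add:
  assumes g: "step_kernel \<mu> g" and f: "step_kernel \<mu> f" shows "step_kernel \<mu> (\<lambda>s. g s + f s)"
  using f
proof induction
  case (step_kernel_add_box A B f x)
  then show ?case
    using step_kernel.step_kernel_add_box [of A \<mu> B "\<lambda>s. g s + f s" x] by (simp add: add.assoc)
qed (simp add: g)

lemma regulated_step: "step_map \<mu> g \<Longrightarrow> regulated \<mu> g"
  unfolding regulated_def by (intro allI impI exI [of _ g]) simp

lemma regulated_kernel_step: "step_kernel \<mu> g \<Longrightarrow> regulated_kernel \<mu> g"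
  unfolding regulated_kernel_def by (intro allI impI exI [of _ g]) simp

lemma regulated_linear:
  assumes T: "bounded_linear T" and g: "regulated \<mu> g"
  shows "regulated \<mu> (\<lambda>s. T (g s))"
  unfolding regulated_def
proof (intro allI impI)
  fix \<epsilon> :: real assume \<epsilon>: "\<epsilon> > 0"
  obtain K where K: "K > 0" "\<And>x. norm (T x) \<le> norm x * K"
    using bounded_linear.pos_bounded [OF T] by blast
  obtain v where v: "step_map \<mu> v" "\<And>s. norm (g s - v s) \<le> \<epsilon> / K"
    using g K \<epsilon> unfolding regulated_def by (meson divide_pos_pos)
  have "norm (T (g s) - T (v s)) \<le> \<epsilon>" for s
  proof -
    have "norm (T (g s) - T (v s)) \<le> norm (g s - v s) * K"
      using K(2) [of "g s - v s"] by (simp add: linear_diff [OF bounded_linear.linear [OF T]])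
    also have "\<dots> \<le> \<epsilon> / K * K" using K v(2) by (intro mult_right_mono) auto
    finally show ?thesis using K by simp
  qed
  then show "\<exists>v. step_map \<mu> v \<and> (\<forall>s. norm (T (g s) - v s) \<le> \<epsilon>)"
    using step_map_linear [OF bounded_linear.linear [OF T] v(1)] by blast
qed

lemma regulated_kernel_diff_step:
  assumes w: "regulated_kernel \<mu> w" and v: "step_kernel \<mu> v"
  shows "regulated_kernel \<mu> (\<lambda>p. w p - v p)"
  unfolding regulated_kernel_def
proof (intro allI impI)
  fix \<epsilon> :: real assume "\<epsilon> > 0"
  then obtain u where u: "step_kernel \<mu> u" "\<And>p. norm (w p - u p) \<le> \<epsilon>"
    using w unfolding regulated_kernel_def by meson
  have "step_kernel \<mu> (\<lambda>p. u p + - v p)"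
    by (rule step_kernel_add [OF u(1) step_kernel_linear [OF linear_uminus v]])
  moreover have "norm (w p - v p - (u p + - v p)) \<le> \<epsilon>" for p using u(2) [of p] by simp
  ultimately show "\<exists>u. step_kernel \<mu> u \<and> (\<forall>p. norm (w p - v p - u p) \<le> \<epsilon>)" by blast
qed

lemma step_kernel_section: "step_kernel \<mu> v \<Longrightarrow> step_map \<mu> (\<lambda>s. v (r, s))"
proof (induction rule: step_kernel.induct)
  case (step_kernel_add_box A B v x)
  then show ?case
    using step_map_add_box [of B \<mu> "\<lambda>s. v (r, s)" "indicat_real A r *\<^sub>R x"] by (simp add: mult.commute)
qed (simp add: step_map_zero)

lemma regulated_kernel_section: assumes "regulated_kernel \<mu> w" shows "regulated \<mu> (\<lambda>s. w (r, s))"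
  unfolding regulated_def
proof (intro allI impI)
  fix \<epsilon> :: real assume "\<epsilon> > 0"
  then obtain v where v: "step_kernel \<mu> v" "\<And>p. norm (w p - v p) \<le> \<epsilon>"
    using assms unfolding regulated_kernel_def by meson
  show "\<exists>v. step_map \<mu> v \<and> (\<forall>s. norm (w (r, s) - v s) \<le> \<epsilon>)"
    by (intro exI [of _ "\<lambda>s. v (r, s)"] conjI allI step_kernel_section v)
qed

lemma step_map_bounded: "step_map \<mu> v \<Longrightarrow> \<exists>M. \<forall>s. norm (v s :: 'e::real_normed_vector) \<le> M"
proof (induction rule: step_map.induct)
  case (step_map_add_box A g x)
  then obtain M where M: "\<And>s. norm (g s) \<le> M" by blast
  have "norm (g s + indicat_real A s *\<^sub>R x) \<le> M + norm x" for s
  proof -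
    have "norm (indicat_real A s *\<^sub>R x) \<le> norm x" by (simp add: indicator_def)
    then show ?thesis
      using norm_triangle_ineq [of "g s" "indicat_real A s *\<^sub>R x"] M [of s] by linarith
  qed
  then show ?case by blast
qed (auto intro: exI [of _ 0])

lemma regulated_bounded: assumes "regulated \<mu> g" obtains M where "\<And>s. norm (g s) \<le> M"
proof -
  obtain v where v: "step_map \<mu> v" "\<And>s. norm (g s - v s) \<le> 1"
    using assms unfolding regulated_def by (meson zero_less_one)
  obtain M where "\<And>s. norm (v s) \<le> M" using step_map_bounded [OF v(1)] by blast
  then have "norm (g s) \<le> 1 + M" for s
    using v(2) [of s] norm_triangle_sub [of "g s" "v s"] by (smt (verit))
  then show ?thesis by (rule that)
qed

lemma regulated_kernel_bounded:
  assumes w: "regulated_kernel \<mu> w" obtains C where "\<And>p. norm (w p) \<le> C"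
proof -
  obtain v where v: "step_kernel \<mu> v" "\<And>p. norm (w p - v p) \<le> 1"
    using w unfolding regulated_kernel_def by (meson zero_less_one)
  have "\<exists>B. \<forall>p. norm (v p) \<le> B"
    using v(1)
  proof (induction rule: step_kernel.induct)
    case (step_kernel_add_box A A' v x)
    then obtain B where B: "\<And>p. norm (v p) \<le> B" by blast
    have "norm (v p + (indicat_real A (fst p) * indicat_real A' (snd p)) *\<^sub>R x) \<le> B + norm x" for p
    proof -
      have "norm ((indicat_real A (fst p) * indicat_real A' (snd p)) *\<^sub>R x) \<le> norm x"
        by (simp add: indicator_def)
      then show ?thesis
        using norm_triangle_ineq [of "v p" "(indicat_real A (fst p) * indicat_real A' (snd p)) *\<^sub>R x"] B [of p]
        by linarith
    qed
    then show ?case by blast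
  qed (auto intro: exI [of _ 0])
  then obtain B where B: "\<And>p. norm (v p) \<le> B" by blast
  have "norm (w p) \<le> 1 + B" for p
    using v(2) [of p] norm_triangle_sub [of "w p" "v p"] B [of p] by linarith
  then show ?thesis by (rule that)
qed

text \<open>
  For each point of \<open>S \<times> S\<close> there is an open box on which the kernel varies little. Finitely many boxes
  suffice, and the sets of points lying in the same first (or second) sides form a finite partition.
\<close>

lemma continuous_regulated_kernel:
  fixes w :: "'s::topological_space \<times> 's \<Rightarrow> 'e::real_normed_vector"
  assumes S: "compact (UNIV :: 's set)" and w: "continuous_on UNIV w" and \<mu>: "sets \<mu> = sets borel"
  shows "regulated_kernel \<mu> w"
  unfolding regulated_kernel_def
proof (intro allI impI)
  fix \<epsilon> :: real assume \<epsilon>: "\<epsilon> > 0"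
  have box: "\<exists>U V. open U \<and> open V \<and> p \<in> U \<times> V \<and> (\<forall>q\<in>U \<times> V. norm (w q - w p) < \<epsilon> / 2)" for p
  proof -
    have "open (w -` ball (w p) (\<epsilon> / 2))"
      using w by (intro open_vimage) auto
    moreover have "p \<in> w -` ball (w p) (\<epsilon> / 2)" using \<epsilon> by simp
    ultimately obtain U V where "open U" "open V" "p \<in> U \<times> V" "U \<times> V \<subseteq> w -` ball (w p) (\<epsilon> / 2)"
      by (rule open_prod_elim)
    then show ?thesis
      by (intro exI [of _ U] exI [of _ V]) (auto simp: subset_iff dist_norm norm_minus_commute)
  qed
  then obtain U V where UV: "\<And>p. open (U p)" "\<And>p. open (V p)" "\<And>p. p \<in> U p \<times> V p"
    "\<And>p q. q \<in> U p \<times> V p \<Longrightarrow> norm (w q - w p) < \<epsilon> / 2" by metis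
  have "compact (UNIV :: ('s \<times> 's) set)" using compact_Times [OF S S] by simp
  then obtain P where P: "finite P" "(UNIV :: ('s \<times> 's) set) \<subseteq> (\<Union>p\<in>P. U p \<times> V p)"
    by (rule compactE_image [of UNIV UNIV "\<lambda>p. U p \<times> V p"]) (use UV in \<open>auto intro: open_Times\<close>)
  \<comment> \<open>the points of \<open>S\<close> lying in \<open>U p\<close> exactly for the boxes \<open>p\<close> in \<open>Q\<close>, and similarly for \<open>V p\<close>\<close>
  define A where "A Q = {r. \<forall>p\<in>P. (r \<in> U p) = (p \<in> Q)}" for Q
  define B where "B Q = {s. \<forall>p\<in>P. (s \<in> V p) = (p \<in> Q)}" for Q
  have meas: "{r. \<forall>p\<in>P. (r \<in> X p) = (p \<in> Q)} \<in> sets \<mu>" if X: "\<And>p. open (X p)" for X :: "_ \<Rightarrow> 's set" and Q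
  proof -
    have "{r. \<forall>p\<in>P. (r \<in> X p) = (p \<in> Q)} = (\<Inter>p\<in>P. if p \<in> Q then X p else - X p)" by auto
    moreover have "(\<Inter>p\<in>P. if p \<in> Q then X p else - X p) \<in> sets borel"
    proof (cases "P = {}")
      case False
      have "(if p \<in> Q then X p else - X p) \<in> sets borel" for p using X by simp
      with False show ?thesis by (intro sets.finite_INT [OF P(1)])
    qed simp
    ultimately show ?thesis by (simp add: \<mu>)
  qed
  have A: "A Q \<in> sets \<mu>" and B: "B Q \<in> sets \<mu>" for Q
    unfolding A_def B_def by (rule meas UV)+
  define x where "x Q R = w (SOME p. p \<in> A Q \<times> B R)" for Q R
  define v where "v p = (\<Sum>(Q, R)\<in>Pow P \<times> Pow P. (indicat_real (A Q) (fst p) * indicat_real (B R) (snd p)) *\<^sub>R x Q R)" for p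
  let ?b = "\<lambda>z p. (indicat_real (A (fst z)) (fst p) * indicat_real (B (snd z)) (snd p)) *\<^sub>R x (fst z) (snd z)"
  have "step_kernel \<mu> (\<lambda>p. \<Sum>z\<in>Z. ?b z p)" if "finite Z" for Z
    using that
  proof (induction Z)
    case empty
    show ?case unfolding sum.empty by (rule step_kernel_zero)
  next
    case (insert z Z)
    have eq: "(\<lambda>p. \<Sum>z\<in>insert z Z. ?b z p) = (\<lambda>p. (\<Sum>z\<in>Z. ?b z p) + ?b z p)"
      unfolding sum.insert [OF insert.hyps] by (rule ext) (rule add.commute)
    show ?case unfolding eq by (rule step_kernel_add_box [OF A B insert.IH])
  qed
  from this [of "Pow P \<times> Pow P"] have "step_kernel \<mu> v"
    using P(1) by (simp add: v_def [abs_def] case_prod_unfold)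
  moreover have "norm (w q - v q) \<le> \<epsilon>" for q
  proof -
    define Q where "Q = {p \<in> P. fst q \<in> U p}"
    define R where "R = {p \<in> P. snd q \<in> V p}"
    have ind: "indicat_real (A Q') (fst q) = (if Q' = Q then 1 else 0)"
      "indicat_real (B Q') (snd q) = (if Q' = R then 1 else 0)" if "Q' \<subseteq> P" for Q'
      using that by (auto simp: indicator_def A_def B_def Q_def R_def)
    have "v q = (\<Sum>z\<in>Pow P \<times> Pow P. if z = (Q, R) then x Q R else 0)"
      unfolding v_def
    proof (rule sum.cong [OF refl])
      fix z assume "z \<in> Pow P \<times> Pow P"
      then obtain Q' R' where z: "z = (Q', R')" "Q' \<subseteq> P" "R' \<subseteq> P" by auto
      show "(case z of (Q, R) \<Rightarrow> (indicat_real (A Q) (fst q) * indicat_real (B R) (snd q)) *\<^sub>R x Q R) =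
          (if z = (Q, R) then x Q R else 0)"
        by (simp add: z(1) ind(1) [OF z(2)] ind(2) [OF z(3)])
    qed
    also have "\<dots> = x Q R" using P(1) by (simp add: Q_def R_def)
    finally have vq: "v q = x Q R" .
    have "q \<in> A Q \<times> B R" by (auto simp: A_def B_def Q_def R_def mem_Times_iff)
    then have "(SOME p. p \<in> A Q \<times> B R) \<in> A Q \<times> B R" by (rule someI)
    then obtain q' where q': "x Q R = w q'" "q' \<in> A Q \<times> B R" by (auto simp: x_def)
    have "q \<in> (\<Union>p\<in>P. U p \<times> V p)" by (rule subsetD [OF P(2) UNIV_I])
    then obtain p where p: "p \<in> P" "q \<in> U p \<times> V p" by (rule UN_E)
    then have "q' \<in> U p \<times> V p" using q'(2) by (auto simp: A_def B_def Q_def R_def mem_Times_iff)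
    then have "norm (w q' - w p) < \<epsilon> / 2" by (rule UV(4))
    moreover have "norm (w q - w p) < \<epsilon> / 2" by (rule UV(4) [OF p(2)])
    ultimately show ?thesis
      using norm_triangle_ineq4 [of "w q - w p" "w q' - w p"] by (simp add: vq q'(1))
  qed
  ultimately show "\<exists>v. step_kernel \<mu> v \<and> (\<forall>p. norm (w p - v p) \<le> \<epsilon>)" by blast
qed


section \<open>Integrals of maps into the continuous functions\<close>

lemma norm_integral_prod_le:
  fixes k f :: "'s \<Rightarrow> 'k::real_or_complex"
  assumes k: "k \<in> borel_measurable \<mu>" "\<And>s. norm (k s) \<le> M" and f: "integrable \<mu> f"
  shows "integrable \<mu> (\<lambda>s. k s * f s)" "norm (\<integral>s. k s * f s \<partial>\<mu>) \<le> M * (\<integral>s. norm (f s) \<partial>\<mu>)"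
proof -
  have M: "M \<ge> 0" using k(2) norm_ge_zero order_trans by blast
  have le: "norm (k s * f s) \<le> M * norm (f s)" for s
    unfolding norm_mult by (rule mult_right_mono [OF k(2)]) simp
  have Mf: "integrable \<mu> (\<lambda>s. M * norm (f s))" using f by simp
  show *: "integrable \<mu> (\<lambda>s. k s * f s)"
  proof (rule Bochner_Integration.integrable_bound [OF Mf])
    show "(\<lambda>s. k s * f s) \<in> borel_measurable \<mu>" using k(1) f by simp
    show "AE s in \<mu>. norm (k s * f s) \<le> norm (M * norm (f s))"
      using le M by (intro always_eventually allI) (simp add: abs_mult)
  qed
  have "norm (\<integral>s. k s * f s \<partial>\<mu>) \<le> (\<integral>s. norm (k s * f s) \<partial>\<mu>)" by (rule integral_norm_bound)
  also have "\<dots> \<le> (\<integral>s. M * norm (f s) \<partial>\<mu>)"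
    using le by (intro integral_mono integrable_norm [OF *] Mf)
  finally show "norm (\<integral>s. k s * f s \<partial>\<mu>) \<le> M * (\<integral>s. norm (f s) \<partial>\<mu>)" by simp
qed

lemma integrable_indicator_prod:
  fixes f :: "'s \<Rightarrow> 'k::real_or_complex"
  assumes "A \<in> sets \<mu>" "integrable \<mu> f"
  shows "integrable \<mu> (\<lambda>s. of_real (indicat_real A s) * f s)"
  by (rule norm_integral_prod_le(1) [of _ _ 1, OF _ _ assms(2)]) (use assms in \<open>auto simp: indicator_def\<close>)

lemma step_map_measurable:
  fixes g :: "'s \<Rightarrow> 't::topological_space \<Rightarrow>\<^sub>C 'k::real_or_complex"
  shows "step_map \<mu> g \<Longrightarrow> (\<lambda>s. apply_bcontfun (g s) t) \<in> borel_measurable \<mu>"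
proof (induction rule: step_map.induct)
  case (step_map_add_box A g x)
  then show ?case
    by (simp add: bcontfun_apply scaleR_bcontfun.rep_eq)
qed (simp add: bcontfun_apply)

lemma regulated_measurable:
  fixes g :: "'s \<Rightarrow> 't::topological_space \<Rightarrow>\<^sub>C 'k::real_or_complex"
  assumes g: "regulated \<mu> g" shows "(\<lambda>s. apply_bcontfun (g s) t) \<in> borel_measurable \<mu>"
proof -
  have "\<forall>n. \<exists>v. step_map \<mu> v \<and> (\<forall>s. norm (g s - v s) \<le> inverse (real (Suc n)))"
    using g unfolding regulated_def by simp
  then obtain v where v: "\<And>n. step_map \<mu> (v n)" "\<And>n s. norm (g s - v n s) \<le> inverse (real (Suc n))"
    by metis
  show ?thesis
  proof (rule borel_measurable_LIMSEQ_metric [OF step_map_measurable [OF v(1)]])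
    fix s
    have "norm (apply_bcontfun (v n s) t - apply_bcontfun (g s) t) \<le> inverse (real (Suc n))" for n
    proof -
      have "norm (apply_bcontfun (g s) t - apply_bcontfun (v n s) t) = norm (apply_bcontfun (g s - v n s) t)"
        by (simp add: bcontfun_apply)
      also have "\<dots> \<le> norm (g s - v n s)" by (rule norm_bounded)
      also have "\<dots> \<le> inverse (real (Suc n))" by (rule v(2))
      finally show ?thesis by (simp add: norm_minus_commute)
    qed
    then have "(\<lambda>n. apply_bcontfun (v n s) t - apply_bcontfun (g s) t) \<longlonglongrightarrow> 0"
      by (intro Lim_null_comparison [OF always_eventually LIMSEQ_inverse_real_of_nat]) simp
    then show "(\<lambda>n. apply_bcontfun (v n s) t) \<longlonglongrightarrow> apply_bcontfun (g s) t"
      by (simp add: LIM_zero_iff)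
  qed
qed

lemma regulated_prod_integrable:
  fixes g :: "'s \<Rightarrow> 't::topological_space \<Rightarrow>\<^sub>C 'k::real_or_complex"
  assumes g: "regulated \<mu> g" and f: "integrable \<mu> f"
  shows "integrable \<mu> (\<lambda>s. apply_bcontfun (g s) t * f s)"
proof -
  obtain M where M: "\<And>s. norm (g s) \<le> M" using regulated_bounded [OF g] by blast
  have "norm (apply_bcontfun (g s) t) \<le> M" for s using norm_bounded M by (rule order_trans)
  then show ?thesis by (rule norm_integral_prod_le(1) [OF regulated_measurable [OF g] _ f])
qed

definition weighted_integral ::
    "'s measure \<Rightarrow> ('s \<Rightarrow> 'k) \<Rightarrow> ('s \<Rightarrow> 't::topological_space \<Rightarrow>\<^sub>C 'k::real_or_complex) \<Rightarrow> 't \<Rightarrow>\<^sub>C 'k"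
  where "weighted_integral \<mu> f g = Eintegral \<mu> (\<lambda>s. g s * const_bcontfun (f s))"

text \<open>
  The integrals of the approximating step maps are elements of \<open>\<C>(T)\<close>, and their uniform limit is
  the pointwise integral.
\<close>

lemma weighted_integral_apply:
  fixes g :: "'s \<Rightarrow> 't::topological_space \<Rightarrow>\<^sub>C 'k::real_or_complex"
  assumes g: "regulated \<mu> g" and f: "integrable \<mu> f"
  shows "apply_bcontfun (weighted_integral \<mu> f g) t = (\<integral>s. apply_bcontfun (g s) t * f s \<partial>\<mu>)"
proof -
  have step: "\<exists>e. \<forall>t. apply_bcontfun e t = (\<integral>s. apply_bcontfun (v s) t * f s \<partial>\<mu>)"
    if "step_map \<mu> v" for v :: "'s \<Rightarrow> 't \<Rightarrow>\<^sub>C 'k"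
    using that
  proof (induction rule: step_map.induct)
    case step_map_zero
    show ?case by (rule exI [of _ 0]) (simp add: bcontfun_apply)
  next
    case (step_map_add_box A v x)
    then obtain e where e: "\<And>t. apply_bcontfun e t = (\<integral>s. apply_bcontfun (v s) t * f s \<partial>\<mu>)" by blast
    let ?c = "\<integral>s. of_real (indicat_real A s) * f s \<partial>\<mu>"
    have i: "integrable \<mu> (\<lambda>s. of_real (indicat_real A s) * f s)"
      by (rule integrable_indicator_prod [OF step_map_add_box(1) f])
    have "apply_bcontfun (e + const_bcontfun ?c * x) t =
        (\<integral>s. apply_bcontfun (v s + indicat_real A s *\<^sub>R x) t * f s \<partial>\<mu>)" for t
    proof -
      have "(\<integral>s. apply_bcontfun (v s + indicat_real A s *\<^sub>R x) t * f s \<partial>\<mu>) =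
          (\<integral>s. apply_bcontfun (v s) t * f s + (of_real (indicat_real A s) * f s) * apply_bcontfun x t \<partial>\<mu>)"
        by (intro Bochner_Integration.integral_cong)
           (simp_all add: bcontfun_apply scaleR_bcontfun.rep_eq scaleR_conv_of_real [where 'a = 'k] algebra_simps)
      also have "\<dots> = apply_bcontfun e t + ?c * apply_bcontfun x t"
        using regulated_prod_integrable [OF regulated_step [OF step_map_add_box(2)] f] i
        by (simp add: e)
      finally show ?thesis by (simp add: bcontfun_apply)
    qed
    then show ?case by blast
  qed
  let ?F = "\<lambda>t. \<integral>s. apply_bcontfun (g s) t * f s \<partial>\<mu>"
  have "?F \<in> bcontfun"
  proof (rule uniform_approx_bcontfun)
    fix \<epsilon> :: real assume \<epsilon>: "\<epsilon> > 0"
    let ?c = "(\<integral>s. norm (f s) \<partial>\<mu>) + 1"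
    have c: "?c > 0" by (simp add: add_nonneg_pos integral_nonneg_AE)
    obtain v where v: "step_map \<mu> v" "\<And>s. norm (g s - v s) \<le> \<epsilon> / ?c"
      using g \<epsilon> c unfolding regulated_def by (meson divide_pos_pos)
    obtain e where e: "\<And>t. apply_bcontfun e t = (\<integral>s. apply_bcontfun (v s) t * f s \<partial>\<mu>)"
      using step [OF v(1)] by blast
    have "norm (?F t - apply_bcontfun e t) \<le> \<epsilon>" for t
    proof -
      let ?k = "\<lambda>s. apply_bcontfun (g s) t - apply_bcontfun (v s) t"
      have "?F t - apply_bcontfun e t = (\<integral>s. ?k s * f s \<partial>\<mu>)"
        using regulated_prod_integrable [OF g f] regulated_prod_integrable [OF regulated_step [OF v(1)] f]
        by (simp add: e left_diff_distrib)
      also have "norm \<dots> \<le> \<epsilon> / ?c * (\<integral>s. norm (f s) \<partial>\<mu>)"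
      proof (rule norm_integral_prod_le(2) [OF _ _ f])
        show "?k \<in> borel_measurable \<mu>"
          by (intro borel_measurable_diff regulated_measurable g step_map_measurable v(1))
        fix s
        have "norm (?k s) = norm (apply_bcontfun (g s - v s) t)" by (simp add: bcontfun_apply)
        also have "\<dots> \<le> norm (g s - v s)" by (rule norm_bounded)
        finally show "norm (?k s) \<le> \<epsilon> / ?c" using v(2) [of s] by linarith
      qed
      also have "\<dots> \<le> \<epsilon> / ?c * ?c" using \<epsilon> c by (intro mult_left_mono) auto
      finally show ?thesis using c by simp
    qed
    then show "\<exists>e. \<forall>t. norm (?F t - apply_bcontfun e t) \<le> \<epsilon>" by blast
  qed
  then show ?thesis
    by (simp add: weighted_integral_def Eintegral_def bcontfun_apply Bcontfun_inverse)
qed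

lemma weighted_integral_norm_le:
  fixes g :: "'s \<Rightarrow> 't::topological_space \<Rightarrow>\<^sub>C 'k::real_or_complex"
  assumes g: "regulated \<mu> g" and f: "integrable \<mu> f" and M: "\<And>s. norm (g s) \<le> M"
  shows "norm (weighted_integral \<mu> f g) \<le> M * (\<integral>s. norm (f s) \<partial>\<mu>)"
proof (rule norm_bound)
  fix t
  have "norm (apply_bcontfun (g s) t) \<le> M" for s using norm_bounded M by (rule order_trans)
  then show "norm (apply_bcontfun (weighted_integral \<mu> f g) t) \<le> M * (\<integral>s. norm (f s) \<partial>\<mu>)"
    unfolding weighted_integral_apply [OF g f]
    by (rule norm_integral_prod_le(2) [OF regulated_measurable [OF g] _ f])
qed

lemma weighted_integral_diff:
  fixes g g' :: "'s \<Rightarrow> 't::topological_space \<Rightarrow>\<^sub>C 'k::real_or_complex"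
  assumes "regulated \<mu> g" "regulated \<mu> g'" "regulated \<mu> (\<lambda>s. g s - g' s)" "integrable \<mu> f"
  shows "weighted_integral \<mu> f (\<lambda>s. g s - g' s) = weighted_integral \<mu> f g - weighted_integral \<mu> f g'"
  using assms
  by (intro bcontfun_eqI)
     (simp add: bcontfun_apply weighted_integral_apply left_diff_distrib regulated_prod_integrable)

lemma kernel_map_eq: "kernel_map \<mu> w f r = weighted_integral \<mu> f (\<lambda>s. w (r, s))"
  by (simp add: kernel_map_def weighted_integral_def)

lemma kernel_map_apply:
  fixes w :: "'s \<times> 's \<Rightarrow> 't::topological_space \<Rightarrow>\<^sub>C 'k::real_or_complex"
  assumes "regulated_kernel \<mu> w" "integrable \<mu> f"
  shows "apply_bcontfun (kernel_map \<mu> w f r) t = (\<integral>s. apply_bcontfun (w (r, s)) t * f s \<partial>\<mu>)"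
  unfolding kernel_map_eq by (rule weighted_integral_apply [OF regulated_kernel_section [OF assms(1)] assms(2)])

lemma kernel_map_norm_le:
  fixes w :: "'s \<times> 's \<Rightarrow> 't::topological_space \<Rightarrow>\<^sub>C 'k::real_or_complex"
  assumes "regulated_kernel \<mu> w" "integrable \<mu> f" "\<And>p. norm (w p) \<le> M"
  shows "norm (kernel_map \<mu> w f r) \<le> M * (\<integral>s. norm (f s) \<partial>\<mu>)"
  unfolding kernel_map_eq
  by (rule weighted_integral_norm_le [OF regulated_kernel_section [OF assms(1)] assms(2,3)])

lemma kernel_map_diff:
  fixes w v :: "'s \<times> 's \<Rightarrow> 't::topological_space \<Rightarrow>\<^sub>C 'k::real_or_complex"
  assumes "regulated_kernel \<mu> w" "step_kernel \<mu> v" "integrable \<mu> f"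
  shows "kernel_map \<mu> (\<lambda>p. w p - v p) f r = kernel_map \<mu> w f r - kernel_map \<mu> v f r"
  unfolding kernel_map_eq
  by (intro weighted_integral_diff regulated_kernel_section [OF assms(1)]
      regulated_kernel_section [OF regulated_kernel_step [OF assms(2)]]
      regulated_kernel_section [OF regulated_kernel_diff_step [OF assms(1,2)]] assms(3))

lemma step_kernel_map_box:
  fixes v :: "'s \<times> 's \<Rightarrow> 't::topological_space \<Rightarrow>\<^sub>C 'k::real_or_complex"
  assumes A: "A \<in> sets \<mu>" and B: "B \<in> sets \<mu>" and v: "step_kernel \<mu> v" and f: "integrable \<mu> f"
  shows "kernel_map \<mu> (\<lambda>p. v p + (indicat_real A (fst p) * indicat_real B (snd p)) *\<^sub>R x) f r =
    kernel_map \<mu> v f r + indicat_real A r *\<^sub>R (const_bcontfun (\<integral>s. of_real (indicat_real B s) * f s \<partial>\<mu>) * x)"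
proof (rule bcontfun_eqI)
  fix t
  let ?w = "\<lambda>p. v p + (indicat_real A (fst p) * indicat_real B (snd p)) *\<^sub>R x"
  have "apply_bcontfun (kernel_map \<mu> ?w f r) t =
      (\<integral>s. apply_bcontfun (v (r, s)) t * f s +
        (of_real (indicat_real B s) * f s) * (of_real (indicat_real A r) * apply_bcontfun x t) \<partial>\<mu>)"
    unfolding kernel_map_apply [OF regulated_kernel_step [OF step_kernel_add_box [OF A B v]] f]
    by (intro Bochner_Integration.integral_cong)
       (simp_all add: bcontfun_apply scaleR_bcontfun.rep_eq scaleR_conv_of_real [where 'a = 'k] algebra_simps)
  also have "\<dots> = (\<integral>s. apply_bcontfun (v (r, s)) t * f s \<partial>\<mu>) +
      (\<integral>s. of_real (indicat_real B s) * f s \<partial>\<mu>) * (of_real (indicat_real A r) * apply_bcontfun x t)"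
    using regulated_prod_integrable [OF regulated_kernel_section [OF regulated_kernel_step [OF v]] f]
      integrable_indicator_prod [OF B f] by simp
  finally show "apply_bcontfun (kernel_map \<mu> ?w f r) t = apply_bcontfun (kernel_map \<mu> v f r +
      indicat_real A r *\<^sub>R (const_bcontfun (\<integral>s. of_real (indicat_real B s) * f s \<partial>\<mu>) * x)) t"
    by (simp add: kernel_map_apply [OF regulated_kernel_step [OF v] f] bcontfun_apply
        scaleR_bcontfun.rep_eq scaleR_conv_of_real [where 'a = 'k] mult_ac)
qed

lemma step_kernel_map:
  fixes v :: "'s \<times> 's \<Rightarrow> 't::topological_space \<Rightarrow>\<^sub>C 'k::real_or_complex"
  assumes v: "step_kernel \<mu> v" and f: "integrable \<mu> f"
  shows "step_map \<mu> (kernel_map \<mu> v f)"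
  using v
proof (induction rule: step_kernel.induct)
  case step_kernel_zero
  have "kernel_map \<mu> (\<lambda>p. 0 :: 't \<Rightarrow>\<^sub>C 'k) f = (\<lambda>r. 0)"
  proof (rule ext, rule bcontfun_eqI)
    fix r t
    show "apply_bcontfun (kernel_map \<mu> (\<lambda>p. 0 :: 't \<Rightarrow>\<^sub>C 'k) f r) t = apply_bcontfun 0 t"
      by (simp add: kernel_map_apply [OF regulated_kernel_step [OF step_kernel.step_kernel_zero] f] bcontfun_apply)
  qed
  then show ?case by (simp add: step_map_zero)
next
  case (step_kernel_add_box A B v x)
  have eq: "kernel_map \<mu> (\<lambda>p. v p + (indicat_real A (fst p) * indicat_real B (snd p)) *\<^sub>R x) f =
      (\<lambda>r. kernel_map \<mu> v f r +
        indicat_real A r *\<^sub>R (const_bcontfun (\<integral>s. of_real (indicat_real B s) * f s \<partial>\<mu>) * x))"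
    by (rule ext) (rule step_kernel_map_box [OF step_kernel_add_box(1-3) f])
  show ?case unfolding eq by (rule step_map_add_box [OF step_kernel_add_box(1,4)])
qed

text \<open>The kernel map turns step kernels into step maps, and it is continuous in the kernel.\<close>

lemma kernel_map_regulated:
  fixes w :: "'s \<times> 's \<Rightarrow> 't::topological_space \<Rightarrow>\<^sub>C 'k::real_or_complex"
  assumes w: "regulated_kernel \<mu> w" and f: "integrable \<mu> f"
  shows "regulated \<mu> (kernel_map \<mu> w f)"
  unfolding regulated_def
proof (intro allI impI)
  fix \<epsilon> :: real assume \<epsilon>: "\<epsilon> > 0"
  let ?c = "(\<integral>s. norm (f s) \<partial>\<mu>) + 1"
  have c: "?c > 0" by (simp add: add_nonneg_pos integral_nonneg_AE)
  obtain v where v: "step_kernel \<mu> v" "\<And>p. norm (w p - v p) \<le> \<epsilon> / ?c"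
    using w \<epsilon> c unfolding regulated_kernel_def by (meson divide_pos_pos)
  have *: "norm (kernel_map \<mu> w f r - kernel_map \<mu> v f r) \<le> \<epsilon>" for r
  proof -
    have "norm (kernel_map \<mu> w f r - kernel_map \<mu> v f r) \<le> \<epsilon> / ?c * (\<integral>s. norm (f s) \<partial>\<mu>)"
      unfolding kernel_map_diff [OF w v(1) f, symmetric]
      by (rule kernel_map_norm_le [OF regulated_kernel_diff_step [OF w v(1)] f v(2)])
    also have "\<dots> \<le> \<epsilon> / ?c * ?c" using \<epsilon> c by (intro mult_left_mono) auto
    finally show ?thesis using c by simp
  qed
  show "\<exists>v. step_map \<mu> v \<and> (\<forall>r. norm (kernel_map \<mu> w f r - v r) \<le> \<epsilon>)"
    by (intro exI [of _ "kernel_map \<mu> v f"] conjI allI step_kernel_map [OF v(1) f] *)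
qed

section \<open>The sesquilinear form of a kernel\<close>

text \<open>
  The value at \<open>t\<close> is \<open>\<langle>W f|g\<rangle>\<close> for the integral operator \<open>W\<close> on \<open>L\<^sup>2(\<mu>)\<close> with the scalar kernel
  \<open>(r, s) \<mapsto> w(r, s)(t)\<close>.
\<close>

definition kernel_form ::
    "'s measure \<Rightarrow> ('s \<times> 's \<Rightarrow> 't::topological_space \<Rightarrow>\<^sub>C 'k::real_or_complex) \<Rightarrow> ('s \<Rightarrow> 'k) \<Rightarrow> ('s \<Rightarrow> 'k) \<Rightarrow> 't \<Rightarrow>\<^sub>C 'k"
  where "kernel_form \<mu> w f g = weighted_integral \<mu> (\<lambda>r. kcnj (g r)) (kernel_map \<mu> w f)"

lemma integrable_kcnj: "integrable \<mu> g \<Longrightarrow> integrable \<mu> (\<lambda>r. kcnj (g r :: 'k::real_or_complex))"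
  by (rule integrable_bounded_linear [OF bounded_linear_kcnj])

context
  fixes \<mu> :: "'s measure" and f g :: "'s \<Rightarrow> 'k::real_or_complex"
  assumes f: "integrable \<mu> f" and g: "integrable \<mu> g"
begin

lemma kernel_form_apply:
  "regulated_kernel \<mu> w \<Longrightarrow> apply_bcontfun (kernel_form \<mu> w f g) t =
    (\<integral>r. apply_bcontfun (kernel_map \<mu> w f r) t * kcnj (g r) \<partial>\<mu>)"
  unfolding kernel_form_def
  by (rule weighted_integral_apply [OF kernel_map_regulated [OF _ f] integrable_kcnj [OF g]])

lemma kernel_form_norm_le:
  assumes "regulated_kernel \<mu> w" "\<And>p. norm (w p) \<le> M"
  shows "norm (kernel_form \<mu> w f g) \<le> M * (\<integral>s. norm (f s) \<partial>\<mu>) * (\<integral>s. norm (g s) \<partial>\<mu>)"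
  using weighted_integral_norm_le [OF kernel_map_regulated [OF assms(1) f] integrable_kcnj [OF g]
      kernel_map_norm_le [OF assms(1) f assms(2)]] by (simp add: kernel_form_def)

lemma kernel_form_diff:
  assumes w: "regulated_kernel \<mu> w" and v: "step_kernel \<mu> v"
  shows "kernel_form \<mu> (\<lambda>p. w p - v p) f g = kernel_form \<mu> w f g - kernel_form \<mu> v f g"
proof -
  have "kernel_map \<mu> (\<lambda>p. w p - v p) f = (\<lambda>r. kernel_map \<mu> w f r - kernel_map \<mu> v f r)"
    by (rule ext) (rule kernel_map_diff [OF w v f])
  moreover have "regulated \<mu> (kernel_map \<mu> (\<lambda>p. w p - v p) f)"
    by (rule kernel_map_regulated [OF regulated_kernel_diff_step [OF w v] f])
  ultimately show ?thesis
    unfolding kernel_form_def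
    using weighted_integral_diff [OF kernel_map_regulated [OF w f]
        kernel_map_regulated [OF regulated_kernel_step [OF v] f] _ integrable_kcnj [OF g]] by simp
qed

lemma kernel_form_zero: "kernel_form \<mu> (\<lambda>p. 0) f g = 0"
  by (rule bcontfun_eqI)
     (simp add: kernel_form_apply kernel_map_apply regulated_kernel_step step_kernel_zero f bcontfun_apply)

lemma kernel_form_box:
  assumes A: "A \<in> sets \<mu>" and B: "B \<in> sets \<mu>" and v: "step_kernel \<mu> v"
  shows "kernel_form \<mu> (\<lambda>p. v p + (indicat_real A (fst p) * indicat_real B (snd p)) *\<^sub>R x) f g =
    kernel_form \<mu> v f g + x * const_bcontfun (kcnj (\<integral>s. of_real (indicat_real A s) * g s \<partial>\<mu>) *
      (\<integral>s. of_real (indicat_real B s) * f s \<partial>\<mu>))"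
proof (rule bcontfun_eqI)
  fix t
  let ?w = "\<lambda>p. v p + (indicat_real A (fst p) * indicat_real B (snd p)) *\<^sub>R x"
  let ?b = "\<integral>s. of_real (indicat_real B s) * f s \<partial>\<mu>"
  have "apply_bcontfun (kernel_form \<mu> ?w f g) t = (\<integral>r. apply_bcontfun (kernel_map \<mu> v f r) t * kcnj (g r) +
      (of_real (indicat_real A r) * kcnj (g r)) * (?b * apply_bcontfun x t) \<partial>\<mu>)"
    unfolding kernel_form_apply [OF regulated_kernel_step [OF step_kernel_add_box [OF A B v]]]
      step_kernel_map_box [OF A B v f]
    by (intro Bochner_Integration.integral_cong)
       (simp_all add: bcontfun_apply scaleR_bcontfun.rep_eq scaleR_conv_of_real [where 'a = 'k] algebra_simps)
  also have "\<dots> = (\<integral>r. apply_bcontfun (kernel_map \<mu> v f r) t * kcnj (g r) \<partial>\<mu>) +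
      (\<integral>r. of_real (indicat_real A r) * kcnj (g r) \<partial>\<mu>) * (?b * apply_bcontfun x t)"
    using regulated_prod_integrable [OF kernel_map_regulated [OF regulated_kernel_step [OF v] f] integrable_kcnj [OF g]]
      integrable_indicator_prod [OF A integrable_kcnj [OF g]] by simp
  also have "(\<integral>r. of_real (indicat_real A r) * kcnj (g r) \<partial>\<mu>) = kcnj (\<integral>r. of_real (indicat_real A r) * g r \<partial>\<mu>)"
    by (simp add: kcnj_mult flip: integral_kcnj)
  finally show "apply_bcontfun (kernel_form \<mu> ?w f g) t = apply_bcontfun (kernel_form \<mu> v f g +
      x * const_bcontfun (kcnj (\<integral>s. of_real (indicat_real A s) * g s \<partial>\<mu>) * ?b)) t"
    by (simp add: kernel_form_apply [OF regulated_kernel_step [OF v]] bcontfun_apply mult_ac)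
qed

end


lemma star_add: "star (x + y) = star x + star y"
  by (rule bcontfun_eqI) (simp add: bcontfun_apply kcnj_add)

lemma star_mult: "star (x * y) = star x * star y"
  by (rule bcontfun_eqI) (simp add: bcontfun_apply kcnj_mult)

lemma star_const: "star (const_bcontfun c) = const_bcontfun (kcnj c)"
  by (rule bcontfun_eqI) (simp add: bcontfun_apply)

lemma star_diff: "star (x - y) = star x - star y"
  by (rule bcontfun_eqI) (simp add: bcontfun_apply kcnj_diff)

lemma star_scaleR: "star (r *\<^sub>R x) = r *\<^sub>R star x"
  by (rule bcontfun_eqI)
     (simp add: star.rep_eq scaleR_bcontfun.rep_eq linear_scale [OF bounded_linear.linear [OF bounded_linear_kcnj]])

lemma norm_star_le: "norm (star x) \<le> norm x"
  by (rule norm_bound) (simp add: star.rep_eq norm_bounded)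

definition adjoint_kernel :: "('s \<times> 's \<Rightarrow> 't::topological_space \<Rightarrow>\<^sub>C 'k::real_or_complex) \<Rightarrow> 's \<times> 's \<Rightarrow> 't \<Rightarrow>\<^sub>C 'k"
  where "adjoint_kernel w = (\<lambda>(r, s). star (w (s, r)))"

lemma adjoint_kernel_box:
  "adjoint_kernel (\<lambda>p. v p + (indicat_real A (fst p) * indicat_real B (snd p)) *\<^sub>R x) =
    (\<lambda>p. adjoint_kernel v p + (indicat_real B (fst p) * indicat_real A (snd p)) *\<^sub>R star x)"
  by (rule ext) (simp add: adjoint_kernel_def case_prod_unfold star_add star_scaleR mult.commute)

lemma adjoint_kernel_zero: "adjoint_kernel (\<lambda>p. 0) = (\<lambda>p. 0)"
  by (rule ext) (simp add: adjoint_kernel_def case_prod_unfold)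

lemma step_adjoint_kernel: "step_kernel \<mu> v \<Longrightarrow> step_kernel \<mu> (adjoint_kernel v)"
proof (induction rule: step_kernel.induct)
  case step_kernel_zero
  show ?case unfolding adjoint_kernel_zero by (rule step_kernel.step_kernel_zero)
next
  case (step_kernel_add_box A B v x)
  then show ?case
    unfolding adjoint_kernel_box by (intro step_kernel.step_kernel_add_box)
qed

lemma regulated_adjoint_kernel:
  assumes w: "regulated_kernel \<mu> w" shows "regulated_kernel \<mu> (adjoint_kernel w)"
  unfolding regulated_kernel_def
proof (intro allI impI)
  fix \<epsilon> :: real assume "\<epsilon> > 0"
  then obtain v where v: "step_kernel \<mu> v" "\<And>p. norm (w p - v p) \<le> \<epsilon>"
    using w unfolding regulated_kernel_def by meson
  have *: "norm (adjoint_kernel w p - adjoint_kernel v p) \<le> \<epsilon>" for p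
    using norm_star_le [of "w (snd p, fst p) - v (snd p, fst p)"] v(2) [of "(snd p, fst p)"]
    by (simp add: adjoint_kernel_def case_prod_unfold star_diff)
  show "\<exists>v. step_kernel \<mu> v \<and> (\<forall>p. norm (adjoint_kernel w p - v p) \<le> \<epsilon>)"
    by (intro exI [of _ "adjoint_kernel v"] conjI allI step_adjoint_kernel v(1) *)
qed

text \<open>
  Exchanging the two integrations is a trivial identity for indicators of boxes; both sides
  depend continuously on the kernel in the supremum norm.
\<close>

lemma kernel_form_adjoint:
  fixes w :: "'s \<times> 's \<Rightarrow> 't::topological_space \<Rightarrow>\<^sub>C 'k::real_or_complex"
  assumes w: "regulated_kernel \<mu> w" and f: "integrable \<mu> f" and g: "integrable \<mu> g"
  shows "kernel_form \<mu> (adjoint_kernel w) f g = star (kernel_form \<mu> w g f)"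
proof -
  have step: "kernel_form \<mu> (adjoint_kernel v) f g = star (kernel_form \<mu> v g f)"
    if "step_kernel \<mu> v" for v :: "'s \<times> 's \<Rightarrow> 't \<Rightarrow>\<^sub>C 'k"
    using that
  proof (induction rule: step_kernel.induct)
    case step_kernel_zero
    show ?case unfolding adjoint_kernel_zero kernel_form_zero [OF f g] kernel_form_zero [OF g f] by simp
  next
    case (step_kernel_add_box A B v x)
    show ?case
      unfolding adjoint_kernel_box
        kernel_form_box [OF f g step_kernel_add_box(2,1) step_adjoint_kernel [OF step_kernel_add_box(3)]]
        kernel_form_box [OF g f step_kernel_add_box(1-3)] star_add star_mult star_const kcnj_mult kcnj_kcnj
        step_kernel_add_box(4)
      by (simp add: mult.commute)
  qed
  define c where "c = (\<integral>s. norm (f s) \<partial>\<mu>) * (\<integral>s. norm (g s) \<partial>\<mu>)"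
  have "norm (kernel_form \<mu> (adjoint_kernel w) f g - star (kernel_form \<mu> w g f)) \<le> 0 + \<delta>"
    if \<delta>: "\<delta> > 0" for \<delta> :: real
  proof -
    define \<epsilon> where "\<epsilon> = \<delta> / 2 / (c + 1)"
    have c: "c \<ge> 0" by (simp add: c_def integral_nonneg_AE)
    have \<epsilon>: "\<epsilon> > 0" using c \<delta> unfolding \<epsilon>_def by (intro divide_pos_pos) auto
    obtain v where v: "step_kernel \<mu> v" "\<And>p. norm (w p - v p) \<le> \<epsilon>"
      using w \<epsilon> unfolding regulated_kernel_def by meson
    have "norm (adjoint_kernel w p - adjoint_kernel v p) \<le> \<epsilon>" for p
      using norm_star_le [of "w (snd p, fst p) - v (snd p, fst p)"] v(2) [of "(snd p, fst p)"]
      by (simp add: adjoint_kernel_def case_prod_unfold star_diff)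
    then have "norm (kernel_form \<mu> (adjoint_kernel w) f g - kernel_form \<mu> (adjoint_kernel v) f g) \<le> \<epsilon> * c"
      using kernel_form_norm_le [OF f g regulated_kernel_diff_step [OF regulated_adjoint_kernel [OF w]
            step_adjoint_kernel [OF v(1)]], of \<epsilon>]
        kernel_form_diff [OF f g regulated_adjoint_kernel [OF w] step_adjoint_kernel [OF v(1)]]
      by (simp add: c_def mult.assoc)
    moreover have "norm (star (kernel_form \<mu> w g f) - star (kernel_form \<mu> v g f)) \<le> \<epsilon> * c"
    proof -
      have "norm (star (kernel_form \<mu> w g f) - star (kernel_form \<mu> v g f)) \<le>
          norm (kernel_form \<mu> (\<lambda>p. w p - v p) g f)"
        unfolding star_diff [symmetric] kernel_form_diff [OF g f w v(1)] by (rule norm_star_le)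
      also have "\<dots> \<le> \<epsilon> * c"
        using kernel_form_norm_le [OF g f regulated_kernel_diff_step [OF w v(1)] v(2)]
        by (simp add: c_def mult_ac)
      finally show ?thesis .
    qed
    ultimately have "norm (kernel_form \<mu> (adjoint_kernel w) f g - star (kernel_form \<mu> w g f)) \<le> 2 * (\<epsilon> * c)"
      using norm_triangle_ineq4 [of "kernel_form \<mu> (adjoint_kernel w) f g - kernel_form \<mu> (adjoint_kernel v) f g"
          "star (kernel_form \<mu> w g f) - star (kernel_form \<mu> v g f)"] by (simp add: step [OF v(1)])
    also have "\<dots> \<le> 2 * (\<epsilon> * (c + 1))" using \<epsilon> by (intro mult_left_mono) auto
    also have "\<dots> = \<delta>"
    proof -
      have cancel: "x / d * d = x" if "d \<noteq> 0" for x d :: real using that by simp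
      have "\<epsilon> * (c + 1) = \<delta> / 2" unfolding \<epsilon>_def by (rule cancel) (use c in linarith)
      then show ?thesis by simp
    qed
    finally show ?thesis by simp
  qed
  then have "norm (kernel_form \<mu> (adjoint_kernel w) f g - star (kernel_form \<mu> w g f)) \<le> 0"
    by (rule field_le_epsilon)
  then show ?thesis by simp
qed

section \<open>The matrix of the integral operator\<close>

definition kernel_matrix ::
    "'s measure \<Rightarrow> 'i set \<Rightarrow> ('i \<Rightarrow> 's \<Rightarrow> 'k::real_or_complex) \<Rightarrow> ('s \<times> 's \<Rightarrow> 't::topological_space \<Rightarrow>\<^sub>C 'k)
      \<Rightarrow> 'i \<times> 'i \<Rightarrow> 't \<Rightarrow>\<^sub>C 'k"
  where "kernel_matrix \<mu> I h w = (\<lambda>(i, j). if i \<in> I \<and> j \<in> I then kernel_form \<mu> w (h j) (h i) else 0)"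

context finite_measure
begin

lemma bounded_Lsq:
  fixes k :: "'a \<Rightarrow> 'k::real_or_complex"
  assumes k: "k \<in> borel_measurable M" "\<And>s. norm (k s) \<le> C"
  shows "k \<in> Lsq M" "Lsq.nsq M k \<le> C\<^sup>2 * measure M (space M)"
proof -
  have le: "(norm (k s))\<^sup>2 \<le> C\<^sup>2" for s by (intro power_mono k) simp
  have "integrable M (\<lambda>s. (norm (k s))\<^sup>2)"
    by (rule integrable_const_bound [of _ "C\<^sup>2"]) (use k(1) le in auto)
  with k(1) show L: "k \<in> Lsq M" by (simp add: Lsq_iff)
  have "(\<integral>s. (norm (k s))\<^sup>2 \<partial>M) \<le> (\<integral>s. C\<^sup>2 \<partial>M)"
    using L le by (intro integral_mono) (auto simp: Lsq_iff)
  then show "Lsq.nsq M k \<le> C\<^sup>2 * measure M (space M)"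
    by (simp add: Lsq_nsq_eq [OF L] mult.commute)
qed

lemma Lsq_integrable: fixes f :: "'a \<Rightarrow> 'k::real_or_complex" assumes "f \<in> Lsq M" shows "integrable M f"
  using Lsq_prod_integrable [OF assms bounded_Lsq(1) [of "\<lambda>_. 1" 1]] by simp

text \<open>The Cauchy-Schwarz inequality for \<open>\<bar>f\<bar>\<close> and the constant function \<open>1\<close>.\<close>

lemma Lsq_integral_norm_le:
  fixes f :: "'a \<Rightarrow> 'k::real_or_complex"
  assumes f: "f \<in> Lsq M"
  shows "(\<integral>s. norm (f s) \<partial>M) \<le> sqrt (measure M (space M)) * sqrt (Lsq.nsq M f)"
proof -
  let ?g = "\<lambda>s. of_real (norm (f s)) :: 'k" and ?o = "\<lambda>s. 1 :: 'k"
  have g: "?g \<in> Lsq M" using f by (auto simp: Lsq_iff)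
  have o: "?o \<in> Lsq M" "Lsq.nsq M ?o \<le> 1\<^sup>2 * measure M (space M)"
    by (rule bounded_Lsq [of ?o 1]; simp)+
  have "Lsq_inner M ?g ?o = of_real (\<integral>s. norm (f s) \<partial>M)"
    unfolding Lsq_inner_def kcnj_one mult_1_right
    by (intro integral_bounded_linear bounded_linear_of_real integrable_norm Lsq_integrable [OF f])
  then have "(\<integral>s. norm (f s) \<partial>M)\<^sup>2 = (norm (Lsq_inner M ?g ?o))\<^sup>2" by simp
  also have "\<dots> \<le> Lsq.nsq M ?g * Lsq.nsq M ?o" by (rule Lsq.Cauchy_Schwarz [OF g o(1)])
  also have "Lsq.nsq M ?g = Lsq.nsq M f" by (simp add: Lsq_nsq_eq f g)
  also have "Lsq.nsq M f * Lsq.nsq M ?o \<le> Lsq.nsq M f * measure M (space M)"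
    using o(2) by (intro mult_left_mono) auto
  finally have "\<bar>\<integral>s. norm (f s) \<partial>M\<bar> \<le> sqrt (Lsq.nsq M f * measure M (space M))"
    by (rule real_le_rsqrt [of "\<bar>_\<bar>", unfolded power2_abs])
  then show ?thesis by (simp add: real_sqrt_mult mult.commute)
qed

text \<open>
  Bessel's inequality is used twice: for the function \<open>r \<mapsto> \<integral> w(r, s)(t) h\<^sub>j(s) d\<mu>(s)\<close> with fixed \<open>j\<close>, and,
  under the remaining integral over \<open>r\<close>, for the section \<open>w(r, \<cdot>)(t)\<close>, whose squared norm in \<open>L\<^sup>2(\<mu>)\<close>
  is at most \<open>C\<^sup>2 \<mu>(S)\<close>.
\<close>

lemma kernel_form_square_sum_le:
  fixes w :: "'a \<times> 'a \<Rightarrow> 't::topological_space \<Rightarrow>\<^sub>C 'k::real_or_complex"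
  assumes w: "regulated_kernel M w" "\<And>p. norm (w p) \<le> C"
    and P: "finite P" "Lsq.orthonormal_on M P h" and Q: "finite Q" "Lsq.orthonormal_on M Q h"
  shows "(\<Sum>j\<in>Q. \<Sum>i\<in>P. (norm (apply_bcontfun (kernel_form M w (h j) (h i)) t))\<^sup>2)
    \<le> (C * measure M (space M))\<^sup>2"
proof -
  have hP: "h i \<in> Lsq M" if "i \<in> P" for i using P(2) that by (simp add: Lsq.orthonormal_on_def)
  have hQ: "h j \<in> Lsq M" if "j \<in> Q" for j using Q(2) that by (simp add: Lsq.orthonormal_on_def)
  define K where "K j r = apply_bcontfun (kernel_map M w (h j) r) t" for j r
  have K: "K j \<in> Lsq M" if j: "j \<in> Q" for j
  proof (rule bounded_Lsq)
    have hj: "integrable M (h j)" by (rule Lsq_integrable [OF hQ [OF j]])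
    show "K j \<in> borel_measurable M"
      unfolding K_def by (rule regulated_measurable [OF kernel_map_regulated [OF w(1) hj]])
    show "norm (K j r) \<le> C * (\<integral>s. norm (h j s) \<partial>M)" for r
      unfolding K_def using norm_bounded kernel_map_norm_le [OF w(1) hj w(2)] by (rule order_trans)
  qed
  have "(\<Sum>j\<in>Q. \<Sum>i\<in>P. (norm (apply_bcontfun (kernel_form M w (h j) (h i)) t))\<^sup>2) =
      (\<Sum>j\<in>Q. \<Sum>i\<in>P. (norm (Lsq_inner M (K j) (h i)))\<^sup>2)"
    by (intro sum.cong refl)
       (simp add: kernel_form_apply Lsq_integrable hP hQ w(1) Lsq_inner_def K_def)
  also have "\<dots> \<le> (\<Sum>j\<in>Q. Lsq.nsq M (K j))"
    by (intro sum_mono Lsq.Bessel P K)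
  also have "\<dots> = (\<integral>r. (\<Sum>j\<in>Q. (norm (K j r))\<^sup>2) \<partial>M)"
    using K by (subst Bochner_Integration.integral_sum) (auto simp: Lsq_iff Lsq_nsq_eq)
  also have "\<dots> \<le> (\<integral>r. C\<^sup>2 * measure M (space M) \<partial>M)"
  proof (rule integral_mono)
    show "integrable M (\<lambda>r. \<Sum>j\<in>Q. (norm (K j r))\<^sup>2)" using K by (auto simp: Lsq_iff)
    fix r
    define k where "k s = apply_bcontfun (w (r, s)) t" for s
    have k: "(\<lambda>s. kcnj (k s)) \<in> Lsq M" "Lsq.nsq M (\<lambda>s. kcnj (k s)) \<le> C\<^sup>2 * measure M (space M)"
    proof -
      have "(\<lambda>s. kcnj (k s)) \<in> borel_measurable M"
        unfolding k_def by (intro borel_measurable_kcnj regulated_measurable regulated_kernel_section w)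
      moreover have "norm (kcnj (k s)) \<le> C" for s
        unfolding k_def norm_kcnj using norm_bounded w(2) by (rule order_trans)
      ultimately show "(\<lambda>s. kcnj (k s)) \<in> Lsq M" "Lsq.nsq M (\<lambda>s. kcnj (k s)) \<le> C\<^sup>2 * measure M (space M)"
        by (rule bounded_Lsq)+
    qed
    have "norm (K j r) = norm (Lsq_inner M (\<lambda>s. kcnj (k s)) (h j))" if j: "j \<in> Q" for j
    proof -
      have "K j r = kcnj (Lsq_inner M (\<lambda>s. kcnj (k s)) (h j))"
        unfolding K_def kernel_map_apply [OF w(1) Lsq_integrable [OF hQ [OF j]]] Lsq_inner_def
          integral_kcnj [symmetric] kcnj_mult kcnj_kcnj k_def ..
      then show ?thesis by simp
    qed
    then have "(\<Sum>j\<in>Q. (norm (K j r))\<^sup>2) = (\<Sum>j\<in>Q. (norm (Lsq_inner M (\<lambda>s. kcnj (k s)) (h j)))\<^sup>2)"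
      by simp
    also have "\<dots> \<le> Lsq.nsq M (\<lambda>s. kcnj (k s))" by (rule Lsq.Bessel [OF Q(2,1) k(1)])
    also note k(2)
    finally show "(\<Sum>j\<in>Q. (norm (K j r))\<^sup>2) \<le> C\<^sup>2 * measure M (space M)" .
  qed simp
  also have "\<dots> = (C * measure M (space M))\<^sup>2" by (simp add: power2_eq_square)
  finally show ?thesis .
qed

context
  fixes I :: "'i set" and h :: "'i \<Rightarrow> 'a \<Rightarrow> 'k::real_or_complex"
  assumes h: "orthonormal_basis M I h"
begin

lemma basis_Lsq: "i \<in> I \<Longrightarrow> h i \<in> Lsq M"
  using h by (simp add: orthonormal_basis_def)

lemma coordinates_l2:
  assumes f: "f \<in> Lsq M" shows "(\<lambda>i. if i \<in> I then Lsq_inner M f (h i) else 0) \<in> l2 I"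
proof (rule l2I)
  fix F assume F: "finite F" "F \<subseteq> I"
  have "(\<Sum>i\<in>F. (norm (if i \<in> I then Lsq_inner M f (h i) else 0))\<^sup>2) = (\<Sum>i\<in>F. (norm (Lsq_inner M f (h i)))\<^sup>2)"
    using F by (intro sum.cong) auto
  also have "\<dots> \<le> Lsq.nsq M f"
    by (rule Lsq.Bessel [OF orthonormal_basis_orthonormal [OF h F(2)] F(1) f])
  finally show "(\<Sum>i\<in>F. (norm (if i \<in> I then Lsq_inner M f (h i) else 0))\<^sup>2) \<le> Lsq.nsq M f" .
qed simp

lemma indicator_Lsq: "A \<in> sets M \<Longrightarrow> (\<lambda>s. of_real (indicat_real A s) :: 'k) \<in> Lsq M"
  by (rule bounded_Lsq(1) [of _ 1]) (auto simp: indicator_def)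

text \<open>
  The indicator of a box contributes the tensor product of the coordinates of two indicator
  functions, which are square-summable by Bessel's inequality.
\<close>

lemma step_kernel_matrix_Hmod:
  fixes v :: "'a \<times> 'a \<Rightarrow> 't::topological_space \<Rightarrow>\<^sub>C 'k"
  assumes "step_kernel M v" shows "kernel_matrix M I h v \<in> Hmod (I \<times> I)"
  using assms
proof (induction rule: step_kernel.induct)
  case step_kernel_zero
  have "kernel_matrix M I h (\<lambda>p. 0 :: 't \<Rightarrow>\<^sub>C 'k) = 0"
    by (rule ext) (simp add: kernel_matrix_def case_prod_unfold kernel_form_zero Lsq_integrable basis_Lsq)
  then show ?case by (simp only: zero_Hmod)
next
  case (step_kernel_add_box A B v x)
  let ?a = "\<lambda>i. if i \<in> I then Lsq_inner M (\<lambda>s. of_real (indicat_real A s)) (h i) else 0"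
  let ?b = "\<lambda>j. if j \<in> I then Lsq_inner M (\<lambda>s. of_real (indicat_real B s)) (h j) else 0"
  let ?T = "\<lambda>(i, j). ?a i * kcnj (?b j)"
  have "?T \<in> l2 (I \<times> I)"
    by (intro l2_tensor kcnj_l2 coordinates_l2 indicator_Lsq step_kernel_add_box)
  then have T: "(\<lambda>p. x * psi ?T p) \<in> Hmod (I \<times> I)" by (intro Hmod_mult psi_Hmod)
  have eq: "kernel_matrix M I h (\<lambda>p. v p + (indicat_real A (fst p) * indicat_real B (snd p)) *\<^sub>R x) =
      kernel_matrix M I h v + (\<lambda>p. x * psi ?T p)"
  proof
    fix p
    obtain i j :: 'i where p: "p = (i, j)" by (cases p)
    show "kernel_matrix M I h (\<lambda>p. v p + (indicat_real A (fst p) * indicat_real B (snd p)) *\<^sub>R x) p =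
        (kernel_matrix M I h v + (\<lambda>p. x * psi ?T p)) p"
    proof (cases "i \<in> I \<and> j \<in> I")
      case True
      have "kcnj (\<integral>s. of_real (indicat_real A s) * h i s \<partial>M) = Lsq_inner M (\<lambda>s. of_real (indicat_real A s)) (h i)"
        by (simp add: Lsq_inner_def kcnj_mult flip: integral_kcnj)
      moreover have "(\<integral>s. of_real (indicat_real B s) * h j s \<partial>M) = kcnj (Lsq_inner M (\<lambda>s. of_real (indicat_real B s)) (h j))"
        by (simp add: Lsq_inner_def kcnj_mult kcnj_kcnj flip: integral_kcnj)
      ultimately show ?thesis
        using True kernel_form_box [OF Lsq_integrable [OF basis_Lsq] Lsq_integrable [OF basis_Lsq] step_kernel_add_box(1-3)]
        by (simp add: p kernel_matrix_def psi_def)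
    qed (auto simp: p kernel_matrix_def psi_def)
  qed
  show ?case unfolding eq by (rule Hmod_add [OF step_kernel_add_box(4) T])
qed

text \<open>
  The square sums of the entries are controlled by the supremum norm of the kernel, so the matrix is a
  limit of matrices of step kernels in the norm of the Hilbert module.
\<close>

lemma kernel_matrix_Hmod:
  fixes w :: "'a \<times> 'a \<Rightarrow> 't::topological_space \<Rightarrow>\<^sub>C 'k"
  assumes w: "regulated_kernel M w" shows "kernel_matrix M I h w \<in> Hmod (I \<times> I)"
proof (rule Hmod_limit)
  show "p \<notin> I \<times> I \<Longrightarrow> kernel_matrix M I h w p = 0" for p
    by (auto simp: kernel_matrix_def split: prod.splits)
  fix \<epsilon> :: real assume \<epsilon>: "\<epsilon> > 0"
  \<comment> \<open>the summand \<open>1\<close> covers the case of measure \<open>0\<close>\<close>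
  define \<delta> where "\<delta> = sqrt \<epsilon> / (measure M (space M) + 1)"
  have \<delta>: "\<delta> > 0" using \<epsilon> unfolding \<delta>_def by (intro divide_pos_pos) (auto simp: add_nonneg_pos)
  obtain v where v: "step_kernel M v" "\<And>p. norm (w p - v p) \<le> \<delta>"
    using w \<delta> unfolding regulated_kernel_def by meson
  have *: "(\<Sum>p\<in>F. (norm (psi_at t (kernel_matrix M I h w - kernel_matrix M I h v) p))\<^sup>2) \<le> \<epsilon>"
    if F: "finite F" "F \<subseteq> I \<times> I" for t F
  proof -
    let ?c = "\<lambda>i j. (norm (apply_bcontfun (kernel_form M (\<lambda>p. w p - v p) (h j) (h i)) t))\<^sup>2"
    let ?P = "fst ` F" and ?Q = "snd ` F"
    have PQ: "?P \<subseteq> I" "?Q \<subseteq> I" "F \<subseteq> ?P \<times> ?Q" using F(2) by force+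
    have "(\<Sum>p\<in>F. (norm (psi_at t (kernel_matrix M I h w - kernel_matrix M I h v) p))\<^sup>2) =
        (\<Sum>(i, j)\<in>F. ?c i j)"
    proof (rule sum.cong [OF refl])
      fix p assume "p \<in> F"
      then obtain i j where p: "p = (i, j)" "i \<in> I" "j \<in> I" using F(2) by auto
      have "kernel_form M (\<lambda>p. w p - v p) (h j) (h i) = kernel_form M w (h j) (h i) - kernel_form M v (h j) (h i)"
        by (rule kernel_form_diff [OF Lsq_integrable [OF basis_Lsq [OF p(3)]] Lsq_integrable [OF basis_Lsq [OF p(2)]] w v(1)])
      then show "(norm (psi_at t (kernel_matrix M I h w - kernel_matrix M I h v) p))\<^sup>2 = (case p of (i, j) \<Rightarrow> ?c i j)"
        using p by (simp add: psi_at_def kernel_matrix_def)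
    qed
    also have "\<dots> \<le> (\<Sum>(i, j)\<in>?P \<times> ?Q. ?c i j)"
      using F(1) PQ(3) by (intro sum_mono2) auto
    also have "\<dots> = (\<Sum>j\<in>?Q. \<Sum>i\<in>?P. ?c i j)"
      by (subst sum.swap) (simp add: sum.cartesian_product)
    also have "\<dots> \<le> (\<delta> * measure M (space M))\<^sup>2"
      using F(1) PQ(1,2)
      by (intro kernel_form_square_sum_le regulated_kernel_diff_step w v orthonormal_basis_orthonormal [OF h]) auto
    also have "\<dots> \<le> (\<delta> * (measure M (space M) + 1))\<^sup>2"
      using \<delta> by (intro power_mono mult_left_mono) auto
    also have "\<delta> * (measure M (space M) + 1) = sqrt \<epsilon>"
      using measure_nonneg [of M "space M"] by (simp add: \<delta>_def add_nonneg_eq_0_iff)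
    also have "(sqrt \<epsilon>)\<^sup>2 = \<epsilon>" using \<epsilon> by simp
    finally show ?thesis .
  qed
  show "\<exists>\<eta>\<in>Hmod (I \<times> I). \<forall>t F. finite F \<and> F \<subseteq> I \<times> I \<longrightarrow>
      (\<Sum>p\<in>F. (norm (psi_at t (kernel_matrix M I h w - \<eta>) p))\<^sup>2) \<le> \<epsilon>"
    by (intro bexI [of _ "kernel_matrix M I h v"] step_kernel_matrix_Hmod v(1) allI impI) (elim conjE, rule *)
qed

lemma kernel_matrix_adjoint:
  assumes w: "regulated_kernel M w"
  shows "kernel_matrix M I h (adjoint_kernel w) = star_transpose (kernel_matrix M I h w)"
proof
  fix p
  obtain i j :: 'i where p: "p = (i, j)" by (cases p)
  show "kernel_matrix M I h (adjoint_kernel w) p = star_transpose (kernel_matrix M I h w) p"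
    using kernel_form_adjoint [OF w Lsq_integrable [OF basis_Lsq] Lsq_integrable [OF basis_Lsq], of j i]
    by (auto simp: p kernel_matrix_def star_transpose_def)
qed

end

end


section \<open>Identification of the integral operator\<close>

context finite_measure
begin

context
  fixes I :: "'i set" and h :: "'i \<Rightarrow> 'a \<Rightarrow> 'k::real_or_complex"
  assumes h: "orthonormal_basis M I h"
begin

text \<open>
  The form is a bounded linear functional of its first argument, so it is determined by the
  expansion of that argument in the basis.
\<close>

lemma kernel_form_expansion:
  fixes w :: "'a \<times> 'a \<Rightarrow> 't::topological_space \<Rightarrow>\<^sub>C 'k"
  assumes w: "regulated_kernel M w" and f: "f \<in> Lsq M" and g: "g \<in> Lsq M"
  shows "((\<lambda>j. apply_bcontfun (kernel_form M w (h j) g) t * Lsq_inner M f (h j)) has_sum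
    apply_bcontfun (kernel_form M w f g) t) I"
  unfolding has_sum_metric
proof (intro allI impI)
  fix e :: real assume e: "e > 0"
  obtain C where C: "\<And>p. norm (w p) \<le> C" using regulated_kernel_bounded [OF w] by blast
  have C0: "C \<ge> 0" using C norm_ge_zero order_trans by blast
  let ?L = "\<lambda>f. apply_bcontfun (kernel_form M w f g) t"
  have gi: "integrable M g" by (rule Lsq_integrable [OF g])
  have bound: "norm (?L u) \<le> C * sqrt (measure M (space M)) * (\<integral>s. norm (g s) \<partial>M) * sqrt (Lsq.nsq M u)"
    if u: "u \<in> Lsq M" for u
  proof -
    have "norm (?L u) \<le> norm (kernel_form M w u g)" by (rule norm_bounded)
    also have "\<dots> \<le> C * (\<integral>s. norm (u s) \<partial>M) * (\<integral>s. norm (g s) \<partial>M)"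
      by (rule kernel_form_norm_le [OF Lsq_integrable [OF u] gi w C])
    also have "\<dots> \<le> C * (sqrt (measure M (space M)) * sqrt (Lsq.nsq M u)) * (\<integral>s. norm (g s) \<partial>M)"
      using C0 by (intro mult_right_mono mult_left_mono Lsq_integral_norm_le [OF u] integral_nonneg_AE) auto
    finally show ?thesis by (simp add: mult_ac)
  qed
  have lin: "?L (\<lambda>s. u s - c * u' s) = ?L u - c * ?L u'" if u: "u \<in> Lsq M" "u' \<in> Lsq M" for u u' c
  proof -
    have ui: "integrable M u" "integrable M u'" "integrable M (\<lambda>s. u s - c * u' s)"
      using Lsq_integrable [OF u(1)] Lsq_integrable [OF u(2)] by auto
    have km: "apply_bcontfun (kernel_map M w (\<lambda>s. u s - c * u' s) r) t =
        apply_bcontfun (kernel_map M w u r) t - c * apply_bcontfun (kernel_map M w u' r) t" for r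
    proof -
      let ?k = "\<lambda>s. apply_bcontfun (w (r, s)) t"
      have i: "integrable M (\<lambda>s. ?k s * u s)" "integrable M (\<lambda>s. ?k s * u' s)"
        using ui by (intro regulated_prod_integrable regulated_kernel_section w; simp)+
      have "(\<integral>s. ?k s * (u s - c * u' s) \<partial>M) = (\<integral>s. ?k s * u s - c * (?k s * u' s) \<partial>M)"
        by (intro Bochner_Integration.integral_cong) (simp_all add: algebra_simps)
      also have "\<dots> = (\<integral>s. ?k s * u s \<partial>M) - c * (\<integral>s. ?k s * u' s \<partial>M)" using i by simp
      finally show ?thesis by (simp add: kernel_map_apply w ui)
    qed
    have "?L (\<lambda>s. u s - c * u' s) = (\<integral>r. apply_bcontfun (kernel_map M w u r) t * kcnj (g r) -
        c * (apply_bcontfun (kernel_map M w u' r) t * kcnj (g r)) \<partial>M)"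
      unfolding kernel_form_apply [OF ui(3) gi w] km
      by (intro Bochner_Integration.integral_cong) (simp_all add: algebra_simps)
    also have "\<dots> = ?L u - c * ?L u'"
      unfolding kernel_form_apply [OF ui(1) gi w] kernel_form_apply [OF ui(2) gi w]
      using regulated_prod_integrable [OF kernel_map_regulated [OF w ui(1)] integrable_kcnj [OF gi]]
        regulated_prod_integrable [OF kernel_map_regulated [OF w ui(2)] integrable_kcnj [OF gi]] by simp
    finally show ?thesis .
  qed
  have expand: "?L (f - Lsq.combination K (\<lambda>j. Lsq_inner M f (h j)) h) =
      ?L f - (\<Sum>j\<in>K. ?L (h j) * Lsq_inner M f (h j))" if "finite K" "K \<subseteq> I" for K
    using that
  proof (induction K)
    case empty
    have "Lsq.combination {} (\<lambda>j. Lsq_inner M f (h j)) h = 0" unfolding Lsq.combination_def by (rule sum.empty)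
    then show ?case by simp
  next
    case (insert k K)
    let ?u = "f - Lsq.combination K (\<lambda>j. Lsq_inner M f (h j)) h"
    have u: "?u \<in> Lsq M"
      using insert.prems
      by (intro Lsq.diff_mem f Lsq.combination_mem orthonormal_basis_orthonormal [OF h]) auto
    have "f - Lsq.combination (insert k K) (\<lambda>j. Lsq_inner M f (h j)) h =
        (\<lambda>s. ?u s - Lsq_inner M f (h k) * h k s)"
      by (rule ext) (simp add: Lsq.combination_def sum_fun_apply insert.hyps)
    then have "?L (f - Lsq.combination (insert k K) (\<lambda>j. Lsq_inner M f (h j)) h) =
        ?L ?u - Lsq_inner M f (h k) * ?L (h k)"
      using lin [OF u basis_Lsq [OF h]] insert.prems by simp
    also have "?L ?u = ?L f - (\<Sum>j\<in>K. ?L (h j) * Lsq_inner M f (h j))"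
      by (rule insert.IH) (use insert.prems in simp)
    finally show ?case unfolding sum.insert [OF insert.hyps] by simp
  qed
  define c where "c = C * sqrt (measure M (space M)) * (\<integral>s. norm (g s) \<partial>M)"
  have c: "c \<ge> 0" unfolding c_def using C0 by (simp add: integral_nonneg_AE)
  have "e / 2 / (c + 1) > 0" using e c by simp
  then obtain J where J: "finite J" "J \<subseteq> I" "\<And>K. finite K \<Longrightarrow> J \<subseteq> K \<Longrightarrow> K \<subseteq> I \<Longrightarrow>
      sqrt (Lsq.nsq M (f - Lsq.combination K (\<lambda>j. Lsq_inner M f (h j)) h)) \<le> e / 2 / (c + 1)"
    using orthonormal_basis_approx [OF h f] by meson
  have *: "dist (\<Sum>j\<in>K. ?L (h j) * Lsq_inner M f (h j)) (?L f) < e"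
    if K: "finite K" "J \<subseteq> K" "K \<subseteq> I" for K
  proof -
    let ?u = "f - Lsq.combination K (\<lambda>j. Lsq_inner M f (h j)) h"
    have u: "?u \<in> Lsq M"
      by (intro Lsq.diff_mem f Lsq.combination_mem orthonormal_basis_orthonormal [OF h K(3)])
    have "dist (\<Sum>j\<in>K. ?L (h j) * Lsq_inner M f (h j)) (?L f) = norm (?L ?u)"
      unfolding expand [OF K(1,3)] by (simp add: dist_norm norm_minus_commute)
    also have "\<dots> \<le> c * sqrt (Lsq.nsq M ?u)" using bound [OF u] by (simp add: c_def)
    also have "\<dots> \<le> c * (e / 2 / (c + 1))" by (rule mult_left_mono [OF J(3) [OF K] c])
    also have "\<dots> \<le> (c + 1) * (e / 2 / (c + 1))" using e c by (intro mult_right_mono) auto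
    also have "\<dots> = e / 2"
    proof -
      have cancel: "d * (x / d) = x" if "d \<noteq> 0" for x d :: real using that by simp
      show ?thesis by (rule cancel) (use c in linarith)
    qed
    also have "\<dots> < e" using e by simp
    finally show ?thesis .
  qed
  show "\<exists>X. finite X \<and> X \<subseteq> I \<and> (\<forall>Y. finite Y \<and> X \<subseteq> Y \<and> Y \<subseteq> I \<longrightarrow>
      dist (\<Sum>j\<in>Y. ?L (h j) * Lsq_inner M f (h j)) (?L f) < e)"
    by (intro exI [of _ J] conjI allI impI J(1,2)) (elim conjE, rule *)
qed

lemma tensor_coords_Hmod: assumes "f \<in> Lsq M" shows "tensor_coords M I h f x \<in> Hmod I"
proof -
  have "tensor_coords M I h f x = (\<lambda>i. x * psi (\<lambda>i. if i \<in> I then Lsq_inner M f (h i) else 0) i)"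
    by (rule ext) (simp add: tensor_coords_def psi_def mult.commute)
  then show ?thesis by (simp only: Hmod_mult psi_Hmod coordinates_l2 [OF h assms])
qed

lemma continuous_coords_apply:
  fixes w :: "'a \<times> 'a \<Rightarrow> 't::topological_space \<Rightarrow>\<^sub>C 'k"
  assumes w: "regulated_kernel M w" and f: "f \<in> Lsq M" and i: "i \<in> I"
  shows "apply_bcontfun (continuous_coords M I h (\<lambda>r. kernel_map M w f r * x) i) t =
    apply_bcontfun (kernel_form M w f (h i)) t * apply_bcontfun x t"
proof -
  have fi: "integrable M f" "integrable M (h i)" by (intro Lsq_integrable f basis_Lsq [OF h i])+
  have K: "regulated M (kernel_map M w f)" by (rule kernel_map_regulated [OF w fi(1)])
  have "bounded_linear (\<lambda>y. y * x)" by (rule bounded_linear_mult_left)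
  then have Kx: "regulated M (\<lambda>r. kernel_map M w f r * x)" by (rule regulated_linear [OF _ K])
  have "apply_bcontfun (continuous_coords M I h (\<lambda>r. kernel_map M w f r * x) i) t =
      (\<integral>r. apply_bcontfun (kernel_map M w f r * x) t * kcnj (h i r) \<partial>M)"
    using i weighted_integral_apply [OF Kx integrable_kcnj [OF fi(2)], of t]
    by (simp add: continuous_coords_def weighted_integral_def)
  also have "\<dots> = (\<integral>r. (apply_bcontfun (kernel_map M w f r) t * kcnj (h i r)) * apply_bcontfun x t \<partial>M)"
    by (intro Bochner_Integration.integral_cong) (simp_all add: bcontfun_apply mult_ac)
  finally show ?thesis by (simp add: kernel_form_apply [OF fi w])
qed

text \<open>The expansion of \<open>f\<close> in the basis is summed by the rows of the matrix.\<close>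

lemma kernel_matrix_tensor_coords:
  fixes w :: "'a \<times> 'a \<Rightarrow> 't::topological_space \<Rightarrow>\<^sub>C 'k"
  assumes w: "regulated_kernel M w" and f: "f \<in> Lsq M"
  shows "mat_op I (kernel_matrix M I h w) (tensor_coords M I h f x) =
    continuous_coords M I h (\<lambda>r. kernel_map M w f r * x)"
proof (rule psi_at_eqI, rule ext)
  fix t i
  let ?a = "kernel_matrix M I h w"
  have a: "?a \<in> Hmod (I \<times> I)" by (rule kernel_matrix_Hmod [OF h w])
  show "psi_at t (mat_op I ?a (tensor_coords M I h f x)) i =
      psi_at t (continuous_coords M I h (\<lambda>r. kernel_map M w f r * x)) i"
  proof (cases "i \<in> I")
    case True
    have "((\<lambda>j. apply_bcontfun (kernel_form M w (h j) (h i)) t * Lsq_inner M f (h j) * apply_bcontfun x t) has_sum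
        apply_bcontfun (kernel_form M w f (h i)) t * apply_bcontfun x t) I"
      by (rule has_sum_cmult_left [OF kernel_form_expansion [OF w f basis_Lsq [OF h True]]])
    moreover have "((\<lambda>j. apply_bcontfun (kernel_form M w (h j) (h i)) t * Lsq_inner M f (h j) * apply_bcontfun x t) has_sum
        apply_bcontfun (kernel_form M w f (h i)) t * apply_bcontfun x t) I \<longleftrightarrow>
        ((\<lambda>j. psi_at t ?a (i, j) * psi_at t (tensor_coords M I h f x) j) has_sum
        apply_bcontfun (kernel_form M w f (h i)) t * apply_bcontfun x t) I"
      using True by (intro has_sum_cong)
        (simp add: psi_at_def kernel_matrix_def tensor_coords_def bcontfun_apply mult_ac)
    ultimately have "mat_op I (psi_at t ?a) (psi_at t (tensor_coords M I h f x)) i =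
        apply_bcontfun (kernel_form M w f (h i)) t * apply_bcontfun x t"
      using True by (simp add: mat_op_def infsumI)
    moreover have "psi_at t (continuous_coords M I h (\<lambda>r. kernel_map M w f r * x)) i =
        apply_bcontfun (kernel_form M w f (h i)) t * apply_bcontfun x t"
      unfolding psi_at_def by (rule continuous_coords_apply [OF w f True])
    ultimately show ?thesis by (simp add: mat_op_apply [OF a tensor_coords_Hmod [OF f]])
  next
    case False
    then show ?thesis by (simp add: psi_at_def mat_op_def continuous_coords_def)
  qed
qed

end

end

lemma psi_at_Hscale: "psi_at t (Hscale c \<xi>) = fscale c (psi_at t \<xi>)"
  by (rule ext) (simp add: psi_at_def Hscale_def bcontfun_apply)

lemma Hscale_Hmod: "\<xi> \<in> Hmod I \<Longrightarrow> Hscale c \<xi> \<in> Hmod I"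
  unfolding Hscale_def by (rule Hmod_mult)

lemma Hmod_component_le: assumes "\<xi> \<in> Hmod I" shows "norm (\<xi> i) \<le> Hnorm I \<xi>"
proof (rule norm_bound)
  fix t
  have "(norm (psi_at t \<xi> i))\<^sup>2 \<le> l2.nsq I (psi_at t \<xi>)" by (rule l2_component_le [OF psi_at_l2 [OF assms]])
  also have "\<dots> \<le> (Hnorm I \<xi>)\<^sup>2" by (rule nsq_le_Hnorm [OF assms])
  finally show "norm (apply_bcontfun (\<xi> i) t) \<le> Hnorm I \<xi>"
    unfolding psi_at_def by (rule power2_le_imp_le) (rule Hnorm_nonneg)
qed

text \<open>
  The families with finite support are sums of families with a single nonzero entry \<open>x\<close>, which
  represent the elementary tensors \<open>h\<^sub>i \<otimes> x\<close>, and they are dense.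
\<close>

lemma bounded_additive_unique:
  fixes W W' :: "('i \<Rightarrow> 't::topological_space \<Rightarrow>\<^sub>C 'k::real_or_complex) \<Rightarrow> 'i \<Rightarrow> 't \<Rightarrow>\<^sub>C 'k"
  assumes W: "W \<in> Hmod I \<rightarrow>\<^sub>E Hmod I" "W' \<in> Hmod I \<rightarrow>\<^sub>E Hmod I"
    and add: "\<And>\<xi> \<eta>. \<xi> \<in> Hmod I \<Longrightarrow> \<eta> \<in> Hmod I \<Longrightarrow> W (\<xi> + \<eta>) = W \<xi> + W \<eta>"
      "\<And>\<xi> \<eta>. \<xi> \<in> Hmod I \<Longrightarrow> \<eta> \<in> Hmod I \<Longrightarrow> W' (\<xi> + \<eta>) = W' \<xi> + W' \<eta>"
    and bound: "\<And>\<xi>. \<xi> \<in> Hmod I \<Longrightarrow> Hnorm I (W \<xi>) \<le> C * Hnorm I \<xi>"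
      "\<And>\<xi>. \<xi> \<in> Hmod I \<Longrightarrow> Hnorm I (W' \<xi>) \<le> C' * Hnorm I \<xi>"
    and eq: "\<And>i x. i \<in> I \<Longrightarrow> W (\<lambda>j. if j = i then x else 0) = W' (\<lambda>j. if j = i then x else 0)"
  shows "W = W'"
proof (rule PiE_ext [OF W])
  fix \<xi> :: "'i \<Rightarrow> 't \<Rightarrow>\<^sub>C 'k" assume \<xi>: "\<xi> \<in> Hmod I"
  have trunc: "W (truncation F \<xi>) = W' (truncation F \<xi>)" if "finite F" "F \<subseteq> I" for F
    using that
  proof (induction F)
    case empty
    have "truncation {} \<xi> = 0" by (rule ext) (simp add: truncation_def)
    moreover have "W 0 = 0" "W' 0 = 0"
      using add(1) [OF zero_Hmod zero_Hmod] add(2) [OF zero_Hmod zero_Hmod] by (simp_all only: add_0 add_cancel_right_right)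
    ultimately show ?case by (simp only:)
  next
    case (insert i F)
    let ?e = "\<lambda>j. if j = i then \<xi> i else 0"
    have e: "?e \<in> Hmod I" using insert.prems by (intro Hmod_finite_support [of "{i}"]) auto
    have F: "truncation F \<xi> \<in> Hmod I" using insert by (intro truncation_Hmod) auto
    have "truncation (insert i F) \<xi> = truncation F \<xi> + ?e"
      using insert.hyps by (intro ext) (auto simp: truncation_def)
    then show ?case
      using insert eq [of i "\<xi> i"] by (simp only: add(1) [OF F e] add(2) [OF F e]) auto
  qed
  show "W \<xi> = W' \<xi>"
  proof
    fix i
    have "norm (W \<xi> i - W' \<xi> i) \<le> 0 + \<delta>" if \<delta>: "\<delta> > 0" for \<delta> :: real
    proof -
      define \<epsilon> where "\<epsilon> = \<delta> / (\<bar>C\<bar> + \<bar>C'\<bar> + 1)"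
      have \<epsilon>: "\<epsilon> > 0" using \<delta> unfolding \<epsilon>_def by (intro divide_pos_pos) auto
      obtain F where F: "finite F" "F \<subseteq> I" "\<And>t. l2.nsq I (psi_at t (\<xi> - truncation F \<xi>)) \<le> \<epsilon>\<^sup>2"
        using Hmod_truncation_approx [OF \<xi>, of "\<epsilon>\<^sup>2"] \<epsilon> by auto
      let ?\<eta> = "\<xi> - truncation F \<xi>"
      have t: "truncation F \<xi> \<in> Hmod I" by (rule truncation_Hmod [OF F(1,2)])
      have \<eta>: "?\<eta> \<in> Hmod I" by (rule Hmod_diff [OF \<xi> t])
      have n: "Hnorm I ?\<eta> \<le> \<epsilon>" using \<epsilon> F(3) by (intro Hnorm_leI [OF \<eta>]) auto
      have small: "norm (V ?\<eta> i) \<le> \<bar>B\<bar> * \<epsilon>"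
        if V: "V ?\<eta> \<in> Hmod I" "Hnorm I (V ?\<eta>) \<le> B * Hnorm I ?\<eta>" for V :: "_ \<Rightarrow> 'i \<Rightarrow> 't \<Rightarrow>\<^sub>C 'k" and B
      proof -
        have "norm (V ?\<eta> i) \<le> Hnorm I (V ?\<eta>)" by (rule Hmod_component_le [OF V(1)])
        also note V(2)
        also have "B * Hnorm I ?\<eta> \<le> \<bar>B\<bar> * \<epsilon>" using n by (intro mult_mono) (auto simp: Hnorm_nonneg)
        finally show ?thesis .
      qed
      have "norm (W ?\<eta> i) \<le> \<bar>C\<bar> * \<epsilon>" "norm (W' ?\<eta> i) \<le> \<bar>C'\<bar> * \<epsilon>"
        using W \<eta> by (auto intro!: small bound)
      then have "norm (W ?\<eta> i) + norm (W' ?\<eta> i) \<le> \<bar>C\<bar> * \<epsilon> + \<bar>C'\<bar> * \<epsilon>" by (rule add_mono)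
      moreover have "W \<xi> = W (truncation F \<xi>) + W ?\<eta>" "W' \<xi> = W' (truncation F \<xi>) + W' ?\<eta>"
        using add(1) [OF t \<eta>] add(2) [OF t \<eta>] by simp_all
      then have eq: "W \<xi> i - W' \<xi> i = W ?\<eta> i - W' ?\<eta> i" by (simp add: trunc [OF F(1,2)])
      have "norm (W \<xi> i - W' \<xi> i) \<le> norm (W ?\<eta> i) + norm (W' ?\<eta> i)"
        unfolding eq by (rule norm_triangle_ineq4)
      ultimately have "norm (W \<xi> i - W' \<xi> i) \<le> \<bar>C\<bar> * \<epsilon> + \<bar>C'\<bar> * \<epsilon>" by simp
      also have "\<dots> \<le> (\<bar>C\<bar> + \<bar>C'\<bar> + 1) * \<epsilon>" using \<epsilon> by (simp add: distrib_right)
      also have "\<dots> = \<delta>" by (simp add: \<epsilon>_def add_nonneg_eq_0_iff)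
      finally show ?thesis by simp
    qed
    then have "norm (W \<xi> i - W' \<xi> i) \<le> 0" by (rule field_le_epsilon)
    then show "W \<xi> i = W' \<xi> i" by simp
  qed
qed

lemma (in finite_measure) integral_op_eq_matrix_operator:
  fixes h :: "'i \<Rightarrow> 'a \<Rightarrow> 'k::real_or_complex" and w :: "'a \<times> 'a \<Rightarrow> 't::topological_space \<Rightarrow>\<^sub>C 'k"
  assumes h: "orthonormal_basis M I h" and w: "regulated_kernel M w"
  shows "integral_op M I h w = matrix_operator I (kernel_matrix M I h w)"
proof -
  let ?a = "kernel_matrix M I h w"
  let ?W = "matrix_operator I ?a"
  have a: "?a \<in> Hmod (I \<times> I)" by (rule kernel_matrix_Hmod [OF h w])
  have W: "?W \<in> Hmod I \<rightarrow>\<^sub>E Hmod I"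
    using mat_op_Hmod [OF a] by (simp add: matrix_operator_def)
  have add: "?W (\<xi> + \<eta>) = ?W \<xi> + ?W \<eta>" if "\<xi> \<in> Hmod I" "\<eta> \<in> Hmod I" for \<xi> \<eta>
  proof (rule psi_at_eqI)
    show "psi_at t (?W (\<xi> + \<eta>)) = psi_at t (?W \<xi> + ?W \<eta>)" for t
      using that mat_op_add [OF psi_at_l2 [OF a] psi_at_l2 [OF that(1)] psi_at_l2 [OF that(2)]]
      by (simp only: matrix_operator_def restrict_apply' Hmod_add psi_at_plus mat_op_apply [OF a])
  qed
  have scale: "?W (Hscale c \<xi>) = Hscale c (?W \<xi>)" if "\<xi> \<in> Hmod I" for c \<xi>
  proof (rule psi_at_eqI)
    show "psi_at t (?W (Hscale c \<xi>)) = psi_at t (Hscale c (?W \<xi>))" for t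
      using that mat_op_scale [OF psi_at_l2 [OF a] psi_at_l2 [OF that]]
      by (simp only: matrix_operator_def restrict_apply' Hscale_Hmod psi_at_Hscale mat_op_apply [OF a])
  qed
  have bound: "Hnorm I (?W \<xi>) \<le> Hnorm (I \<times> I) ?a * Hnorm I \<xi>" if "\<xi> \<in> Hmod I" for \<xi>
    using Hnorm_mat_op_le [OF a that Hnorm_nonneg nsq_le_Hnorm [OF a]] that
    by (simp add: matrix_operator_def)
  have tensor: "?W (tensor_coords M I h f x) = continuous_coords M I h (\<lambda>r. kernel_map M w f r * x)"
    if "f \<in> Lsq M" for f and x :: "'t \<Rightarrow>\<^sub>C 'k"
    using kernel_matrix_tensor_coords [OF h w that] tensor_coords_Hmod [OF h that, where x = x]
    by (simp add: matrix_operator_def)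
  have unit: "tensor_coords M I h (h i) x = (\<lambda>j. if j = i then x else 0)" if "i \<in> I" for i and x :: "'t \<Rightarrow>\<^sub>C 'k"
  proof
    have one: "const_bcontfun 1 = (1 :: 't \<Rightarrow>\<^sub>C 'k)" by (rule bcontfun_eqI) (simp add: bcontfun_apply)
    show "tensor_coords M I h (h i) x j = (if j = i then x else 0)" for j
      using h that by (auto simp: tensor_coords_def orthonormal_basis_def one)
  qed
  show ?thesis
    unfolding integral_op_def
  proof (rule the_equality)
    show "?W \<in> Hmod I \<rightarrow>\<^sub>E Hmod I \<and>
      (\<forall>\<xi>\<in>Hmod I. \<forall>\<eta>\<in>Hmod I. ?W (\<xi> + \<eta>) = ?W \<xi> + ?W \<eta>) \<and>
      (\<forall>c. \<forall>\<xi>\<in>Hmod I. ?W (Hscale c \<xi>) = Hscale c (?W \<xi>)) \<and>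
      (\<exists>C. \<forall>\<xi>\<in>Hmod I. Hnorm I (?W \<xi>) \<le> C * Hnorm I \<xi>) \<and>
      (\<forall>f\<in>Lsq M. \<forall>x. ?W (tensor_coords M I h f x) =
        continuous_coords M I h (\<lambda>r. kernel_map M w f r * x))"
      using W add scale bound tensor by blast
    fix V
    assume V: "V \<in> Hmod I \<rightarrow>\<^sub>E Hmod I \<and>
      (\<forall>\<xi>\<in>Hmod I. \<forall>\<eta>\<in>Hmod I. V (\<xi> + \<eta>) = V \<xi> + V \<eta>) \<and>
      (\<forall>c. \<forall>\<xi>\<in>Hmod I. V (Hscale c \<xi>) = Hscale c (V \<xi>)) \<and>
      (\<exists>C. \<forall>\<xi>\<in>Hmod I. Hnorm I (V \<xi>) \<le> C * Hnorm I \<xi>) \<and>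
      (\<forall>f\<in>Lsq M. \<forall>x. V (tensor_coords M I h f x) =
        continuous_coords M I h (\<lambda>r. kernel_map M w f r * x))"
    then obtain C where C: "\<And>\<xi>. \<xi> \<in> Hmod I \<Longrightarrow> Hnorm I (V \<xi>) \<le> C * Hnorm I \<xi>" by blast
    have VH: "V \<in> Hmod I \<rightarrow>\<^sub>E Hmod I" using V by blast
    have Vadd: "V (\<xi> + \<eta>) = V \<xi> + V \<eta>" if "\<xi> \<in> Hmod I" "\<eta> \<in> Hmod I" for \<xi> \<eta>
      using V that by blast
    show "V = ?W"
    proof (rule bounded_additive_unique [OF VH W Vadd add C bound])
      fix i and x :: "'t \<Rightarrow>\<^sub>C 'k" assume i: "i \<in> I"
      have hi: "h i \<in> Lsq M" by (rule basis_Lsq [OF h i])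
      have "V (tensor_coords M I h (h i) x) = ?W (tensor_coords M I h (h i) x)"
        unfolding tensor [OF hi] using V hi by blast
      then show "V (\<lambda>j. if j = i then x else 0) = ?W (\<lambda>j. if j = i then x else 0)"
        unfolding unit [OF i] .
    qed
  qed
qed

theorem theorem7p6:
  fixes \<mu> :: "'s::t2_space measure"
    and I :: "'i set"
    and h :: "'i \<Rightarrow> 's \<Rightarrow> 'k::real_or_complex"
    and w :: "'s \<times> 's \<Rightarrow> ('t::t2_space \<Rightarrow>\<^sub>C 'k)"
  assumes "hyperstonian TYPE('t)"
    and "compact (UNIV :: 's set)"
    and "radon_measure \<mu>"
    and "orthonormal_basis \<mu> I h"
    and "continuous_on UNIV w"
  shows "integral_op \<mu> I h w \<in> hilbert_schmidt_ops I \<and>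
    adjoint_on (Hmod I) (Hinner I) (integral_op \<mu> I h w) =
      integral_op \<mu> I h (\<lambda>(r, s). star (w (s, r)))"
proof -
  have \<mu>: "finite_measure \<mu>" "sets \<mu> = sets borel"
    using assms(3) by (simp_all add: radon_measure_def)
  interpret finite_measure \<mu> by (rule \<mu>(1))
  note h = assms(4)
  have w: "regulated_kernel \<mu> w" by (rule continuous_regulated_kernel [OF assms(2,5) \<mu>(2)])
  have a: "kernel_matrix \<mu> I h w \<in> Hmod (I \<times> I)" by (rule kernel_matrix_Hmod [OF h w])
  have "integral_op \<mu> I h (adjoint_kernel w) = matrix_operator I (star_transpose (kernel_matrix \<mu> I h w))"
    unfolding integral_op_eq_matrix_operator [OF h regulated_adjoint_kernel [OF w]]
      kernel_matrix_adjoint [OF h w] ..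
  then show ?thesis
    unfolding integral_op_eq_matrix_operator [OF h w] adjoint_kernel_def
    by (simp only: matrix_operator_adjoint [OF a] matrix_operator_hilbert_schmidt [OF a])
qed

end
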